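(* Let $M\subset\mathbb R^4$ be a smooth surface parametrized near the origin by $(x,y)\mapsto(f(x,y),g(x,y),x,y)$, where the $2$-jet of $(f,g)$ at $(0,0)$ is $(f_{11}xy,\ 0)$ with $f_{11}\neq0$ (so the origin is an inflexion point of real type), and suppose that the inflexion point is generic in the sense that $$g_{22}^2-4g_{40}g_{04}\neq0\quad\text{and}\quad 9g_{30}g_{03}-g_{12}g_{21}\neq0 .$$ Then, locally, the $_V\mathcal K$ bifurcation set $\mathcal B$ of the family of contact maps of $M$ consists of the two branches of the parabolic set of $M$ through the inflexion point, and the sign attached to ordinary parabolic points changes along each branch at the inflexion point.
   Context: For $M$ parametrized as $(f(x,y),g(x,y),x,y)$, with $f,g$ smooth with zero $1$-jet at the origin, $f_{ij},g_{ij}$ denote the coefficients of $x^iy^j$ in the Taylor expansions of $f,g$ at $(0,0)$. Parabolic set: the set of parameter values (points of $M$) at which $(f_{xx}g_{yy}-f_{yy}g_{xx})^2=4(f_{xy}g_{yy}-f_{yy}g_{xy})(f_{xx}g_{xy}-f_{xy}g_{xx})$. Sign of an ordinary parabolic point: at a point of $M$, by an affine transformation of $\mathbb R^4$ taking the point to the origin, write $M$ as $(f,g,x,y)$; the point is an ordinary parabolic point if this can be done with the $2$-jet of $(f,g)$ equal to $(f_{11}xy,\ g_{20}x^2)$, $f_{11}\ne0$, $g_{20}\ne0$, $g_{04}\neq0$, and $g_{12}\ne0$ or $g_{03}\neq0$. Its sign is the sign of $g_{20}g_{04}$. Family of contact maps (contact of $M$ with its reflexion in the point of $M$ with parameters $(p,q)$):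 $$F_{(p,q)}(x,y)=\bigl(f(p+x,q+y)+f(p-x,q-y)-2f(p,q),\ g(p+x,q+y)+g(p-x,q-y)-2g(p,q)\bigr).$$ Since $F_{(p,q)}(x,y)=F_{(p,q)}(-x,-y)$ one can write $F_{(p,q)}(x,y)=H_{(p,q)}(x^2,xy,y^2)$ with $H_{(p,q)}:(\mathbb R^3,0)\to(\mathbb R^2,0)$ smooth in $(u,v,w)=(x^2,xy,y^2)$. $_V\mathcal K$ bifurcation set $\mathcal B$ (as a germ at the base point): the set of $(p,q)$ for which there is $(x,y)$ (near the origin) at which $F_{(p,q)}$ has an unstable singularity with respect to $\mathcal K$-equivalence of maps symmetric under $(x,y)\mapsto(-x,-y)$. Concretely, it is stratified by constancy of the contact data: the multiplicities of the intersections of $H_{(p,q)}^{-1}(0)$ with the half-cone $V: v^2=uw,\ u\ge0,\ w\ge0$, in an arbitrarily small neighbourhood of the origin of $\mathbb R^3$. A parameter $(p,q)$ belongs to $\mathcal B$ when either the intersection at the origin has multiplicity greater than its minimal (generic, stable) value, or there is an intersection point of $H_{(p,q)}^{-1}(0)$ with $V$ away from the origin of multiplicity greater than $1$ (i.e. a tangency).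
   Formalization: The genericity assumption is completed by g_40 ≠ 0 and g_04 ≠ 0; without them the claim is false: for f = xy, g = x^3+y^3+x^2y^2+xy^4 both printed conditions hold, but the sign does not change along the branch g_yy = 0. *)

theory Defs
  imports "HOL-Analysis.Analysis" "HOL-Library.Extended_Nat"
begin

section \<open>Smooth maps\<close>

text \<open>The predicates are meant for open sets only, where they are the usual
  \<open>C\<^sup>k\<close> and \<open>C\<^sup>\<infinity>\<close>: differentiable, with all first order
  partial derivatives of class \<open>C\<^sup>k\<close>.\<close>

primrec Ck_on :: "nat \<Rightarrow> 'a::euclidean_space set \<Rightarrow> ('a \<Rightarrow> 'b::real_normed_vector) \<Rightarrow> bool" where
  "Ck_on 0 U h \<longleftrightarrow> continuous_on U h"
| "Ck_on (Suc k) U h \<longleftrightarrow> (\<forall>x\<in>U. h differentiable (at x)) \<and>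
     (\<forall>i\<in>Basis. Ck_on k U (\<lambda>x. frechet_derivative h (at x) i))"

definition smooth_on :: "'a::euclidean_space set \<Rightarrow> ('a \<Rightarrow> 'b::real_normed_vector) \<Rightarrow> bool" where
  "smooth_on U h \<longleftrightarrow> (\<forall>k. Ck_on k U h)"

definition smooth_at :: "'a::euclidean_space \<Rightarrow> ('a \<Rightarrow> 'b::real_normed_vector) \<Rightarrow> bool" where
  "smooth_at P h \<longleftrightarrow> (\<exists>U. open U \<and> P \<in> U \<and> smooth_on U h)"

definition dx :: "(real \<times> real \<Rightarrow> real) \<Rightarrow> real \<times> real \<Rightarrow> real" where
  "dx h = (\<lambda>z. frechet_derivative h (at z) (1, 0))"

definition dy :: "(real \<times> real \<Rightarrow> real) \<Rightarrow> real \<times> real \<Rightarrow> real" where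
  "dy h = (\<lambda>z. frechet_derivative h (at z) (0, 1))"

text \<open>Coefficient of \<open>x^i y^j\<close> in the Taylor expansion at the origin.\<close>

definition taylor_coeff :: "(real \<times> real \<Rightarrow> real) \<Rightarrow> nat \<Rightarrow> nat \<Rightarrow> real" where
  "taylor_coeff h i j = (dx ^^ i) ((dy ^^ j) h) (0, 0) / (fact i * fact j)"

text \<open>The 2-jet of \<open>h\<close> at the origin is \<open>a x^2 + b x y + c y^2\<close>.\<close>

definition two_jet_eq :: "(real \<times> real \<Rightarrow> real) \<Rightarrow> real \<Rightarrow> real \<Rightarrow> real \<Rightarrow> bool" where
  "two_jet_eq h a b c \<longleftrightarrow>
     taylor_coeff h 0 0 = 0 \<and> taylor_coeff h 1 0 = 0 \<and> taylor_coeff h 0 1 = 0 \<and>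
     taylor_coeff h 2 0 = a \<and> taylor_coeff h 1 1 = b \<and> taylor_coeff h 0 2 = c"

section \<open>Surfaces in 4-space and their parabolic points\<close>

type_synonym R4 = "real \<times> real \<times> real \<times> real"

definition surface_point :: "(real \<times> real \<Rightarrow> real) \<Rightarrow> (real \<times> real \<Rightarrow> real) \<Rightarrow> real \<times> real \<Rightarrow> R4" where
  "surface_point f g z = (f z, g z, z)"

definition surface :: "(real \<times> real \<Rightarrow> real) \<Rightarrow> (real \<times> real \<Rightarrow> real) \<Rightarrow> (real \<times> real) set \<Rightarrow> R4 set" where
  "surface f g W = surface_point f g ` W"

definition parabolic_set ::
    "(real \<times> real \<Rightarrow> real) \<Rightarrow> (real \<times> real \<Rightarrow> real) \<Rightarrow> (real \<times> real) set \<Rightarrow> (real \<times> real) set" where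
  "parabolic_set f g W = {z \<in> W.
     (dx (dx f) z * dy (dy g) z - dy (dy f) z * dx (dx g) z)\<^sup>2 =
       4 * (dx (dy f) z * dy (dy g) z - dy (dy f) z * dx (dy g) z)
         * (dx (dx f) z * dx (dy g) z - dx (dy f) z * dx (dx g) z)}"

text \<open>The surface is, near its point with parameters \<open>z\<close> and up to an affine transformation
  \<open>v \<mapsto> A (v - surface_point f g z)\<close> of 4-space, the graph of \<open>(f', g')\<close> over a
  neighbourhood \<open>W'\<close> of the origin, in the normal form of an ordinary parabolic point.\<close>

definition ordinary_parabolic_form ::
    "(real \<times> real \<Rightarrow> real) \<Rightarrow> (real \<times> real \<Rightarrow> real) \<Rightarrow> (real \<times> real) set \<Rightarrow> real \<times> real
     \<Rightarrow> (real \<times> real \<Rightarrow> real) \<Rightarrow> (real \<times> real \<Rightarrow> real) \<Rightarrow> bool" where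
  "ordinary_parabolic_form f g W z f' g' \<longleftrightarrow>
     (\<exists>(A :: R4 \<Rightarrow> R4) N W'.
        linear A \<and> bij A \<and> open N \<and> surface_point f g z \<in> N \<and>
        open W' \<and> 0 \<in> W' \<and> smooth_on W' f' \<and> smooth_on W' g' \<and>
        (\<lambda>v. A (v - surface_point f g z)) ` (surface f g W \<inter> N) = surface f' g' W') \<and>
     (\<exists>f11 g20. f11 \<noteq> 0 \<and> g20 \<noteq> 0 \<and> two_jet_eq f' 0 f11 0 \<and> two_jet_eq g' g20 0 0) \<and>
     taylor_coeff g' 0 4 \<noteq> 0 \<and>
     (taylor_coeff g' 1 2 \<noteq> 0 \<or> taylor_coeff g' 0 3 \<noteq> 0)"

definition ordinary_parabolic_point ::
    "(real \<times> real \<Rightarrow> real) \<Rightarrow> (real \<times> real \<Rightarrow> real) \<Rightarrow> (real \<times> real) set \<Rightarrow> real \<times> real \<Rightarrow> bool" where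
  "ordinary_parabolic_point f g W z \<longleftrightarrow>
     z \<in> W \<and> (\<exists>f' g'. ordinary_parabolic_form f g W z f' g')"

text \<open>The sign does not depend on the normal form chosen, so that the description below is
  meaningful at every ordinary parabolic point.\<close>

definition parabolic_sign ::
    "(real \<times> real \<Rightarrow> real) \<Rightarrow> (real \<times> real \<Rightarrow> real) \<Rightarrow> (real \<times> real) set \<Rightarrow> real \<times> real \<Rightarrow> real" where
  "parabolic_sign f g W z =
     (THE s. \<exists>f' g'. ordinary_parabolic_form f g W z f' g' \<and>
        s = sgn (taylor_coeff g' 2 0 * taylor_coeff g' 0 4))"

text \<open>An embedded regular smooth arc.\<close>

definition smooth_arc :: "(real \<Rightarrow> real \<times> real) \<Rightarrow> bool" where
  "smooth_arc \<gamma> \<longleftrightarrow> smooth_on {-1<..<1} \<gamma> \<and>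
     (\<forall>t\<in>{-1<..<1}. vector_derivative \<gamma> (at t) \<noteq> 0) \<and>
     (\<exists>h. homeomorphism {-1<..<1} (\<gamma> ` {-1<..<1}) \<gamma> h)"

section \<open>Contact maps and the bifurcation set\<close>

definition contact_map ::
    "(real \<times> real \<Rightarrow> real) \<Rightarrow> (real \<times> real \<Rightarrow> real) \<Rightarrow> real \<times> real \<Rightarrow> real \<times> real \<Rightarrow> real \<times> real" where
  "contact_map f g = (\<lambda>(p, q) (x, y).
     (f (p + x, q + y) + f (p - x, q - y) - 2 * f (p, q),
      g (p + x, q + y) + g (p - x, q - y) - 2 * g (p, q)))"

text \<open>\<open>H\<close> is a smooth representation \<open>F(x,y) = H(x^2, xy, y^2)\<close> of the contact maps with parameter
  near the origin. Such an \<open>H\<close> exists because the contact maps are even, but it is not unique.\<close>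

definition represents_contact_maps ::
    "(real \<times> real \<Rightarrow> real) \<Rightarrow> (real \<times> real \<Rightarrow> real)
     \<Rightarrow> (real \<times> real \<Rightarrow> real \<times> real \<times> real \<Rightarrow> real \<times> real) \<Rightarrow> bool" where
  "represents_contact_maps f g H \<longleftrightarrow>
     (\<exists>\<delta>>0. \<exists>\<rho>>0. \<forall>z\<in>ball 0 \<delta>. smooth_on (ball 0 \<rho>) (H z) \<and>
        (\<forall>x y. (x\<^sup>2, x * y, y\<^sup>2) \<in> ball 0 \<rho> \<longrightarrow>
           contact_map f g z (x, y) = H z (x\<^sup>2, x * y, y\<^sup>2)))"

definition half_cone :: "(real \<times> real \<times> real) set" where
  "half_cone = {(u, v, w). v\<^sup>2 = u * w \<and> u \<ge> 0 \<and> w \<ge> 0}"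

text \<open>Dimension over the reals of the quotient of the ring of germs at \<open>P\<close> of smooth functions by
  the ideal generated by the finite set \<open>\<Phi>\<close>, obtained as the least size of a set \<open>E\<close> of germs that
  spans the quotient.\<close>

definition local_multiplicity :: "('a::euclidean_space \<Rightarrow> real) set \<Rightarrow> 'a \<Rightarrow> enat" where
  "local_multiplicity \<Phi> P =
     (INF E \<in> {E. finite E \<and> (\<forall>e\<in>E. smooth_at P e) \<and>
          (\<forall>h. smooth_at P h \<longrightarrow>
             (\<exists>c a. (\<forall>\<phi>\<in>\<Phi>. smooth_at P (a \<phi>)) \<and>
                (\<forall>\<^sub>F X in nhds P. h X = (\<Sum>e\<in>E. c e * e X) + (\<Sum>\<phi>\<in>\<Phi>. a \<phi> X * \<phi> X))))}.
        enat (card E))"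

text \<open>Multiplicity of the intersection of \<open>{G = 0}\<close> with the cone at a point of both.\<close>

definition cone_multiplicity ::
    "(real \<times> real \<times> real \<Rightarrow> real \<times> real) \<Rightarrow> real \<times> real \<times> real \<Rightarrow> enat" where
  "cone_multiplicity G P =
     local_multiplicity {fst \<circ> G, snd \<circ> G, (\<lambda>(u, v, w). v\<^sup>2 - u * w)} P"

definition minimal_vertex_multiplicity :: enat where
  "minimal_vertex_multiplicity =
     (INF G \<in> {G :: real \<times> real \<times> real \<Rightarrow> real \<times> real. smooth_at 0 G \<and> G 0 = 0}.
        cone_multiplicity G 0)"

text \<open>Representative of the bifurcation set in which intersection points at distance less than
  \<open>\<epsilon>\<close> from the vertex are taken into account.\<close>

definition bifurcation_set ::
    "(real \<times> real \<Rightarrow> real \<times> real \<times> real \<Rightarrow> real \<times> real) \<Rightarrow> real \<Rightarrow> (real \<times> real) set" where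
  "bifurcation_set H \<epsilon> = {z.
     cone_multiplicity (H z) 0 > minimal_vertex_multiplicity \<or>
     (\<exists>P \<in> half_cone \<inter> ball 0 \<epsilon>. P \<noteq> 0 \<and> H z P = 0 \<and> cone_multiplicity (H z) P > 1)}"

end

theory Submission
  imports Defs
begin

text \<open>Write \<open>f''\<close> and \<open>g''\<close> for the Hessian quadratic forms of \<open>f\<close> and \<open>g\<close> at the parameter value \<open>z\<close>.

The contact map is \<open>F(X) = (f''(X,X), g''(X,X))\<close> up to terms of order four, so the gradients of the two
components of \<open>H z\<close> at the vertex are the coefficient vectors of \<open>f''\<close> and \<open>g''\<close>. The cross product \<open>n\<close> of
these vectors is the tangent direction at the vertex of the curve \<open>H z = 0\<close>. The intersection of this curve with the
cone \<open>q = v\<^sup>2 - u w = 0\<close> has the minimal multiplicity 2 when \<open>q(n) \<noteq> 0\<close>, and multiplicity at least 3 when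
\<open>q(n) = 0\<close>. But \<open>q(n)\<close> is the resultant of \<open>f''\<close> and \<open>g''\<close>, and its vanishing is the equation of the parabolic
set (\<open>multiplicity_le_2_vertex\<close>, \<open>vertex_multiplicity_ge_3\<close>, \<open>vertex_multiplicity_parabolic\<close>).

Intersection points other than the vertex correspond to zeros \<open>X \<noteq> 0\<close> of \<open>F\<close>, and they are multiple only if the
Jacobian determinant of \<open>F\<close> vanishes at \<open>X\<close>. Near the inflexion point this does not occur (\<open>no_tangency\<close>).
The equation \<open>f\<^sub>1\<^sub>1 x y + \<dots> = 0\<close> forces \<open>X\<close> to be almost parallel to an axis. The expression \<open>D\<^sub>X F - 2 F\<close>
annihilates the quadratic part of \<open>F\<close>. At a degenerate zero it equals \<open>D\<^sub>X F\<close>, whose component belonging to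
\<open>g\<close> is a small multiple of the component belonging to \<open>f\<close>, since the gradients of the two components of \<open>F\<close> are
proportional. But the component belonging to \<open>g\<close> is of exact order four, because \<open>g\<^sub>4\<^sub>0\<close> and \<open>g\<^sub>0\<^sub>4\<close> do not vanish, while
the other one is of order at least four. So the bifurcation set is the parabolic set
(\<open>bifurcation_set_eq_parabolic_set\<close>).

As \<open>f''(X,X)\<close> is close to \<open>2 f\<^sub>1\<^sub>1 x y\<close>, it has two roots \<open>e\<^sub>1\<close> and \<open>e\<^sub>2\<close> depending smoothly on \<open>z\<close>, and the resultant is, up
to a unit, the product of \<open>G\<^sub>1 = g''(e\<^sub>1,e\<^sub>1)\<close> and \<open>G\<^sub>2 = g''(e\<^sub>2,e\<^sub>2)\<close>. The condition \<open>9 g\<^sub>3\<^sub>0 g\<^sub>0\<^sub>3 \<noteq> g\<^sub>1\<^sub>2 g\<^sub>2\<^sub>1\<close> says that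
\<open>(G\<^sub>1, G\<^sub>2)\<close> is a local diffeomorphism, so the parabolic set is a pair of transversal arcs, on each of which the
other one of the two functions is a multiple of the parameter (\<open>node_branches\<close>).

On the branch \<open>G\<^sub>1 = 0\<close>, the direction \<open>e = e\<^sub>1\<close> is a common root of \<open>f''\<close> and \<open>g''\<close>, and there is a unique
combination \<open>h = g - \<lambda> f\<close> with \<open>h''(e, \<cdot>) = 0\<close>. In the basis formed by \<open>k = e\<^sub>2\<close> and \<open>e\<close>, the functions \<open>f\<close> and \<open>h\<close>
are in normal form up to their first order terms, and the sign is that of \<open>h''(k,k) D\<^sub>e\<^sup>4 h = G\<^sub>2 D\<^sub>e\<^sup>4 h\<close>; every other normal
form gives the same sign (\<open>normal_form_sign\<close>). Near the inflexion point \<open>D\<^sub>e\<^sup>4 h\<close> keeps the sign of \<open>g\<^sub>4\<^sub>0\<close>, while \<open>G\<^sub>2\<close> is a multiple of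
the parameter of the arc, so the sign changes. The nondegeneracy of the cubic terms holds because \<open>g\<^sub>3\<^sub>0\<close> and \<open>g\<^sub>2\<^sub>1\<close>
do not both vanish. The other branch is symmetric.\<close>

section \<open>Smooth functions\<close>

text \<open>The direction comes first, so that \<open>dd v\<close> is an operator on functions that can be iterated.\<close>

definition dd :: "'a::euclidean_space \<Rightarrow> ('a \<Rightarrow> 'b::real_normed_vector) \<Rightarrow> 'a \<Rightarrow> 'b" where
  "dd v h = (\<lambda>x. frechet_derivative h (at x) v)"

lemma Ck_on_Suc_dd:
  "Ck_on (Suc k) U h \<longleftrightarrow> (\<forall>x\<in>U. h differentiable (at x)) \<and> (\<forall>i\<in>Basis. Ck_on k U (dd i h))"
  by (simp add: dd_def)

lemma dd_unique: "(h has_derivative D) (at x) \<Longrightarrow> dd v h x = D v"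
  unfolding dd_def using frechet_derivative_at by metis

lemma has_derivative_dd:
  "h differentiable (at x) \<Longrightarrow> (h has_derivative (\<lambda>v. dd v h x)) (at x)"
  unfolding dd_def by (simp add: frechet_derivative_works)

lemma dd_cong_open:
  assumes "open U" "x \<in> U" "\<And>y. y \<in> U \<Longrightarrow> h y = h' y"
  shows "dd v h x = dd v h' x"
proof -
  have "(h has_derivative D) (at x) \<longleftrightarrow> (h' has_derivative D) (at x)" for D
    using assms by (metis has_derivative_transform_within_open)
  then show ?thesis by (simp add: dd_def frechet_derivative_def)
qed

lemma dd_linear_expand:
  assumes "h differentiable (at x)"
  shows "dd v h x = (\<Sum>b\<in>Basis. (v \<bullet> b) *\<^sub>R dd b h x)"
proof -
  have l: "linear (\<lambda>v. dd v h x)"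
    unfolding dd_def by (rule linear_frechet_derivative[OF assms])
  have "dd v h x = dd (\<Sum>b\<in>Basis. (v \<bullet> b) *\<^sub>R b) h x"
    by (simp add: euclidean_representation)
  also have "\<dots> = (\<Sum>b\<in>Basis. (v \<bullet> b) *\<^sub>R dd b h x)"
    using linear_sum[OF l, of "\<lambda>b. (v \<bullet> b) *\<^sub>R b" Basis] linear_cmul[OF l] by simp
  finally show ?thesis .
qed

lemma dd_linear: "h differentiable (at x) \<Longrightarrow> linear (\<lambda>v. dd v h x)"
  unfolding dd_def by (rule linear_frechet_derivative)

lemma differentiable_cong_open:
  assumes "open U" "x \<in> U" "\<And>y. y \<in> U \<Longrightarrow> h y = h' y" "h differentiable (at x)"
  shows "h' differentiable (at x)"
  using assms by (metis differentiable_def has_derivative_transform_within_open)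

lemma Ck_on_cong:
  assumes "open U" "\<And>x. x \<in> U \<Longrightarrow> h x = h' x" "Ck_on k U h"
  shows "Ck_on k U h'"
  using assms
proof (induction k arbitrary: h h')
  case 0
  then show ?case using continuous_on_cong by fastforce
next
  case (Suc k)
  have "Ck_on k U (dd i h')" if "i \<in> Basis" for i
  proof (rule Suc.IH[OF Suc.prems(1)])
    show "dd i h x = dd i h' x" if "x \<in> U" for x
      using dd_cong_open[OF Suc.prems(1) that Suc.prems(2)] .
    show "Ck_on k U (dd i h)" using Suc.prems(3) that unfolding Ck_on_Suc_dd by blast
  qed
  moreover have "h' differentiable at x" if "x \<in> U" for x
    using differentiable_cong_open[OF Suc.prems(1) that Suc.prems(2)] Suc.prems(3) that by simp
  ultimately show ?case unfolding Ck_on_Suc_dd by blast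
qed

lemma Ck_on_subset: "Ck_on k U h \<Longrightarrow> V \<subseteq> U \<Longrightarrow> Ck_on k V h"
  by (induction k arbitrary: h) (auto intro: continuous_on_subset)

lemma Ck_on_continuous: "Ck_on k U h \<Longrightarrow> continuous_on U h"
  by (cases k) (auto intro!: continuous_at_imp_continuous_on differentiable_imp_continuous_within)

lemma Ck_on_SucD: "Ck_on (Suc k) U h \<Longrightarrow> Ck_on k U h"
proof (induction k arbitrary: h)
  case 0
  then show ?case using Ck_on_continuous[of "Suc 0"] by (metis Ck_on.simps(1))
next
  case (Suc k)
  then show ?case using Ck_on_Suc_dd by blast
qed

lemma Ck_on_const: "Ck_on k (U :: 'a::euclidean_space set) (\<lambda>x. c)"
proof (induction k arbitrary: c)
  case (Suc k)
  have "dd i (\<lambda>x. c) = (\<lambda>x. 0)" for i :: 'a by (simp add: dd_def fun_eq_iff)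
  then show ?case unfolding Ck_on_Suc_dd using Suc by simp
qed simp

lemma Ck_on_linear:
  assumes "bounded_linear L"
  shows "Ck_on k U L"
proof (cases k)
  case 0
  then show ?thesis
    using linear_continuous_on[OF assms] by simp
next
  case (Suc k')
  have "dd i L = (\<lambda>x. L i)" for i
    using dd_unique[OF bounded_linear_imp_has_derivative[OF assms]] by (simp add: fun_eq_iff)
  then show ?thesis
    unfolding Suc Ck_on_Suc_dd
    using Ck_on_const bounded_linear_imp_differentiable[OF assms] by auto
qed

lemma Ck_on_add:
  assumes "open U" "Ck_on k U h" "Ck_on k U h'"
  shows "Ck_on k U (\<lambda>x. h x + h' x)"
  using assms(2,3)
proof (induction k arbitrary: h h')
  case 0
  then show ?case by (simp add: continuous_on_add)
next
  case (Suc k)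
  have d: "h differentiable at x" "h' differentiable at x" if "x \<in> U" for x
    using that Suc.prems by auto
  have "dd i h x + dd i h' x = dd i (\<lambda>x. h x + h' x) x" if "x \<in> U" for x i
    using dd_unique[OF has_derivative_add[OF has_derivative_dd[OF d(1)[OF that]] has_derivative_dd[OF d(2)[OF that]]]]
    by simp
  moreover have "Ck_on k U (\<lambda>x. dd i h x + dd i h' x)" if "i \<in> Basis" for i
    using Suc that unfolding Ck_on_Suc_dd by blast
  ultimately have "Ck_on k U (dd i (\<lambda>x. h x + h' x))" if "i \<in> Basis" for i
    using Ck_on_cong[OF assms(1)] that by (metis (no_types, lifting))
  then show ?case
    unfolding Ck_on_Suc_dd using d by (auto intro!: derivative_intros)
qed

text \<open>All product rules (products, scaling, inner products) are instances, so the induction on \<open>k\<close> is done once.\<close>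

lemma Ck_on_bilinear:
  assumes "bounded_bilinear p" "open U" "Ck_on k U h" "Ck_on k U h'"
  shows "Ck_on k U (\<lambda>x. p (h x) (h' x))"
  using assms(3,4)
proof (induction k arbitrary: h h')
  case 0
  then show ?case by (simp add: bounded_bilinear.continuous_on[OF assms(1)])
next
  case (Suc k)
  have d: "h differentiable at x" "h' differentiable at x" if "x \<in> U" for x
    using that Suc.prems by auto
  have D: "((\<lambda>x. p (h x) (h' x)) has_derivative (\<lambda>v. p (h x) (dd v h' x) + p (dd v h x) (h' x))) (at x)"
    if "x \<in> U" for x
    using bounded_bilinear.FDERIV[OF assms(1) has_derivative_dd[OF d(1)[OF that]] has_derivative_dd[OF d(2)[OF that]]] .
  have e: "p (h x) (dd i h' x) + p (dd i h x) (h' x) = dd i (\<lambda>x. p (h x) (h' x)) x" if "x \<in> U" for x i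
    using dd_unique[OF D[OF that]] by simp
  have c: "Ck_on k U (\<lambda>x. p (h x) (dd i h' x) + p (dd i h x) (h' x))" if "i \<in> Basis" for i
  proof (rule Ck_on_add[OF assms(2)]; rule Suc.IH)
    show "Ck_on k U h" "Ck_on k U h'" using Suc.prems Ck_on_SucD by blast+
    show "Ck_on k U (dd i h)" "Ck_on k U (dd i h')"
      using Suc.prems that unfolding Ck_on_Suc_dd by blast+
  qed
  have "Ck_on k U (dd i (\<lambda>x. p (h x) (h' x)))" if "i \<in> Basis" for i
    by (rule Ck_on_cong[OF assms(2) _ c[OF that]]) (rule e)
  moreover have "(\<lambda>x. p (h x) (h' x)) differentiable at x" if "x \<in> U" for x
    using D[OF that] by (rule differentiableI)
  ultimately show ?case
    unfolding Ck_on_Suc_dd by blast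
qed

lemma Ck_on_sum:
  assumes "open U" "\<And>i. i \<in> I \<Longrightarrow> Ck_on k U (h i)"
  shows "Ck_on k U (\<lambda>x. \<Sum>i\<in>I. h i x)"
  using assms(2)
  by (induction I rule: infinite_finite_induct) (auto intro!: Ck_on_const Ck_on_add[OF assms(1)])

lemma Ck_on_dd:
  assumes "open U" "Ck_on (Suc k) U h"
  shows "Ck_on k U (dd v h)"
proof (rule Ck_on_cong[OF assms(1)])
  show "(\<Sum>b\<in>Basis. (v \<bullet> b) *\<^sub>R dd b h x) = dd v h x" if "x \<in> U" for x
    using dd_linear_expand[of h x v] assms(2) that by simp
  show "Ck_on k U (\<lambda>x. \<Sum>b\<in>Basis. (v \<bullet> b) *\<^sub>R dd b h x)"
    using assms(2) unfolding Ck_on_Suc_dd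
    by (intro Ck_on_sum[OF assms(1)] Ck_on_bilinear[OF bounded_bilinear_scaleR assms(1)] Ck_on_const) auto
qed

text \<open>By the chain rule, the derivative of a composition is a sum of products of derivatives of the inner map with compositions of the same kind, which are one class better by induction.\<close>

lemma Ck_on_compose:
  fixes f :: "'a::euclidean_space \<Rightarrow> 'b::euclidean_space" and g :: "'b \<Rightarrow> 'c::real_normed_vector"
  assumes "open U" "open V" "f ` U \<subseteq> V" "Ck_on k U f" "Ck_on k V g"
  shows "Ck_on k U (\<lambda>x. g (f x))"
  using assms(4,5)
proof (induction k arbitrary: g)
  case 0
  then show ?case using assms(3) by (auto intro: continuous_on_compose2)
next
  case (Suc k)
  have d: "f differentiable at x" "g differentiable at (f x)" if "x \<in> U" for x
    using that Suc.prems assms(3) by auto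
  have D: "((\<lambda>x. g (f x)) has_derivative (\<lambda>v. dd (dd v f x) g (f x))) (at x)" if "x \<in> U" for x
    using diff_chain_at[OF has_derivative_dd[OF d(1)[OF that]] has_derivative_dd[OF d(2)[OF that]]]
    by (simp add: o_def)
  have e: "(\<Sum>b\<in>Basis. (dd i f x \<bullet> b) *\<^sub>R dd b g (f x)) = dd i (\<lambda>x. g (f x)) x" if "x \<in> U" for x i
    using dd_unique[OF D[OF that]] dd_linear_expand[OF d(2)[OF that]] by metis
  have c: "Ck_on k U (\<lambda>x. \<Sum>b\<in>Basis. (dd i f x \<bullet> b) *\<^sub>R dd b g (f x))" if "i \<in> Basis" for i
  proof (intro Ck_on_sum[OF assms(1)] Ck_on_bilinear[OF bounded_bilinear_scaleR assms(1)]
       Ck_on_bilinear[OF bounded_bilinear_inner assms(1)] Ck_on_const)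
    show "Ck_on k U (dd i f)" using Suc.prems that unfolding Ck_on_Suc_dd by blast
    show "Ck_on k U (\<lambda>x. dd b g (f x))" if "b \<in> Basis" for b
      using Suc.IH Ck_on_SucD[OF Suc.prems(1)] Suc.prems(2) that unfolding Ck_on_Suc_dd by blast
  qed
  have "Ck_on k U (dd i (\<lambda>x. g (f x)))" if "i \<in> Basis" for i
    by (rule Ck_on_cong[OF assms(1) _ c[OF that]]) (rule e)
  moreover have "(\<lambda>x. g (f x)) differentiable at x" if "x \<in> U" for x
    using D[OF that] by (rule differentiableI)
  ultimately show ?case
    unfolding Ck_on_Suc_dd by blast
qed

lemma smooth_on_cong:
  "open U \<Longrightarrow> (\<And>x. x \<in> U \<Longrightarrow> h x = h' x) \<Longrightarrow> smooth_on U h \<Longrightarrow> smooth_on U h'"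
  unfolding smooth_on_def using Ck_on_cong by blast

lemma smooth_on_subset: "smooth_on U h \<Longrightarrow> V \<subseteq> U \<Longrightarrow> smooth_on V h"
  unfolding smooth_on_def using Ck_on_subset by blast

lemma smooth_on_continuous: "smooth_on U h \<Longrightarrow> continuous_on U h"
  unfolding smooth_on_def using Ck_on_continuous by blast

lemma smooth_on_differentiable:
  assumes "smooth_on U h" "x \<in> U"
  shows "h differentiable (at x)"
proof -
  have "Ck_on (Suc 0) U h" using assms(1) unfolding smooth_on_def by blast
  then show ?thesis using assms(2) by simp
qed

lemma smooth_on_isCont:
  assumes "smooth_on U h" "x \<in> U"
  shows "isCont h x"
proof -
  have "h differentiable (at x)" by (rule smooth_on_differentiable[OF assms])
  then show ?thesis using differentiable_imp_continuous_within by metis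
qed

lemma smooth_on_has_derivative:
  "smooth_on U h \<Longrightarrow> x \<in> U \<Longrightarrow> (h has_derivative (\<lambda>v. dd v h x)) (at x)"
  by (rule has_derivative_dd[OF smooth_on_differentiable])

lemma smooth_on_const [simp]: "smooth_on U (\<lambda>x. c)"
  unfolding smooth_on_def using Ck_on_const by blast

lemma smooth_on_linear: "bounded_linear L \<Longrightarrow> smooth_on U L"
  unfolding smooth_on_def using Ck_on_linear by blast

lemma smooth_on_dd: "open U \<Longrightarrow> smooth_on U h \<Longrightarrow> smooth_on U (dd v h)"
  unfolding smooth_on_def using Ck_on_dd by blast

lemma smooth_on_add: "open U \<Longrightarrow> smooth_on U h \<Longrightarrow> smooth_on U h' \<Longrightarrow> smooth_on U (\<lambda>x. h x + h' x)"
  unfolding smooth_on_def using Ck_on_add by blast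

lemma smooth_on_sum:
  "open U \<Longrightarrow> (\<And>i. i \<in> I \<Longrightarrow> smooth_on U (h i)) \<Longrightarrow> smooth_on U (\<lambda>x. \<Sum>i\<in>I. h i x)"
  unfolding smooth_on_def by (auto intro!: Ck_on_sum)

lemma smooth_on_bilinear:
  "bounded_bilinear p \<Longrightarrow> open U \<Longrightarrow> smooth_on U h \<Longrightarrow> smooth_on U h' \<Longrightarrow> smooth_on U (\<lambda>x. p (h x) (h' x))"
  unfolding smooth_on_def using Ck_on_bilinear by blast

lemmas smooth_on_scaleR = smooth_on_bilinear[OF bounded_bilinear_scaleR]

lemma smooth_on_mult:
  fixes h h' :: "'a::euclidean_space \<Rightarrow> real"
  shows "open U \<Longrightarrow> smooth_on U h \<Longrightarrow> smooth_on U h' \<Longrightarrow> smooth_on U (\<lambda>x. h x * h' x)"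
  by (rule smooth_on_bilinear[OF bounded_bilinear_mult])

lemma smooth_on_compose:
  fixes f :: "'a::euclidean_space \<Rightarrow> 'b::euclidean_space" and g :: "'b \<Rightarrow> 'c::real_normed_vector"
  shows "open U \<Longrightarrow> open V \<Longrightarrow> f ` U \<subseteq> V \<Longrightarrow> smooth_on U f \<Longrightarrow> smooth_on V g \<Longrightarrow> smooth_on U (\<lambda>x. g (f x))"
  unfolding smooth_on_def using Ck_on_compose by blast

lemma smooth_on_bounded_linear_compose:
  fixes h :: "'a::euclidean_space \<Rightarrow> 'b::euclidean_space"
  shows "open U \<Longrightarrow> bounded_linear L \<Longrightarrow> smooth_on U h \<Longrightarrow> smooth_on U (\<lambda>x. L (h x))"
  using smooth_on_compose[of U UNIV h L] smooth_on_linear[of L UNIV] by auto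

lemma smooth_on_minus:
  fixes h :: "'a::euclidean_space \<Rightarrow> real"
  shows "open U \<Longrightarrow> smooth_on U h \<Longrightarrow> smooth_on U (\<lambda>x. - h x)"
  using smooth_on_mult[of U "\<lambda>x. -1" h] by simp

lemma smooth_on_diff:
  fixes h h' :: "'a::euclidean_space \<Rightarrow> real"
  shows "open U \<Longrightarrow> smooth_on U h \<Longrightarrow> smooth_on U h' \<Longrightarrow> smooth_on U (\<lambda>x. h x - h' x)"
  using smooth_on_add[of U h "\<lambda>x. - h' x"] smooth_on_minus[of U h'] by simp

lemma smooth_on_power:
  fixes h :: "'a::euclidean_space \<Rightarrow> real"
  shows "open U \<Longrightarrow> smooth_on U h \<Longrightarrow> smooth_on U (\<lambda>x. h x ^ n)"
  by (induction n) (auto intro: smooth_on_mult)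

lemma smooth_on_id: "smooth_on U (\<lambda>x. x)"
  by (rule smooth_on_linear[OF bounded_linear_ident])

lemma smooth_on_Pair:
  fixes h :: "'a::euclidean_space \<Rightarrow> 'b::euclidean_space" and h' :: "'a \<Rightarrow> 'c::euclidean_space"
  assumes "open U" "smooth_on U h" "smooth_on U h'"
  shows "smooth_on U (\<lambda>x. (h x, h' x))"
proof -
  have "smooth_on U (\<lambda>x. (h x, 0) + (0, h' x))"
    by (intro smooth_on_add smooth_on_bounded_linear_compose[OF assms(1) _ assms(2), where L="\<lambda>x. (x,0)"]
        smooth_on_bounded_linear_compose[OF assms(1) _ assms(3), where L="\<lambda>x. (0,x)"] assms(1)
        bounded_linear_Pair bounded_linear_ident bounded_linear_zero)
  then show ?thesis by simp
qed

lemma smooth_on_fst: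
  fixes h :: "'a::euclidean_space \<Rightarrow> 'b::euclidean_space \<times> 'c::euclidean_space"
  shows "open U \<Longrightarrow> smooth_on U h \<Longrightarrow> smooth_on U (\<lambda>x. fst (h x))"
  using smooth_on_bounded_linear_compose[OF _ bounded_linear_fst] .

lemma smooth_on_snd:
  fixes h :: "'a::euclidean_space \<Rightarrow> 'b::euclidean_space \<times> 'c::euclidean_space"
  shows "open U \<Longrightarrow> smooth_on U h \<Longrightarrow> smooth_on U (\<lambda>x. snd (h x))"
  using smooth_on_bounded_linear_compose[OF _ bounded_linear_snd] .

text \<open>Bootstrapping: when the derivatives of \<open>h\<close> are expressed through \<open>h\<close> itself and smooth functions, every
gain of regularity of \<open>h\<close> is passed on to its derivatives. Reciprocals, square roots and inverse functions are of this kind.\<close>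

lemma Ck_on_bootstrap:
  assumes "open U" and cont: "continuous_on U h"
    and der: "\<And>x. x \<in> U \<Longrightarrow> h differentiable (at x)"
    and step: "\<And>k i. i \<in> Basis \<Longrightarrow> Ck_on k U h \<Longrightarrow> Ck_on k U (dd i h)"
  shows "smooth_on U h"
  unfolding smooth_on_def
proof
  show "Ck_on k U h" for k
    by (induction k) (auto simp: cont Ck_on_Suc_dd der step simp del: Ck_on.simps(2))
qed

lemma smooth_on_inverse:
  fixes h :: "'a::euclidean_space \<Rightarrow> real"
  assumes "open U" "smooth_on U h" "\<And>x. x \<in> U \<Longrightarrow> h x \<noteq> 0"
  shows "smooth_on U (\<lambda>x. inverse (h x))"
proof (rule Ck_on_bootstrap[OF assms(1)])
  have D: "((\<lambda>x. inverse (h x)) has_derivative (\<lambda>v. - (inverse (h x) * dd v h x * inverse (h x)))) (at x)"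
    if "x \<in> U" for x
    using Deriv.has_derivative_inverse[OF assms(3)[OF that] smooth_on_has_derivative[OF assms(2) that]] .
  show "continuous_on U (\<lambda>x. inverse (h x))"
    using smooth_on_continuous[OF assms(2)] assms(3) by (intro continuous_intros) auto
  show "(\<lambda>x. inverse (h x)) differentiable at x" if "x \<in> U" for x
    using D[OF that] by (rule differentiableI)
  show "Ck_on k U (dd i (\<lambda>x. inverse (h x)))" if "i \<in> Basis" "Ck_on k U (\<lambda>x. inverse (h x))" for k i
  proof (rule Ck_on_cong[OF assms(1)])
    show "(-1) * ((inverse (h x) * dd i h x) * inverse (h x)) = dd i (\<lambda>x. inverse (h x)) x" if "x \<in> U" for x
      using dd_unique[OF D[OF that], of i] by simp
    have "Ck_on k U (dd i h)" using smooth_on_dd[OF assms(1,2)] unfolding smooth_on_def by blast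
    then show "Ck_on k U (\<lambda>x. (-1) * ((inverse (h x) * dd i h x) * inverse (h x)))"
      using that(2) by (intro Ck_on_bilinear[OF bounded_bilinear_mult assms(1)] Ck_on_const)
  qed
qed

lemma smooth_on_divide:
  fixes h h' :: "'a::euclidean_space \<Rightarrow> real"
  assumes "open U" "smooth_on U h" "smooth_on U h'" "\<And>x. x \<in> U \<Longrightarrow> h' x \<noteq> 0"
  shows "smooth_on U (\<lambda>x. h x / h' x)"
  using smooth_on_mult[OF assms(1,2) smooth_on_inverse[OF assms(1,3,4)]] by (simp add: divide_inverse)

lemma smooth_on_sqrt:
  fixes h :: "'a::euclidean_space \<Rightarrow> real"
  assumes "open U" "smooth_on U h" "\<And>x. x \<in> U \<Longrightarrow> h x > 0"
  shows "smooth_on U (\<lambda>x. sqrt (h x))"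
proof (rule Ck_on_bootstrap[OF assms(1)])
  have D: "((\<lambda>x. sqrt (h x)) has_derivative (\<lambda>v. dd v h x * (sqrt (h x) * (inverse (h x) / 2)))) (at x)"
    if "x \<in> U" for x
  proof -
    have "((\<lambda>x. sqrt (h x)) has_derivative (\<lambda>v. dd v h x * (inverse (sqrt (h x)) / 2))) (at x)"
      using DERIV_compose_FDERIV[OF DERIV_real_sqrt smooth_on_has_derivative[OF assms(2) that]] assms(3)[OF that]
      by simp
    moreover have "inverse (sqrt (h x)) = sqrt (h x) * inverse (h x)"
      using assms(3)[OF that] by (simp add: field_simps)
    ultimately show ?thesis by (simp add: mult.assoc)
  qed
  show "continuous_on U (\<lambda>x. sqrt (h x))"
    using smooth_on_continuous[OF assms(2)] by (intro continuous_intros) auto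
  show "(\<lambda>x. sqrt (h x)) differentiable at x" if "x \<in> U" for x
    using D[OF that] by (rule differentiableI)
  show "Ck_on k U (dd i (\<lambda>x. sqrt (h x)))" if "i \<in> Basis" "Ck_on k U (\<lambda>x. sqrt (h x))" for k i
  proof (rule Ck_on_cong[OF assms(1)])
    show "dd i h x * (sqrt (h x) * (inverse (h x) * (1 / 2))) = dd i (\<lambda>x. sqrt (h x)) x" if "x \<in> U" for x
      using dd_unique[OF D[OF that], of i] by simp
    have "smooth_on U (\<lambda>x. inverse (h x))"
      using smooth_on_inverse[OF assms(1,2)] assms(3) by (metis order_less_irrefl)
    moreover have "smooth_on U (dd i h)" using smooth_on_dd[OF assms(1,2)] by blast
    ultimately have "Ck_on k U (dd i h)" "Ck_on k U (\<lambda>x. inverse (h x))"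
      unfolding smooth_on_def by blast+
    then show "Ck_on k U (\<lambda>x. dd i h x * (sqrt (h x) * (inverse (h x) * (1 / 2))))"
      using that(2) by (intro Ck_on_bilinear[OF bounded_bilinear_mult assms(1)] Ck_on_const)
  qed
qed

section \<open>Iterated directional derivatives and Taylor expansions\<close>

lemma dd_add:
  assumes "h differentiable (at x)" "h' differentiable (at x)"
  shows "dd v (\<lambda>x. h x + h' x) x = dd v h x + dd v h' x"
  using dd_unique[OF has_derivative_add[OF has_derivative_dd[OF assms(1)] has_derivative_dd[OF assms(2)]]] .

lemma dd_cmult:
  fixes h :: "'a::euclidean_space \<Rightarrow> real"
  assumes "h differentiable (at x)"
  shows "dd v (\<lambda>x. c * h x) x = c * dd v h x"
  using dd_unique[OF has_derivative_mult_right[OF has_derivative_dd[OF assms]]] .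

lemma dd_mult:
  fixes h h' :: "'a::euclidean_space \<Rightarrow> real"
  assumes "h differentiable (at x)" "h' differentiable (at x)"
  shows "dd v (\<lambda>x. h x * h' x) x = h x * dd v h' x + dd v h x * h' x"
  using dd_unique[OF has_derivative_mult[OF has_derivative_dd[OF assms(1)] has_derivative_dd[OF assms(2)]]] .

lemma dd_add_dir: "h differentiable (at x) \<Longrightarrow> dd (u + v) h x = dd u h x + dd v h x"
  using linear_add[OF dd_linear] by metis

lemma dd_scale_dir: "h differentiable (at x) \<Longrightarrow> dd (c *\<^sub>R v) h x = c *\<^sub>R dd v h x"
  using linear_cmul[OF dd_linear] by metis

lemma has_field_derivative_line:
  fixes h :: "'a::euclidean_space \<Rightarrow> real"
  assumes "h differentiable (at (z + t *\<^sub>R v))"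
  shows "((\<lambda>t. h (z + t *\<^sub>R v)) has_real_derivative dd v h (z + t *\<^sub>R v)) (at t)"
proof -
  have 1: "((\<lambda>t. z + t *\<^sub>R v) has_derivative (\<lambda>s. s *\<^sub>R v)) (at t)"
    by (auto intro!: derivative_eq_intros)
  have "((\<lambda>t. h (z + t *\<^sub>R v)) has_derivative (\<lambda>s. dd (s *\<^sub>R v) h (z + t *\<^sub>R v))) (at t)"
    using diff_chain_at[OF 1 has_derivative_dd[OF assms]] by (simp add: o_def)
  moreover have "(\<lambda>s. dd (s *\<^sub>R v) h (z + t *\<^sub>R v)) = (*) (dd v h (z + t *\<^sub>R v))"
    by (simp add: fun_eq_iff dd_scale_dir[OF assms])
  ultimately show ?thesis
    unfolding has_field_derivative_def by simp
qed

text \<open>The directions are applied from the right: the last entry of the list differentiates first.\<close>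

definition dirs :: "'a::euclidean_space list \<Rightarrow> ('a \<Rightarrow> 'b::real_normed_vector) \<Rightarrow> 'a \<Rightarrow> 'b" where
  "dirs vs h = foldr dd vs h"

lemma dirs_simps [simp]: "dirs [] h = h" "dirs (v # vs) h = dd v (dirs vs h)"
  by (simp_all add: dirs_def)

lemma dirs_append: "dirs (us @ vs) h = dirs us (dirs vs h)"
  by (simp add: dirs_def)

lemma smooth_on_dirs: "open W \<Longrightarrow> smooth_on W h \<Longrightarrow> smooth_on W (dirs vs h)"
  by (induction vs) (auto intro: smooth_on_dd)

lemma dirs_cong_open:
  assumes "open W" "\<And>y. y \<in> W \<Longrightarrow> h y = h' y"
  shows "x \<in> W \<Longrightarrow> dirs vs h x = dirs vs h' x"
proof (induction vs arbitrary: x)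
  case (Cons v vs)
  then show ?case using dd_cong_open[OF assms(1) Cons.prems Cons.IH] by simp
qed (use assms in simp)

lemma dirs_add:
  assumes "open W" "smooth_on W h" "smooth_on W h'"
  shows "x \<in> W \<Longrightarrow> dirs vs (\<lambda>x. h x + h' x) x = dirs vs h x + dirs vs h' x"
proof (induction vs arbitrary: x)
  case (Cons v vs)
  then show ?case
    using dd_cong_open[OF assms(1) Cons.prems Cons.IH, where v=v]
      dd_add[OF smooth_on_differentiable[OF smooth_on_dirs[OF assms(1,2)] Cons.prems]
        smooth_on_differentiable[OF smooth_on_dirs[OF assms(1,3)] Cons.prems]]
    by simp
qed simp

lemma dirs_cmult:
  fixes h :: "'a::euclidean_space \<Rightarrow> real"
  assumes "open W" "smooth_on W h"
  shows "x \<in> W \<Longrightarrow> dirs vs (\<lambda>x. c * h x) x = c * dirs vs h x"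
proof (induction vs arbitrary: x)
  case (Cons v vs)
  then show ?case
    using dd_cong_open[OF assms(1) Cons.prems Cons.IH, where v=v]
      dd_cmult[OF smooth_on_differentiable[OF smooth_on_dirs[OF assms(1,2)] Cons.prems]]
    by simp
qed simp

lemma dirs_sum:
  assumes "open W" "\<And>i. i \<in> I \<Longrightarrow> smooth_on W (h i)" "x \<in> W"
  shows "dirs vs (\<lambda>x. \<Sum>i\<in>I. h i x) x = (\<Sum>i\<in>I. dirs vs (h i) x)"
proof -
  have z: "dirs vs (\<lambda>x. 0) = (\<lambda>x. 0)" for vs :: "'a list"
    by (induction vs) (auto simp: dd_def)
  show ?thesis
    using assms(2)
  proof (induction I rule: infinite_finite_induct)
    case (insert a I)
    then show ?case
      using dirs_add[OF assms(1), of "h a" "\<lambda>x. \<Sum>i\<in>I. h i x"] assms(3) smooth_on_sum[OF assms(1), of I h]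
      by simp
  qed (simp_all add: z)
qed

text \<open>Expanding the innermost direction makes the remaining iterated derivatives act on fixed functions; this drives the induction in the continuity lemma that follows.\<close>

lemma dirs_snoc_expand:
  fixes h :: "'a::euclidean_space \<Rightarrow> real"
  assumes "open W" "smooth_on W h" "x \<in> W"
  shows "dirs (vs @ [v]) h x = (\<Sum>b\<in>Basis. (v \<bullet> b) * dirs vs (dd b h) x)"
proof -
  have "dirs (vs @ [v]) h x = dirs vs (\<lambda>x. \<Sum>b\<in>Basis. (v \<bullet> b) * dd b h x) x"
    unfolding dirs_append
    using dirs_cong_open[OF assms(1) _ assms(3), of "dd v h" "\<lambda>x. \<Sum>b\<in>Basis. (v \<bullet> b) * dd b h x" vs]
      dd_linear_expand[OF smooth_on_differentiable[OF assms(2)], of _ v]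
    by simp
  also have "\<dots> = (\<Sum>b\<in>Basis. dirs vs (\<lambda>x. (v \<bullet> b) * dd b h x) x)"
    by (rule dirs_sum[OF assms(1) _ assms(3)])
      (intro smooth_on_mult[OF assms(1)] smooth_on_const smooth_on_dd[OF assms(1,2)])
  also have "\<dots> = (\<Sum>b\<in>Basis. (v \<bullet> b) * dirs vs (dd b h) x)"
    by (intro sum.cong refl dirs_cmult[OF assms(1) _ assms(3)] smooth_on_dd assms)
  finally show ?thesis .
qed

text \<open>The directions move with the point in the applications: they are the roots of a Hessian form that varies.\<close>

lemma tendsto_dirs:
  fixes h :: "'a::euclidean_space \<Rightarrow> real"
  assumes "open W" "w0 \<in> W" "(w \<longlongrightarrow> w0) F"
  shows "smooth_on W h \<Longrightarrow> list_all2 (\<lambda>v l. (v \<longlongrightarrow> l) F) vs ls \<Longrightarrow>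
    ((\<lambda>x. dirs (map (\<lambda>v. v x) vs) h (w x)) \<longlongrightarrow> dirs ls h w0) F"
proof (induction vs arbitrary: h ls rule: rev_induct)
  case Nil
  then show ?case
    using isCont_tendsto_compose[OF smooth_on_isCont[OF Nil(1) assms(2)] assms(3)] by simp
next
  case (snoc v vs)
  obtain l ls' where ls: "ls = ls' @ [l]" "list_all2 (\<lambda>v l. (v \<longlongrightarrow> l) F) vs ls'" "(v \<longlongrightarrow> l) F"
    using snoc.prems(2) by (auto simp: list_all2_append1 list_all2_Cons1)
  have ev: "\<forall>\<^sub>F x in F. w x \<in> W" using topological_tendstoD[OF assms(3,1,2)] .
  have "((\<lambda>x. \<Sum>b\<in>Basis. (v x \<bullet> b) * dirs (map (\<lambda>v. v x) vs) (dd b h) (w x))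
      \<longlongrightarrow> (\<Sum>b\<in>Basis. (l \<bullet> b) * dirs ls' (dd b h) w0)) F"
    by (intro tendsto_sum tendsto_mult tendsto_inner tendsto_const ls(3) snoc.IH ls(2)
        smooth_on_dd assms(1) snoc.prems(1))
  then show ?case
    unfolding ls(1) dirs_snoc_expand[OF assms(1) snoc.prems(1) assms(2)]
    by (rule Lim_transform_eventually)
      (use ev in \<open>auto elim!: eventually_mono simp: dirs_snoc_expand[OF assms(1) snoc.prems(1)]\<close>)
qed

lemma dirs_affine_compose:
  fixes h :: "'b::euclidean_space \<Rightarrow> real" and L :: "'a::euclidean_space \<Rightarrow> 'b"
  assumes W: "open W" "smooth_on W h" and L: "bounded_linear L"
  shows "p + L x \<in> W \<Longrightarrow> dirs vs (\<lambda>x. h (p + L x)) x = dirs (map L vs) h (p + L x)"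
proof (induction vs arbitrary: x)
  case (Cons v vs)
  define W' where "W' = (\<lambda>x. p + L x) -` W"
  have c: "continuous_on UNIV (\<lambda>x. p + L x)"
    by (intro continuous_intros bounded_linear.continuous_on[OF L])
  have W': "open W'" "x \<in> W'"
    unfolding W'_def using W(1) c Cons.prems open_vimage by blast+
  have 1: "((\<lambda>x. p + L x) has_derivative L) (at x)"
    using has_derivative_add[OF has_derivative_const bounded_linear_imp_has_derivative[OF L]] by simp
  have "dd v (dirs vs (\<lambda>x. h (p + L x))) x = dd v (\<lambda>x. dirs (map L vs) h (p + L x)) x"
    by (rule dd_cong_open[OF W']) (use Cons.IH W'_def in auto)
  also have "\<dots> = dd (L v) (dirs (map L vs) h) (p + L x)"
    using dd_unique[OF diff_chain_at[OF 1
      has_derivative_dd[OF smooth_on_differentiable[OF smooth_on_dirs[OF W] Cons.prems]]], of v]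
    by (simp add: o_def)
  finally show ?case by simp
qed simp

lemma dirs_affine_eq_0:
  assumes "bounded_linear L" "length vs \<ge> 2"
  shows "dirs vs (\<lambda>x. c + L x) = (\<lambda>x. 0)"
proof -
  have 1: "dd v (\<lambda>x. c + L x) = (\<lambda>x. L v)" for v
    using dd_unique[OF has_derivative_add[OF has_derivative_const bounded_linear_imp_has_derivative[OF assms(1)]]]
    by (simp add: fun_eq_iff)
  have 2: "dd v (\<lambda>x. d) = (\<lambda>x. 0)" for v :: 'a and d :: 'b by (simp add: dd_def fun_eq_iff)
  show ?thesis using assms(2)
  proof (induction vs)
    case (Cons v vs)
    show ?case
    proof (cases "length vs \<ge> 2")
      case False
      then obtain u where "vs = [u]" using Cons.prems by (cases vs; cases "tl vs") auto
      then show ?thesis by (simp add: 1 2)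
    qed (simp add: Cons.IH 2)
  qed simp
qed

lemma dirs_replicate_scale:
  fixes h :: "'a::euclidean_space \<Rightarrow> real"
  assumes "open W" "smooth_on W h"
  shows "x \<in> W \<Longrightarrow> dirs (replicate n (r *\<^sub>R v)) h x = r ^ n * dirs (replicate n v) h x"
proof (induction n arbitrary: x)
  case (Suc n)
  have s: "smooth_on W (dirs (replicate n v) h)" by (rule smooth_on_dirs[OF assms])
  have "dirs (replicate (Suc n) (r *\<^sub>R v)) h x = dd (r *\<^sub>R v) (\<lambda>x. r ^ n * dirs (replicate n v) h x) x"
    using dd_cong_open[OF assms(1) Suc.prems Suc.IH] by simp
  also have "\<dots> = r ^ n * (r * dd v (dirs (replicate n v) h) x)"
    using dd_cmult[OF smooth_on_differentiable[OF s Suc.prems]]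
      dd_scale_dir[OF smooth_on_differentiable[OF s Suc.prems]] by simp
  finally show ?case by simp
qed simp

lemma dd_mvt:
  fixes h :: "'a::euclidean_space \<Rightarrow> real"
  assumes "s > 0" "\<forall>t\<in>{0..s}. h differentiable (at (z + t *\<^sub>R v))"
  shows "\<exists>t. 0 < t \<and> t < s \<and> h (z + s *\<^sub>R v) - h z = s * dd v h (z + t *\<^sub>R v)"
proof -
  have "\<exists>t>0. t < s \<and> h (z + s *\<^sub>R v) - h (z + 0 *\<^sub>R v) = (s - 0) * dd v h (z + t *\<^sub>R v)"
  proof (rule MVT2[OF assms(1)])
    show "((\<lambda>t. h (z + t *\<^sub>R v)) has_real_derivative dd v h (z + t *\<^sub>R v)) (at t)"
      if "0 \<le> t" "t \<le> s" for t
      by (rule has_field_derivative_line) (use assms(2) that in simp)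
  qed
  then show ?thesis by auto
qed

lemma taylor_dirs:
  fixes h :: "'a::euclidean_space \<Rightarrow> real"
  assumes W: "open W" "smooth_on W h" and n: "n > 0"
    and seg: "\<forall>t\<in>{0..1}. z + t *\<^sub>R v \<in> W"
  shows "\<exists>t. 0 < t \<and> t < 1 \<and> h (z + v) =
    (\<Sum>m<n. dirs (replicate m v) h z / fact m) + dirs (replicate n v) h (z + t *\<^sub>R v) / fact n"
proof -
  let ?d = "\<lambda>m t. dirs (replicate m v) h (z + t *\<^sub>R v)"
  have "\<exists>t. (if (1::real) < 0 then 1 < t \<and> t < 0 else 0 < t \<and> t < 1) \<and>
      ?d 0 1 = (\<Sum>m<n. (?d m 0 / fact m) * (1 - 0) ^ m) + (?d n t / fact n) * (1 - 0) ^ n"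
  proof (rule Taylor[OF n refl])
    show "\<forall>m t. m < n \<and> 0 \<le> t \<and> t \<le> 1 \<longrightarrow> DERIV (?d m) t :> ?d (Suc m) t"
      using has_field_derivative_line[OF smooth_on_differentiable[OF smooth_on_dirs[OF W]]] seg by simp
  qed auto
  then show ?thesis by auto
qed

text \<open>Taylor's formula along a line with Peano remainder, in the form of a limit that is ready for comparing coefficients.\<close>

lemma taylor_dirs_peano:
  fixes h :: "'a::euclidean_space \<Rightarrow> real"
  assumes W: "open W" "smooth_on W h" "z \<in> W" and n: "n > 0"
  shows "((\<lambda>t. (h (z + t *\<^sub>R v) - (\<Sum>m<n. t ^ m * dirs (replicate m v) h z / fact m)) / t ^ n)
    \<longlongrightarrow> dirs (replicate n v) h z / fact n) (at 0)"
proof (rule tendstoI)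
  fix \<epsilon> :: real assume "\<epsilon> > 0"
  have lin: "isCont (\<lambda>s. z + s *\<^sub>R v) 0" by (intro continuous_intros)
  have "isCont (\<lambda>s. dirs (replicate n v) h (z + s *\<^sub>R v)) 0"
    by (rule isCont_o2[OF lin])
      (use smooth_on_isCont[OF smooth_on_dirs[OF W(1,2)] W(3)] in simp)
  then obtain d2 where d2: "d2 > 0"
    "\<And>s. dist s 0 < d2 \<Longrightarrow> dist (dirs (replicate n v) h (z + s *\<^sub>R v)) (dirs (replicate n v) h (z + 0 *\<^sub>R v)) < \<epsilon>"
    using \<open>\<epsilon> > 0\<close> unfolding continuous_at_eps_delta by metis
  have "open ((\<lambda>s. z + s *\<^sub>R v) -` W)"
    by (rule open_vimage[OF W(1)]) (intro continuous_intros)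
  moreover have "(0::real) \<in> (\<lambda>s. z + s *\<^sub>R v) -` W" using W(3) by simp
  ultimately obtain d1 where d1: "d1 > 0" "ball (0::real) d1 \<subseteq> (\<lambda>s. z + s *\<^sub>R v) -` W"
    by (rule openE)
  define d where "d = min d1 d2"
  have d: "d > 0" "\<And>s. \<bar>s\<bar> < d \<Longrightarrow> z + s *\<^sub>R v \<in> W"
      "\<And>s. \<bar>s\<bar> < d \<Longrightarrow> dist (dirs (replicate n v) h (z + s *\<^sub>R v)) (dirs (replicate n v) h z) < \<epsilon>"
    using d1 d2 by (auto simp: d_def dist_real_def subset_iff)
  have main: "dist ((h (z + s *\<^sub>R v) - (\<Sum>m<n. s ^ m * dirs (replicate m v) h z / fact m)) / s ^ n)
      (dirs (replicate n v) h z / fact n) < \<epsilon>" if s: "s \<noteq> 0" "\<bar>s\<bar> < d" for s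
  proof -
    have seg: "\<forall>t\<in>{0..1}. z + t *\<^sub>R (s *\<^sub>R v) \<in> W"
    proof
      fix t :: real assume that: "t \<in> {0..1}"
      have "\<bar>t * s\<bar> \<le> \<bar>s\<bar>" using that by (simp add: abs_mult mult_left_le_one_le)
      then show "z + t *\<^sub>R (s *\<^sub>R v) \<in> W" using d(2)[of "t * s"] s by simp
    qed
    from taylor_dirs[OF W(1,2) n seg]
    obtain t where t: "0 < t" "t < 1" and e: "h (z + s *\<^sub>R v) =
      (\<Sum>m<n. dirs (replicate m (s *\<^sub>R v)) h z / fact m) + dirs (replicate n (s *\<^sub>R v)) h (z + t *\<^sub>R (s *\<^sub>R v)) / fact n"
      by (elim exE conjE)
    have "\<bar>t * s\<bar> \<le> \<bar>s\<bar>" using t by (simp add: abs_mult mult_left_le_one_le)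
    then have ts: "\<bar>t * s\<bar> < d" using s by linarith
    have "(h (z + s *\<^sub>R v) - (\<Sum>m<n. s ^ m * dirs (replicate m v) h z / fact m))
        = s ^ n * dirs (replicate n v) h (z + (t * s) *\<^sub>R v) / fact n"
      using e d(2)[OF ts] W(3) by (simp add: dirs_replicate_scale[OF W(1,2)])
    then have "dist ((h (z + s *\<^sub>R v) - (\<Sum>m<n. s ^ m * dirs (replicate m v) h z / fact m)) / s ^ n)
      (dirs (replicate n v) h z / fact n) = dist (dirs (replicate n v) h (z + (t * s) *\<^sub>R v)) (dirs (replicate n v) h z) / fact n"
      using s by (simp add: dist_real_def abs_divide flip: diff_divide_distrib)
    also have "\<dots> \<le> dist (dirs (replicate n v) h (z + (t * s) *\<^sub>R v)) (dirs (replicate n v) h z)"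
      by (simp add: divide_le_eq mult_le_cancel_left1 fact_ge_1)
    also have "\<dots> < \<epsilon>" using d(3)[OF ts] .
    finally show ?thesis .
  qed
  show "\<forall>\<^sub>F s in at 0. dist ((h (z + s *\<^sub>R v) - (\<Sum>m<n. s ^ m * dirs (replicate m v) h z / fact m)) / s ^ n)
      (dirs (replicate n v) h z / fact n) < \<epsilon>"
    unfolding eventually_at using d(1) main by (auto simp: dist_real_def)
qed

text \<open>Symmetry of second derivatives: the second difference over a small parallelogram is, by two applications of the mean value theorem, a value of either mixed derivative nearby.\<close>

lemma dd_commute:
  fixes h :: "'a::euclidean_space \<Rightarrow> real"
  assumes W: "open W" "smooth_on W h" "x \<in> W"
  shows "dd u (dd v h) x = dd v (dd u h) x"
proof (rule ccontr)
  assume ne: "dd u (dd v h) x \<noteq> dd v (dd u h) x"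
  define \<epsilon> where "\<epsilon> = \<bar>dd u (dd v h) x - dd v (dd u h) x\<bar> / 2"
  have "\<epsilon> > 0" using ne by (simp add: \<epsilon>_def)
  have s: "smooth_on W (dd a h)" "smooth_on W (dd a (dd b h))" for a b
    using W by (auto intro!: smooth_on_dd)
  obtain d0 where d0: "d0 > 0" "ball x d0 \<subseteq> W" using W openE by blast
  obtain d1 where d1: "d1 > 0" "\<And>y. dist y x < d1 \<Longrightarrow> dist (dd u (dd v h) y) (dd u (dd v h) x) < \<epsilon>"
    using smooth_on_isCont[OF s(2)[of u v] W(3)] \<open>\<epsilon> > 0\<close> unfolding continuous_at_eps_delta by metis
  obtain d2 where d2: "d2 > 0" "\<And>y. dist y x < d2 \<Longrightarrow> dist (dd v (dd u h) y) (dd v (dd u h) x) < \<epsilon>"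
    using smooth_on_isCont[OF s(2)[of v u] W(3)] \<open>\<epsilon> > 0\<close> unfolding continuous_at_eps_delta by metis
  define d where "d = min d0 (min d1 d2)"
  have d: "d > 0" using d0 d1 d2 by (simp add: d_def)
  define r where "r = d / (norm u + norm v + 1) / 2"
  have n: "norm u + norm v + 1 > 0" by (smt (verit) norm_ge_zero)
  have r: "r > 0" using d n by (simp add: r_def)
  have "r * (norm u + norm v) < d"
  proof -
    have "r * (norm u + norm v) \<le> r * (norm u + norm v + 1)" using r by simp
    also have "\<dots> = d / 2" using n by (simp add: r_def field_simps)
    finally show ?thesis using d by simp
  qed
  have near: "dist (x + a *\<^sub>R u + b *\<^sub>R v) x < d" if "0 \<le> a" "a \<le> r" "0 \<le> b" "b \<le> r" for a b
  proof -
    have "dist (x + a *\<^sub>R u + b *\<^sub>R v) x = norm (a *\<^sub>R u + b *\<^sub>R v)" by (simp add: dist_norm)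
    also have "\<dots> \<le> a * norm u + b * norm v"
      using norm_triangle_ineq[of "a *\<^sub>R u" "b *\<^sub>R v"] that by simp
    also have "\<dots> \<le> r * (norm u + norm v)"
      using that by (simp add: distrib_left add_mono mult_right_mono)
    finally show ?thesis using \<open>r * (norm u + norm v) < d\<close> by simp
  qed
  then have inW: "x + a *\<^sub>R u + b *\<^sub>R v \<in> W" if "0 \<le> a" "a \<le> r" "0 \<le> b" "b \<le> r" for a b
    using that d0(2) by (fastforce simp: d_def dist_commute)
  \<comment> \<open>The second difference is symmetric in the two directions, while the mean value theorem brings out the derivatives in the order in which it is applied.\<close>
  define \<Delta> where "\<Delta> = h (x + r *\<^sub>R u + r *\<^sub>R v) - h (x + r *\<^sub>R u) - h (x + r *\<^sub>R v) + h x"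
  have one: "\<exists>a b. 0 < a \<and> a < r \<and> 0 < b \<and> b < r \<and> \<Delta> = r * (r * dd v' (dd u' h) (x + a *\<^sub>R u' + b *\<^sub>R v'))"
    if inW': "\<And>a b. 0 \<le> a \<Longrightarrow> a \<le> r \<Longrightarrow> 0 \<le> b \<Longrightarrow> b \<le> r \<Longrightarrow> x + a *\<^sub>R u' + b *\<^sub>R v' \<in> W"
      and \<Delta>': "\<Delta> = h (x + r *\<^sub>R u' + r *\<^sub>R v') - h (x + r *\<^sub>R u') - h (x + r *\<^sub>R v') + h x" for u' v'
  proof -
    have "((\<lambda>t. h (x + t *\<^sub>R u' + r *\<^sub>R v') - h (x + t *\<^sub>R u')) has_real_derivative
        dd u' h (x + t *\<^sub>R u' + r *\<^sub>R v') - dd u' h (x + t *\<^sub>R u')) (at t)" if "0 \<le> t" "t \<le> r" for t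
    proof (rule DERIV_diff)
      show "((\<lambda>t. h (x + t *\<^sub>R u' + r *\<^sub>R v')) has_real_derivative dd u' h (x + t *\<^sub>R u' + r *\<^sub>R v')) (at t)"
        using has_field_derivative_line[of h "x + r *\<^sub>R v'" t u'] smooth_on_differentiable[OF W(2) inW'[OF that, of r]] r
        by (simp add: algebra_simps)
      show "((\<lambda>t. h (x + t *\<^sub>R u')) has_real_derivative dd u' h (x + t *\<^sub>R u')) (at t)"
        using has_field_derivative_line[of h "x" t u'] smooth_on_differentiable[OF W(2) inW'[OF that, of 0]] r
        by simp
    qed
    then obtain a where a: "0 < a" "a < r"
      and ae: "\<Delta> = r * (dd u' h (x + a *\<^sub>R u' + r *\<^sub>R v') - dd u' h (x + a *\<^sub>R u'))"
      using MVT2[OF r, of "\<lambda>t. h (x + t *\<^sub>R u' + r *\<^sub>R v') - h (x + t *\<^sub>R u')"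
          "\<lambda>t. dd u' h (x + t *\<^sub>R u' + r *\<^sub>R v') - dd u' h (x + t *\<^sub>R u')"] \<Delta>'
      by (auto simp: algebra_simps)
    have "\<forall>t\<in>{0..r}. dd u' h differentiable at (x + a *\<^sub>R u' + t *\<^sub>R v')"
      using smooth_on_differentiable[OF s(1) inW'[of a]] a by simp
    from dd_mvt[OF r this]
    obtain b where b: "0 < b" "b < r"
      "dd u' h (x + a *\<^sub>R u' + r *\<^sub>R v') - dd u' h (x + a *\<^sub>R u') = r * dd v' (dd u' h) (x + a *\<^sub>R u' + b *\<^sub>R v')"
      by (elim exE conjE)
    then show ?thesis using a ae by auto
  qed
  obtain a b where ab: "0 < a" "a < r" "0 < b" "b < r" "\<Delta> = r * (r * dd v (dd u h) (x + a *\<^sub>R u + b *\<^sub>R v))"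
    using one[OF inW \<Delta>_def] by blast
  have inW2: "x + a *\<^sub>R v + b *\<^sub>R u \<in> W" if "0 \<le> a" "a \<le> r" "0 \<le> b" "b \<le> r" for a b
    using inW[of b a] that by (simp add: algebra_simps)
  have \<Delta>2: "\<Delta> = h (x + r *\<^sub>R v + r *\<^sub>R u) - h (x + r *\<^sub>R v) - h (x + r *\<^sub>R u) + h x"
    unfolding \<Delta>_def by (simp add: algebra_simps)
  obtain a' b' where ab': "0 < a'" "a' < r" "0 < b'" "b' < r" "\<Delta> = r * (r * dd u (dd v h) (x + a' *\<^sub>R v + b' *\<^sub>R u))"
    using one[OF inW2 \<Delta>2] by blast
  have "dd v (dd u h) (x + a *\<^sub>R u + b *\<^sub>R v) = dd u (dd v h) (x + b' *\<^sub>R u + a' *\<^sub>R v)"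
    using ab(5) ab'(5) r by (simp add: algebra_simps)
  moreover have "dist (dd v (dd u h) (x + a *\<^sub>R u + b *\<^sub>R v)) (dd v (dd u h) x) < \<epsilon>"
    using near[of a b] ab by (intro d2(2)) (simp add: d_def)
  moreover have "dist (dd u (dd v h) (x + b' *\<^sub>R u + a' *\<^sub>R v)) (dd u (dd v h) x) < \<epsilon>"
    using near[of b' a'] ab' by (intro d1(2)) (simp add: d_def)
  ultimately show False
    unfolding dist_real_def \<epsilon>_def by (smt (verit) field_sum_of_halves)
qed

text \<open>The two partial derivatives, as instances of the same operator as all other directional derivatives, so that one theory covers the coordinate directions and the moving root directions of the Hessian forms.\<close>

abbreviation Dx :: "(real \<times> real \<Rightarrow> real) \<Rightarrow> real \<times> real \<Rightarrow> real" where
  "Dx \<equiv> dd (1, 0)"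

abbreviation Dy :: "(real \<times> real \<Rightarrow> real) \<Rightarrow> real \<times> real \<Rightarrow> real" where
  "Dy \<equiv> dd (0, 1)"

lemma dx_eq_dd: "dx = Dx" and dy_eq_dd: "dy = Dy"
  by (simp_all add: dx_def dy_def dd_def fun_eq_iff)

lemma taylor_coeff_dirs:
  "taylor_coeff h i j = dirs (replicate i (1, 0) @ replicate j (0, 1)) h 0 / (fact i * fact j)"
proof -
  have "(dd v ^^ n) h = dirs (replicate n v) h" for v :: "real \<times> real" and n and h :: "real \<times> real \<Rightarrow> real"
    by (induction n) auto
  then show ?thesis
    unfolding taylor_coeff_def dx_eq_dd dy_eq_dd dirs_append by (simp add: zero_prod_def)
qed

section \<open>Hadamard's lemma\<close>

text \<open>The averages that occur as coefficients in Hadamard's lemma. The weight \<open>t ^ m\<close> makes the family closed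
under differentiation: each derivative produces one more factor \<open>t\<close> by the chain rule.\<close>

definition radial_mean :: "'a::euclidean_space \<Rightarrow> nat \<Rightarrow> ('a \<Rightarrow> real) \<Rightarrow> 'a \<Rightarrow> real" where
  "radial_mean P m \<phi> X = integral (cbox 0 1) (\<lambda>t. t ^ m * \<phi> (P + t *\<^sub>R (X - P)))"

lemma radial_in_ball:
  fixes P :: "'a::real_normed_vector"
  assumes "X \<in> ball P r" "0 \<le> t" "t \<le> (1::real)"
  shows "P + t *\<^sub>R (X - P) \<in> ball P r"
proof -
  have "dist P (P + t *\<^sub>R (X - P)) = t * dist P X"
  proof -
    have "dist P (P + y) = norm y" for y :: 'a by (simp add: dist_norm)
    then show ?thesis using assms(2) by (simp add: dist_norm norm_minus_commute)
  qed
  also have "\<dots> \<le> dist P X" using assms by (simp add: mult_left_le_one_le)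
  finally show ?thesis using assms(1) by simp
qed

lemma radial_mean_has_derivative:
  fixes \<phi> :: "'a::euclidean_space \<Rightarrow> real"
  assumes s: "smooth_on (ball P r) \<phi>" and X: "X \<in> ball P r"
  shows "(radial_mean P m \<phi> has_derivative
      (\<lambda>v. \<Sum>b\<in>Basis. (v \<bullet> b) * radial_mean P (Suc m) (dd b \<phi>) X)) (at X)"
proof -
  let ?U = "ball P r"
  let ?g = "\<lambda>b x t. t ^ Suc m * dd b \<phi> (P + t *\<^sub>R (x - P))"
  define fx where "fx x t = (\<Sum>b\<in>Basis. ?g b x t *\<^sub>R blinfun_inner_left b)" for x :: 'a and t :: real
  have c1: "continuous_on (?U \<times> cbox 0 1) (\<lambda>p. \<psi> (P + snd p *\<^sub>R (fst p - P)))"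
    if "continuous_on ?U \<psi>" for \<psi> :: "'a \<Rightarrow> real"
    by (rule continuous_on_compose2[OF that]) (auto intro!: continuous_intros radial_in_ball simp del: mem_ball)
  have c: "continuous_on (?U \<times> cbox 0 1) (\<lambda>p. ?g b (fst p) (snd p))" for b
    by (intro continuous_intros c1 smooth_on_continuous smooth_on_dd s open_ball)
  have c': "continuous_on (cbox 0 1) (\<lambda>t. ?g b X t)" for b
  proof -
    have "continuous_on (cbox 0 1) (\<lambda>t. ?g b (fst (X, t)) (snd (X, t)))"
      by (rule continuous_on_compose2[OF c]) (use X in \<open>auto intro!: continuous_intros\<close>)
    then show ?thesis by (simp only: fst_conv snd_conv)
  qed
  have c0: "continuous_on (cbox 0 1) (\<lambda>t. t ^ m * \<phi> (P + t *\<^sub>R (x - P)))" if "x \<in> ?U" for x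
  proof -
    have "continuous_on (cbox 0 1) (\<lambda>t. \<phi> (P + snd (x, t) *\<^sub>R (fst (x, t) - P)))"
      by (rule continuous_on_compose2[OF c1[OF smooth_on_continuous[OF s]]])
        (use that in \<open>auto intro!: continuous_intros\<close>)
    then show ?thesis by (intro continuous_intros) (simp only: fst_conv snd_conv)
  qed
  have "((\<lambda>x. integral (cbox 0 1) (\<lambda>t. t ^ m * \<phi> (P + t *\<^sub>R (x - P)))) has_derivative
      blinfun_apply (integral (cbox 0 1) (fx X))) (at X within ?U)"
  proof (rule leibniz_rule[OF _ _ _ X convex_ball])
    fix x and t :: real assume x: "x \<in> ?U" and t: "t \<in> cbox 0 1"
    have y: "P + t *\<^sub>R (x - P) \<in> ?U" using radial_in_ball[OF x, of t] t by simp
    have 1: "((\<lambda>x. P + t *\<^sub>R (x - P)) has_derivative (\<lambda>v. t *\<^sub>R v)) (at x)"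
      by (auto intro!: derivative_eq_intros)
    have 2: "((\<lambda>x. \<phi> (P + t *\<^sub>R (x - P))) has_derivative (\<lambda>v. dd (t *\<^sub>R v) \<phi> (P + t *\<^sub>R (x - P)))) (at x)"
      using diff_chain_at[OF 1 smooth_on_has_derivative[OF s y]] by (simp add: o_def)
    have "((\<lambda>x. t ^ m * \<phi> (P + t *\<^sub>R (x - P))) has_derivative
        (\<lambda>v. t ^ m * dd (t *\<^sub>R v) \<phi> (P + t *\<^sub>R (x - P)))) (at x)"
      by (rule has_derivative_mult_right[OF 2])
    moreover have "t ^ m * dd (t *\<^sub>R v) \<phi> (P + t *\<^sub>R (x - P)) = blinfun_apply (fx x t) v" for v
      unfolding fx_def dd_scale_dir[OF smooth_on_differentiable[OF s y]]
      by (simp add: blinfun.sum_left blinfun.scaleR_left dd_linear_expand[OF smooth_on_differentiable[OF s y], of v]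
          sum_distrib_left mult_ac)
    ultimately show "((\<lambda>x. t ^ m * \<phi> (P + t *\<^sub>R (x - P))) has_derivative blinfun_apply (fx x t)) (at x within ?U)"
      using has_derivative_at_withinI by (metis (no_types, lifting) ext)
  next
    show "(\<lambda>t. t ^ m * \<phi> (P + t *\<^sub>R (x - P))) integrable_on cbox 0 1" if "x \<in> ?U" for x
      by (rule integrable_continuous[OF c0[OF that]])
    show "continuous_on (?U \<times> cbox 0 1) (\<lambda>(x, t). fx x t)"
      unfolding fx_def split_beta by (intro continuous_on_sum continuous_on_scaleR continuous_on_const c)
  qed
  moreover have "blinfun_apply (integral (cbox 0 1) (fx X)) =
      (\<lambda>v. \<Sum>b\<in>Basis. (v \<bullet> b) * radial_mean P (Suc m) (dd b \<phi>) X)"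
  proof (rule ext)
    fix v
    have "fx X integrable_on cbox 0 1"
      unfolding fx_def by (intro integrable_continuous continuous_on_sum continuous_on_scaleR continuous_on_const c')
    then have "blinfun_apply (integral (cbox 0 1) (fx X)) v = integral (cbox 0 1) (\<lambda>t. blinfun_apply (fx X t) v)"
      by (rule blinfun_apply_integral)
    also have "\<dots> = integral (cbox 0 1) (\<lambda>t. \<Sum>b\<in>Basis. (v \<bullet> b) * ?g b X t)"
      unfolding fx_def by (simp add: blinfun.sum_left blinfun.scaleR_left mult_ac)
    also have "\<dots> = (\<Sum>b\<in>Basis. integral (cbox 0 1) (\<lambda>t. (v \<bullet> b) * ?g b X t))"
      by (intro integral_sum integrable_continuous continuous_on_mult continuous_on_const c') simp
    finally show "blinfun_apply (integral (cbox 0 1) (fx X)) v =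
        (\<Sum>b\<in>Basis. (v \<bullet> b) * radial_mean P (Suc m) (dd b \<phi>) X)" by (simp add: radial_mean_def)
  qed
  ultimately show ?thesis
    unfolding radial_mean_def[abs_def] at_within_open[OF X open_ball] by (simp only:)
qed

text \<open>Differentiation under the integral sign stays inside the family of averages, so all derivatives exist.\<close>

lemma smooth_on_radial_mean:
  fixes \<phi> :: "'a::euclidean_space \<Rightarrow> real"
  assumes "smooth_on (ball P r) \<phi>"
  shows "smooth_on (ball P r) (radial_mean P m \<phi>)"
  unfolding smooth_on_def
proof
  fix k
  show "Ck_on k (ball P r) (radial_mean P m \<phi>)"
    using assms
  proof (induction k arbitrary: m \<phi>)
    case 0
    have "continuous (at X) (radial_mean P m \<phi>)" if "X \<in> ball P r" for X
      by (rule has_derivative_continuous[OF radial_mean_has_derivative[OF 0 that]])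
    then show ?case by (simp add: continuous_at_imp_continuous_on)
  next
    case (Suc k)
    have "dd i (radial_mean P m \<phi>) X = radial_mean P (Suc m) (dd i \<phi>) X"
      if "X \<in> ball P r" "i \<in> Basis" for X i
    proof -
      have "dd i (radial_mean P m \<phi>) X = (\<Sum>b\<in>Basis. (i \<bullet> b) * radial_mean P (Suc m) (dd b \<phi>) X)"
        by (rule dd_unique[OF radial_mean_has_derivative[OF Suc.prems that(1)]])
      also have "\<dots> = (\<Sum>b\<in>Basis. if b = i then radial_mean P (Suc m) (dd b \<phi>) X else 0)"
        using that(2) by (intro sum.cong) (auto simp: inner_Basis)
      finally show ?thesis using that(2) by simp
    qed
    then have "Ck_on k (ball P r) (dd i (radial_mean P m \<phi>))" if "i \<in> Basis" for i
      using Ck_on_cong[OF open_ball _ Suc.IH[OF smooth_on_dd[OF open_ball Suc.prems]]] that by metis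
    moreover have "radial_mean P m \<phi> differentiable at X" if "X \<in> ball P r" for X
      by (rule differentiableI[OF radial_mean_has_derivative[OF Suc.prems that]])
    ultimately show ?case unfolding Ck_on_Suc_dd by blast
  qed
qed

text \<open>The difference \<open>h X - h P\<close> is the integral of the derivative along the segment from \<open>P\<close> to \<open>X\<close>; this derivative is linear in \<open>X - P\<close>.\<close>

lemma hadamard:
  fixes h :: "'a::euclidean_space \<Rightarrow> real"
  assumes s: "smooth_on (ball P r) h"
  obtains a where "\<And>b. smooth_on (ball P r) (a b)" "\<And>b. a b P = dd b h P"
    "\<And>X. X \<in> ball P r \<Longrightarrow> h X = h P + (\<Sum>b\<in>Basis. ((X - P) \<bullet> b) * a b X)"
proof
  let ?a = "\<lambda>b. radial_mean P 0 (dd b h)"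
  show "smooth_on (ball P r) (?a b)" for b
    by (intro smooth_on_radial_mean smooth_on_dd open_ball s)
  show "?a b P = dd b h P" for b by (simp add: radial_mean_def)
  fix X assume X: "X \<in> ball P r"
  let ?f = "\<lambda>t. h (P + t *\<^sub>R (X - P))"
  have "(?f has_vector_derivative dd (X - P) h (P + t *\<^sub>R (X - P))) (at t within {0..1})" if "t \<in> {0..1}" for t
    using has_field_derivative_line[OF smooth_on_differentiable[OF s radial_in_ball[OF X]], of t] that
    by (auto simp: has_real_derivative_iff_has_vector_derivative intro: has_vector_derivative_at_within)
  then have "((\<lambda>t. dd (X - P) h (P + t *\<^sub>R (X - P))) has_integral (?f 1 - ?f 0)) {0..1}"
    by (intro fundamental_theorem_of_calculus) auto
  moreover have "((\<lambda>t. dd (X - P) h (P + t *\<^sub>R (X - P))) has_integral (\<Sum>b\<in>Basis. ((X - P) \<bullet> b) * ?a b X)) {0..1}"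
  proof -
    have i: "(\<lambda>t. dd b h (P + t *\<^sub>R (X - P))) integrable_on cbox 0 1" for b
      by (intro integrable_continuous continuous_on_compose2[OF smooth_on_continuous[OF smooth_on_dd[OF open_ball s]]])
        (auto intro!: continuous_intros radial_in_ball[OF X] simp del: mem_ball)
    have "((\<lambda>t. \<Sum>b\<in>Basis. ((X - P) \<bullet> b) * dd b h (P + t *\<^sub>R (X - P))) has_integral
        (\<Sum>b\<in>Basis. ((X - P) \<bullet> b) * ?a b X)) {0..1}"
      using i by (intro has_integral_sum has_integral_mult_right) (auto simp: radial_mean_def has_integral_iff)
    then show ?thesis
      by (rule has_integral_eq[rotated])
        (use dd_linear_expand[OF smooth_on_differentiable[OF s radial_in_ball[OF X]], of _ "X - P"] in simp)
  qed
  ultimately have "?f 1 - ?f 0 = (\<Sum>b\<in>Basis. ((X - P) \<bullet> b) * ?a b X)"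
    by (rule has_integral_unique)
  then show "h X = h P + (\<Sum>b\<in>Basis. ((X - P) \<bullet> b) * ?a b X)" by simp
qed

section \<open>Ideals of germs and multiplicity\<close>

lemma smooth_at_ball:
  assumes "smooth_at P h"
  obtains r where "r > 0" "smooth_on (ball P r) h"
proof -
  obtain U where U: "open U" "P \<in> U" "smooth_on U h" using assms unfolding smooth_at_def by blast
  obtain r where "r > 0" "ball P r \<subseteq> U" using U(1,2) by (rule openE)
  then show ?thesis using that smooth_on_subset[OF U(3)] by blast
qed

lemma smooth_atI: "open U \<Longrightarrow> P \<in> U \<Longrightarrow> smooth_on U h \<Longrightarrow> smooth_at P h"
  unfolding smooth_at_def by blast

lemma smooth_at_common:
  assumes "smooth_at P h" "smooth_at P h'"
  obtains U where "open U" "P \<in> U" "smooth_on U h" "smooth_on U h'"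
proof -
  obtain U where U: "open U" "P \<in> U" "smooth_on U h" using assms(1) unfolding smooth_at_def by blast
  obtain V where V: "open V" "P \<in> V" "smooth_on V h'" using assms(2) unfolding smooth_at_def by blast
  show ?thesis
    by (rule that[of "U \<inter> V"]) (use U V smooth_on_subset in \<open>auto intro: smooth_on_subset\<close>)
qed

lemma smooth_at_const [simp]: "smooth_at P (\<lambda>x. c)"
  by (rule smooth_atI[OF open_UNIV]) auto

lemma smooth_at_add:
  assumes "smooth_at P h" "smooth_at P h'" shows "smooth_at P (\<lambda>x. h x + h' x)"
  by (rule smooth_at_common[OF assms]) (auto intro: smooth_atI smooth_on_add)

lemma smooth_at_mult:
  fixes h h' :: "'a::euclidean_space \<Rightarrow> real"
  assumes "smooth_at P h" "smooth_at P h'" shows "smooth_at P (\<lambda>x. h x * h' x)"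
  by (rule smooth_at_common[OF assms]) (auto intro: smooth_atI smooth_on_mult)

lemma smooth_at_diff:
  fixes h h' :: "'a::euclidean_space \<Rightarrow> real"
  assumes "smooth_at P h" "smooth_at P h'" shows "smooth_at P (\<lambda>x. h x - h' x)"
  by (rule smooth_at_common[OF assms]) (auto intro: smooth_atI smooth_on_diff)

lemma smooth_at_sum:
  "(\<And>i. i \<in> I \<Longrightarrow> smooth_at P (h i)) \<Longrightarrow> smooth_at P (\<lambda>x. \<Sum>i\<in>I. h i x)"
  by (induction I rule: infinite_finite_induct) (auto intro: smooth_at_add)

lemma smooth_at_linear: "bounded_linear L \<Longrightarrow> smooth_at P L"
  by (rule smooth_atI[OF open_UNIV]) (auto intro: smooth_on_linear)

lemma smooth_at_isCont: "smooth_at P h \<Longrightarrow> isCont h P"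
  unfolding smooth_at_def using smooth_on_isCont by metis

lemma smooth_at_inverse:
  fixes h :: "'a::euclidean_space \<Rightarrow> real"
  assumes "smooth_at P h" "h P \<noteq> 0" shows "smooth_at P (\<lambda>x. inverse (h x))"
proof -
  obtain U where U: "open U" "P \<in> U" "smooth_on U h" using assms(1) unfolding smooth_at_def by blast
  let ?V = "U \<inter> h -` (- {0})"
  have "open ?V" using continuous_open_preimage[OF smooth_on_continuous[OF U(3)] U(1)] by blast
  moreover have "P \<in> ?V" using U assms by simp
  moreover have "smooth_on ?V (\<lambda>x. inverse (h x))"
    by (rule smooth_on_inverse[OF \<open>open ?V\<close>]) (use smooth_on_subset[OF U(3)] in auto)
  ultimately show ?thesis by (rule smooth_atI)
qed

definition germ_ideal :: "('a::euclidean_space \<Rightarrow> real) set \<Rightarrow> 'a \<Rightarrow> ('a \<Rightarrow> real) \<Rightarrow> bool" where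
  "germ_ideal \<Phi> P h \<longleftrightarrow> (\<exists>a. (\<forall>\<phi>\<in>\<Phi>. smooth_at P (a \<phi>)) \<and> (\<forall>\<^sub>F X in nhds P. h X = (\<Sum>\<phi>\<in>\<Phi>. a \<phi> X * \<phi> X)))"

lemma germ_ideal_generator:
  assumes "finite \<Phi>" "\<phi> \<in> \<Phi>" shows "germ_ideal \<Phi> P \<phi>"
proof -
  have "(\<Sum>\<psi>\<in>\<Phi>. (if \<psi> = \<phi> then 1 else 0) * \<psi> X) = \<phi> X" for X
    using assms by (simp add: if_distrib[of "\<lambda>x. x * _"] cong: if_cong)
  then show ?thesis
    unfolding germ_ideal_def
    by (intro exI[of _ "\<lambda>\<psi> X. if \<psi> = \<phi> then 1 else 0"]) auto
qed

lemma germ_ideal_cong: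
  assumes "germ_ideal \<Phi> P h" "\<forall>\<^sub>F X in nhds P. h' X = h X" shows "germ_ideal \<Phi> P h'"
proof -
  obtain a where a: "\<forall>\<phi>\<in>\<Phi>. smooth_at P (a \<phi>)" "\<forall>\<^sub>F X in nhds P. h X = (\<Sum>\<phi>\<in>\<Phi>. a \<phi> X * \<phi> X)"
    using assms(1) unfolding germ_ideal_def by blast
  have "\<forall>\<^sub>F X in nhds P. h' X = (\<Sum>\<phi>\<in>\<Phi>. a \<phi> X * \<phi> X)"
    using assms(2) a(2) by eventually_elim simp
  then show ?thesis unfolding germ_ideal_def using a(1) by blast
qed

lemma germ_ideal_zero: "germ_ideal \<Phi> P (\<lambda>X. 0)"
  unfolding germ_ideal_def by (intro exI[of _ "\<lambda>\<phi> X. 0"]) auto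

lemma germ_ideal_add:
  assumes "germ_ideal \<Phi> P h" "germ_ideal \<Phi> P h'" shows "germ_ideal \<Phi> P (\<lambda>X. h X + h' X)"
proof -
  obtain a where a: "\<forall>\<phi>\<in>\<Phi>. smooth_at P (a \<phi>)" "\<forall>\<^sub>F X in nhds P. h X = (\<Sum>\<phi>\<in>\<Phi>. a \<phi> X * \<phi> X)"
    using assms(1) unfolding germ_ideal_def by blast
  obtain b where b: "\<forall>\<phi>\<in>\<Phi>. smooth_at P (b \<phi>)" "\<forall>\<^sub>F X in nhds P. h' X = (\<Sum>\<phi>\<in>\<Phi>. b \<phi> X * \<phi> X)"
    using assms(2) unfolding germ_ideal_def by blast
  have "\<forall>\<^sub>F X in nhds P. h X + h' X = (\<Sum>\<phi>\<in>\<Phi>. (a \<phi> X + b \<phi> X) * \<phi> X)"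
    using a(2) b(2) by eventually_elim (simp add: distrib_right sum.distrib)
  moreover have "\<forall>\<phi>\<in>\<Phi>. smooth_at P (\<lambda>X. a \<phi> X + b \<phi> X)" using a(1) b(1) by (auto intro: smooth_at_add)
  ultimately show ?thesis
    unfolding germ_ideal_def by (intro exI[of _ "\<lambda>\<phi> X. a \<phi> X + b \<phi> X"]) auto
qed

lemma germ_ideal_mult:
  assumes "germ_ideal \<Phi> P h" "smooth_at P s" shows "germ_ideal \<Phi> P (\<lambda>X. s X * h X)"
proof -
  obtain a where a: "\<forall>\<phi>\<in>\<Phi>. smooth_at P (a \<phi>)" "\<forall>\<^sub>F X in nhds P. h X = (\<Sum>\<phi>\<in>\<Phi>. a \<phi> X * \<phi> X)"
    using assms(1) unfolding germ_ideal_def by blast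
  have "\<forall>\<^sub>F X in nhds P. s X * h X = (\<Sum>\<phi>\<in>\<Phi>. (s X * a \<phi> X) * \<phi> X)"
    using a(2) by eventually_elim (simp add: sum_distrib_left mult.assoc)
  moreover have "\<forall>\<phi>\<in>\<Phi>. smooth_at P (\<lambda>X. s X * a \<phi> X)" using a(1) assms(2) by (auto intro: smooth_at_mult)
  ultimately show ?thesis
    unfolding germ_ideal_def by (intro exI[of _ "\<lambda>\<phi> X. s X * a \<phi> X"]) auto
qed

lemma germ_ideal_diff:
  assumes "germ_ideal \<Phi> P h" "germ_ideal \<Phi> P h'" shows "germ_ideal \<Phi> P (\<lambda>X. h X - h' X)"
  using germ_ideal_add[OF assms(1) germ_ideal_mult[OF assms(2) smooth_at_const[of P "-1"]]] by simp

lemma germ_ideal_sum: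
  "(\<And>i. i \<in> I \<Longrightarrow> germ_ideal \<Phi> P (h i)) \<Longrightarrow> germ_ideal \<Phi> P (\<lambda>X. \<Sum>i\<in>I. h i X)"
  by (induction I rule: infinite_finite_induct) (auto intro: germ_ideal_add germ_ideal_zero)

lemma local_multiplicity_le:
  assumes "finite E" "\<And>e. e \<in> E \<Longrightarrow> smooth_at P e"
    and "\<And>h. smooth_at P h \<Longrightarrow> \<exists>c. germ_ideal \<Phi> P (\<lambda>X. h X - (\<Sum>e\<in>E. c e * e X))"
  shows "local_multiplicity \<Phi> P \<le> enat (card E)"
  unfolding local_multiplicity_def
proof (rule INF_lower, safe)
  fix h :: "'a \<Rightarrow> real" assume "smooth_at P h"
  then obtain c where "germ_ideal \<Phi> P (\<lambda>X. h X - (\<Sum>e\<in>E. c e * e X))" using assms(3) by blast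
  then obtain a where a: "\<forall>\<phi>\<in>\<Phi>. smooth_at P (a \<phi>)"
    "\<forall>\<^sub>F X in nhds P. h X - (\<Sum>e\<in>E. c e * e X) = (\<Sum>\<phi>\<in>\<Phi>. a \<phi> X * \<phi> X)"
    unfolding germ_ideal_def by blast
  have "\<forall>\<^sub>F X in nhds P. h X = (\<Sum>e\<in>E. c e * e X) + (\<Sum>\<phi>\<in>\<Phi>. a \<phi> X * \<phi> X)"
    using a(2) by eventually_elim simp
  then show "\<exists>c a. (\<forall>\<phi>\<in>\<Phi>. smooth_at P (a \<phi>)) \<and>
     (\<forall>\<^sub>F X in nhds P. h X = (\<Sum>e\<in>E. c e * e X) + (\<Sum>\<phi>\<in>\<Phi>. a \<phi> X * \<phi> X))"
    using a(1) by blast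
qed (use assms in auto)

text \<open>Lower bounds: a linear map onto a space of dimension \<open>n\<close> that vanishes on the ideal factors through the quotient,
so a set spanning the quotient has at least \<open>n\<close> elements.\<close>

lemma local_multiplicity_ge:
  fixes \<Lambda> :: "('a::euclidean_space \<Rightarrow> real) \<Rightarrow> 'b::euclidean_space"
  assumes fin: "finite \<Phi>" and sm: "\<And>\<phi>. \<phi> \<in> \<Phi> \<Longrightarrow> smooth_at P \<phi>"
    and add: "\<And>h h'. smooth_at P h \<Longrightarrow> smooth_at P h' \<Longrightarrow> \<Lambda> (\<lambda>X. h X + h' X) = \<Lambda> h + \<Lambda> h'"
    and scale: "\<And>h c. smooth_at P h \<Longrightarrow> \<Lambda> (\<lambda>X. c * h X) = c *\<^sub>R \<Lambda> h"
    and cong: "\<And>h h'. \<forall>\<^sub>F X in nhds P. h X = h' X \<Longrightarrow> \<Lambda> h = \<Lambda> h'"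
    and kill: "\<And>a \<phi>. smooth_at P a \<Longrightarrow> \<phi> \<in> \<Phi> \<Longrightarrow> \<Lambda> (\<lambda>X. a X * \<phi> X) = 0"
    and surj: "\<And>y. \<exists>h. smooth_at P h \<and> \<Lambda> h = y"
  shows "enat DIM('b) \<le> local_multiplicity \<Phi> P"
  unfolding local_multiplicity_def
proof (rule INF_greatest, clarify)
  fix E assume E: "finite E" "\<forall>e\<in>E. smooth_at P e" "\<forall>h. smooth_at P h \<longrightarrow>
             (\<exists>c a. (\<forall>\<phi>\<in>\<Phi>. smooth_at P (a \<phi>)) \<and>
                (\<forall>\<^sub>F X in nhds P. h X = (\<Sum>e\<in>E. c e * e X) + (\<Sum>\<phi>\<in>\<Phi>. a \<phi> X * \<phi> X)))"
  have zero: "\<Lambda> (\<lambda>X. 0) = 0" using scale[of "\<lambda>X. 0" 0] by simp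
  have sum: "\<Lambda> (\<lambda>X. \<Sum>i\<in>I. k i X) = (\<Sum>i\<in>I. \<Lambda> (k i))" if "finite I" "\<And>i. i \<in> I \<Longrightarrow> smooth_at P (k i)"
    for I :: "('a \<Rightarrow> real) set" and k
    using that by (induction I rule: finite_induct) (auto simp: zero add smooth_at_sum)
  have "y \<in> span (\<Lambda> ` E)" for y
  proof -
    obtain h where h: "smooth_at P h" "\<Lambda> h = y" using surj by blast
    obtain c a where a: "\<forall>\<phi>\<in>\<Phi>. smooth_at P (a \<phi>)"
      and ev: "\<forall>\<^sub>F X in nhds P. h X = (\<Sum>e\<in>E. c e * e X) + (\<Sum>\<phi>\<in>\<Phi>. a \<phi> X * \<phi> X)"
      using E(3) h(1) by blast
    have s1: "smooth_at P (\<lambda>X. c e * e X)" if "e \<in> E" for e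
      using E(2) that by (auto intro: smooth_at_mult)
    have s2: "smooth_at P (\<lambda>X. a \<phi> X * \<phi> X)" if "\<phi> \<in> \<Phi>" for \<phi>
      using a sm that by (auto intro: smooth_at_mult)
    have "y = \<Lambda> (\<lambda>X. (\<Sum>e\<in>E. c e * e X) + (\<Sum>\<phi>\<in>\<Phi>. a \<phi> X * \<phi> X))"
      using cong[OF ev] h(2) by simp
    also have "\<dots> = \<Lambda> (\<lambda>X. \<Sum>e\<in>E. c e * e X) + \<Lambda> (\<lambda>X. \<Sum>\<phi>\<in>\<Phi>. a \<phi> X * \<phi> X)"
      by (rule add) (auto intro!: smooth_at_sum s1 s2)
    also have "\<Lambda> (\<lambda>X. \<Sum>\<phi>\<in>\<Phi>. a \<phi> X * \<phi> X) = 0"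
      using sum[OF fin, of "\<lambda>\<phi> X. a \<phi> X * \<phi> X"] s2 kill a by simp
    also have "\<Lambda> (\<lambda>X. \<Sum>e\<in>E. c e * e X) = (\<Sum>e\<in>E. c e *\<^sub>R \<Lambda> e)"
      using sum[OF E(1), of "\<lambda>e X. c e * e X"] s1 scale E(2) by simp
    finally have "y = (\<Sum>e\<in>E. c e *\<^sub>R \<Lambda> e)" by simp
    moreover have "(\<Sum>e\<in>E. c e *\<^sub>R \<Lambda> e) \<in> span (\<Lambda> ` E)"
      by (intro span_sum span_scale span_base imageI)
    ultimately show ?thesis by simp
  qed
  then have "UNIV \<subseteq> span (\<Lambda> ` E)" by blast
  then have "dim (UNIV :: 'b set) \<le> card (\<Lambda> ` E)"
    using E(1) by (intro span_card_ge_dim) auto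
  also have "\<dots> \<le> card E" using E(1) by (rule card_image_le)
  finally show "enat DIM('b) \<le> enat (card E)" by simp
qed

section \<open>Intersection multiplicity of a curve with the cone\<close>

type_synonym R3 = "real \<times> real \<times> real"

definition cone_form :: "R3 \<Rightarrow> real" where "cone_form = (\<lambda>(u, v, w). v\<^sup>2 - u * w)"

definition grad3 :: "(R3 \<Rightarrow> real) \<Rightarrow> R3 \<Rightarrow> R3" where
  "grad3 h P = (dd (1, 0, 0) h P, dd (0, 1, 0) h P, dd (0, 0, 1) h P)"

definition cross :: "R3 \<Rightarrow> R3 \<Rightarrow> R3" where
  "cross = (\<lambda>(a, b, c) (a', b', c'). (b * c' - c * b', c * a' - a * c', a * b' - b * a'))"

lemma Basis_R3: "(Basis :: R3 set) = {(1, 0, 0), (0, 1, 0), (0, 0, 1)}"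
  by (auto simp: Basis_prod_def zero_prod_def)

lemma sum_Basis_R3: "(\<Sum>b\<in>Basis. k b) = k (1, 0, 0) + k (0, 1, 0) + k ((0, 0, 1) :: R3)"
  by (simp add: Basis_R3 add.assoc)

lemma dd_grad3: "h differentiable (at P) \<Longrightarrow> dd v h P = grad3 h P \<bullet> v"
  using dd_linear_expand[of h P v] by (cases v) (simp add: sum_Basis_R3 grad3_def mult.commute)

lemma smooth_at_differentiable: "smooth_at P h \<Longrightarrow> h differentiable (at P)"
  unfolding smooth_at_def using smooth_on_differentiable by metis

lemma smooth_on_cone: "smooth_on UNIV cone_form"
proof -
  have "smooth_on UNIV (\<lambda>X::R3. (fst (snd X))\<^sup>2 - fst X * snd (snd X))"
    by (intro smooth_on_diff smooth_on_mult smooth_on_power smooth_on_fst smooth_on_snd smooth_on_id open_UNIV)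
  then show ?thesis by (simp add: cone_form_def case_prod_unfold)
qed

lemma smooth_at_cone: "smooth_at P cone_form"
  using smooth_on_cone by (auto intro: smooth_atI)

lemma cone_has_derivative:
  "(cone_form has_derivative (\<lambda>X. 2 * fst (snd P) * fst (snd X) - fst P * snd (snd X) - fst X * snd (snd P))) (at P)"
proof -
  have "((\<lambda>X::R3. (fst (snd X))\<^sup>2 - fst X * snd (snd X)) has_derivative
     (\<lambda>X. 2 * fst (snd P) * fst (snd X) - fst P * snd (snd X) - fst X * snd (snd P))) (at P)"
    by (auto intro!: derivative_eq_intros simp: algebra_simps)
  then show ?thesis by (simp add: cone_form_def case_prod_unfold)
qed

lemma dd_cone: "dd v cone_form P = 2 * fst (snd P) * fst (snd v) - fst P * snd (snd v) - fst v * snd (snd P)"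
  by (rule dd_unique[OF cone_has_derivative])

lemma dd_cone_0: "dd v cone_form 0 = 0" and cone_0: "cone_form 0 = 0"
  by (simp_all add: dd_cone) (simp add: cone_form_def zero_prod_def)

lemma hadamard_at:
  fixes h :: "'a::euclidean_space \<Rightarrow> real"
  assumes "smooth_at P h"
  obtains a where "\<forall>b. smooth_at P (a b) \<and> a b P = dd b h P"
    "\<forall>\<^sub>F X in nhds P. h X = h P + (\<Sum>b\<in>Basis. ((X - P) \<bullet> b) * a b X)"
proof -
  obtain r where r: "r > 0" "smooth_on (ball P r) h" using smooth_at_ball[OF assms] .
  show ?thesis
  proof (rule hadamard[OF r(2)])
    fix a
    assume a: "\<And>b. smooth_on (ball P r) (a b)" "\<And>b. a b P = dd b h P"
      "\<And>X. X \<in> ball P r \<Longrightarrow> h X = h P + (\<Sum>b\<in>Basis. ((X - P) \<bullet> b) * a b X)"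
    have "P \<in> ball P r" using r(1) by simp
    then have "smooth_at P (a b)" for b using a(1)[of b] by (rule smooth_atI[OF open_ball])
    moreover have "\<forall>\<^sub>F X in nhds P. h X = h P + (\<Sum>b\<in>Basis. ((X - P) \<bullet> b) * a b X)"
    proof -
      have "\<forall>\<^sub>F X in nhds P. X \<in> ball P r" using r(1) by (intro eventually_nhds_in_open) auto
      then show ?thesis by (rule eventually_mono) (rule a(3))
    qed
    ultimately show thesis using that[of a] a(2) by simp
  qed
qed

lemma smooth_at_inner_left: "smooth_at P (\<lambda>X. (X - Q) \<bullet> b)"
proof -
  have "smooth_at P (\<lambda>X. X \<bullet> b - Q \<bullet> b)"
    by (intro smooth_at_diff smooth_at_const smooth_at_linear bounded_linear_inner_left)
  then show ?thesis by (simp add: inner_diff_left)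
qed

lemma germ_ideal_cancel:
  assumes "germ_ideal \<Phi> P (\<lambda>X. d X * h X)" "smooth_at P d" "d P \<noteq> 0"
  shows "germ_ideal \<Phi> P h"
proof -
  have "germ_ideal \<Phi> P (\<lambda>X. inverse (d X) * (d X * h X))"
    by (intro germ_ideal_mult assms smooth_at_inverse)
  moreover have "\<forall>\<^sub>F X in nhds P. h X = inverse (d X) * (d X * h X)"
  proof -
    have "\<forall>\<^sub>F X in nhds P. d X \<noteq> 0"
    proof -
      have "(d \<longlongrightarrow> d P) (nhds P)" using smooth_at_isCont[OF assms(2)] by (simp add: isCont_def tendsto_nhds_iff)
      then show ?thesis using assms(3) by (rule tendsto_imp_eventually_ne)
    qed
    then show ?thesis by eventually_elim simp
  qed
  ultimately show ?thesis by (rule germ_ideal_cong)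
qed

text \<open>If the three gradients are independent, the coefficient matrix supplied by Hadamard's lemma is invertible near \<open>P\<close>.
By Cramer's rule the coordinate functions then lie in the ideal, and only constants survive in the quotient.\<close>

lemma multiplicity_le_1_transversal:
  assumes s: "smooth_at P \<phi>1" "smooth_at P \<phi>2" "smooth_at P \<phi>3"
    and z: "\<phi>1 P = 0" "\<phi>2 P = 0" "\<phi>3 P = 0"
    and det: "cross (grad3 \<phi>1 P) (grad3 \<phi>2 P) \<bullet> grad3 \<phi>3 P \<noteq> 0"
  shows "local_multiplicity {\<phi>1, \<phi>2, \<phi>3} P \<le> 1"
proof -
  let ?\<Phi> = "{\<phi>1, \<phi>2, \<phi>3}"
  let ?e1 = "(1, 0, 0) :: R3" and ?e2 = "(0, 1, 0) :: R3" and ?e3 = "(0, 0, 1) :: R3"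
  obtain a where a': "\<forall>b. smooth_at P (a b) \<and> a b P = dd b \<phi>1 P"
    "\<forall>\<^sub>F X in nhds P. \<phi>1 X = \<phi>1 P + (\<Sum>b\<in>Basis. ((X - P) \<bullet> b) * a b X)" using hadamard_at[OF s(1)] .
  then have a: "smooth_at P (a b)" "a b P = dd b \<phi>1 P" for b by blast+
  obtain b where b': "\<forall>i. smooth_at P (b i) \<and> b i P = dd i \<phi>2 P"
    "\<forall>\<^sub>F X in nhds P. \<phi>2 X = \<phi>2 P + (\<Sum>i\<in>Basis. ((X - P) \<bullet> i) * b i X)" using hadamard_at[OF s(2)] .
  then have b: "smooth_at P (b i)" "b i P = dd i \<phi>2 P" for i by blast+
  obtain c where c': "\<forall>i. smooth_at P (c i) \<and> c i P = dd i \<phi>3 P"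
    "\<forall>\<^sub>F X in nhds P. \<phi>3 X = \<phi>3 P + (\<Sum>i\<in>Basis. ((X - P) \<bullet> i) * c i X)" using hadamard_at[OF s(3)] .
  then have c: "smooth_at P (c i)" "c i P = dd i \<phi>3 P" for i by blast+
  let ?n1 = "\<lambda>x y. \<lambda>X. x ?e2 X * y ?e3 X - x ?e3 X * y ?e2 X"
  let ?n2 = "\<lambda>x y. \<lambda>X. x ?e3 X * y ?e1 X - x ?e1 X * y ?e3 X"
  let ?n3 = "\<lambda>x y. \<lambda>X. x ?e1 X * y ?e2 X - x ?e2 X * y ?e1 X"
  define d where "d X = ?n1 a b X * c ?e1 X + ?n2 a b X * c ?e2 X + ?n3 a b X * c ?e3 X" for X
  have sd: "smooth_at P d" unfolding d_def[abs_def]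
    by (intro smooth_at_add smooth_at_mult smooth_at_diff a b c)
  have dP: "d P \<noteq> 0" using det by (simp add: d_def a b c cross_def grad3_def add.assoc)
  have gen: "germ_ideal ?\<Phi> P (\<lambda>X. x X * \<phi>1 X + y X * \<phi>2 X + w X * \<phi>3 X)"
    if "smooth_at P x" "smooth_at P y" "smooth_at P w" for x y w
    using that by (intro germ_ideal_add germ_ideal_mult germ_ideal_generator) auto
  have ev: "\<forall>\<^sub>F X in nhds P. 
      \<phi>1 X = ((X - P) \<bullet> ?e1) * a ?e1 X + ((X - P) \<bullet> ?e2) * a ?e2 X + ((X - P) \<bullet> ?e3) * a ?e3 X \<and>
      \<phi>2 X = ((X - P) \<bullet> ?e1) * b ?e1 X + ((X - P) \<bullet> ?e2) * b ?e2 X + ((X - P) \<bullet> ?e3) * b ?e3 X \<and>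
      \<phi>3 X = ((X - P) \<bullet> ?e1) * c ?e1 X + ((X - P) \<bullet> ?e2) * c ?e2 X + ((X - P) \<bullet> ?e3) * c ?e3 X"
    using a'(2) b'(2) c'(2) unfolding sum_Basis_R3 z by eventually_elim simp
  have coord: "germ_ideal ?\<Phi> P (\<lambda>X. d X * ((X - P) \<bullet> i))" if i: "i \<in> Basis" for i
  proof -
    consider "i = ?e1" | "i = ?e2" | "i = ?e3" using i unfolding Basis_R3 by blast
    then show ?thesis
    proof cases
      case 1
      have "germ_ideal ?\<Phi> P (\<lambda>X. ?n1 b c X * \<phi>1 X + ?n1 c a X * \<phi>2 X + ?n1 a b X * \<phi>3 X)"
        by (intro gen smooth_at_mult smooth_at_diff a b c)
      then show ?thesis
      proof (rule germ_ideal_cong)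
        show "\<forall>\<^sub>F X in nhds P. d X * ((X - P) \<bullet> i) = ?n1 b c X * \<phi>1 X + ?n1 c a X * \<phi>2 X + ?n1 a b X * \<phi>3 X"
          using ev
        proof eventually_elim
          case (elim X)
          show ?case
            unfolding 1 d_def elim[THEN conjunct1] elim[THEN conjunct2, THEN conjunct1] elim[THEN conjunct2, THEN conjunct2]
            by algebra
        qed
      qed
    next
      case 2
      have "germ_ideal ?\<Phi> P (\<lambda>X. ?n2 b c X * \<phi>1 X + ?n2 c a X * \<phi>2 X + ?n2 a b X * \<phi>3 X)"
        by (intro gen smooth_at_mult smooth_at_diff a b c)
      then show ?thesis
      proof (rule germ_ideal_cong)
        show "\<forall>\<^sub>F X in nhds P. d X * ((X - P) \<bullet> i) = ?n2 b c X * \<phi>1 X + ?n2 c a X * \<phi>2 X + ?n2 a b X * \<phi>3 X"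
          using ev
        proof eventually_elim
          case (elim X)
          show ?case
            unfolding 2 d_def elim[THEN conjunct1] elim[THEN conjunct2, THEN conjunct1] elim[THEN conjunct2, THEN conjunct2]
            by algebra
        qed
      qed
    next
      case 3
      have "germ_ideal ?\<Phi> P (\<lambda>X. ?n3 b c X * \<phi>1 X + ?n3 c a X * \<phi>2 X + ?n3 a b X * \<phi>3 X)"
        by (intro gen smooth_at_mult smooth_at_diff a b c)
      then show ?thesis
      proof (rule germ_ideal_cong)
        show "\<forall>\<^sub>F X in nhds P. d X * ((X - P) \<bullet> i) = ?n3 b c X * \<phi>1 X + ?n3 c a X * \<phi>2 X + ?n3 a b X * \<phi>3 X"
          using ev
        proof eventually_elim
          case (elim X)
          show ?case
            unfolding 3 d_def elim[THEN conjunct1] elim[THEN conjunct2, THEN conjunct1] elim[THEN conjunct2, THEN conjunct2]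
            by algebra
        qed
      qed
    qed
  qed
  have "local_multiplicity ?\<Phi> P \<le> enat (card {\<lambda>X::R3. 1 :: real})"
  proof (rule local_multiplicity_le)
    fix h :: "R3 \<Rightarrow> real" assume sh: "smooth_at P h"
    obtain k where k': "\<forall>b. smooth_at P (k b) \<and> k b P = dd b h P"
      "\<forall>\<^sub>F X in nhds P. h X = h P + (\<Sum>b\<in>Basis. ((X - P) \<bullet> b) * k b X)" using hadamard_at[OF sh] .
    then have k: "smooth_at P (k b)" for b by blast+
    have "germ_ideal ?\<Phi> P (\<lambda>X. \<Sum>i\<in>Basis. k i X * ((X - P) \<bullet> i))"
      by (intro germ_ideal_sum germ_ideal_mult k germ_ideal_cancel[OF coord sd dP])
    then have "germ_ideal ?\<Phi> P (\<lambda>X. h X - (\<Sum>e\<in>{\<lambda>X. 1}. (\<lambda>_. h P) e * e X))"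
      by (rule germ_ideal_cong) (use k'(2) in eventually_elim, simp add: mult.commute)
    then show "\<exists>c. germ_ideal ?\<Phi> P (\<lambda>X. h X - (\<Sum>e\<in>{\<lambda>X. 1}. c e * e X))" by (rule exI[of _ "\<lambda>_. h P"])
  qed auto
  then show ?thesis by (simp add: one_enat_def)
qed

text \<open>By Hadamard's lemma \<open>\<phi>1 = a \<bullet> x\<close> and \<open>\<phi>2 = b \<bullet> x\<close> with vector-valued smooth \<open>a\<close> and \<open>b\<close>. Let \<open>n = a \<times> b\<close>. Since
\<open>x \<times> n = \<phi>2 a - \<phi>1 b\<close>, the vectors \<open>x\<close> and \<open>n\<close> are proportional modulo the ideal: \<open>x\<^sub>i n\<^sub>j\<close> and \<open>x\<^sub>j n\<^sub>i\<close> are congruent. Hence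
\<open>x\<^sub>i x\<^sub>j q(n)\<close> is congruent to \<open>n\<^sub>i n\<^sub>j q(x)\<close>, which lies in the ideal, and as \<open>q(n)\<close> is a unit all quadratic
monomials lie in the ideal. Modulo these, the proportionality leaves one of the three coordinates, so the
quotient is spanned by that coordinate and the constant 1.\<close>

lemma multiplicity_le_2_vertex:
  assumes s: "smooth_at 0 \<phi>1" "smooth_at 0 \<phi>2"
    and z: "\<phi>1 0 = 0" "\<phi>2 0 = 0"
    and det: "cone_form (cross (grad3 \<phi>1 0) (grad3 \<phi>2 0)) \<noteq> 0"
  shows "local_multiplicity {\<phi>1, \<phi>2, cone_form} 0 \<le> 2"
proof -
  let ?\<Phi> = "{\<phi>1, \<phi>2, cone_form}"
  let ?I = "germ_ideal ?\<Phi> 0"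
  let ?e1 = "(1, 0, 0) :: R3" and ?e2 = "(0, 1, 0) :: R3" and ?e3 = "(0, 0, 1) :: R3"
  obtain a where a': "\<forall>b. smooth_at 0 (a b) \<and> a b 0 = dd b \<phi>1 0"
    "\<forall>\<^sub>F X in nhds 0. \<phi>1 X = \<phi>1 0 + (\<Sum>b\<in>Basis. ((X - 0) \<bullet> b) * a b X)" using hadamard_at[OF s(1)] .
  then have a: "smooth_at 0 (a b)" "a b 0 = dd b \<phi>1 0" for b by blast+
  obtain b where b': "\<forall>i. smooth_at 0 (b i) \<and> b i 0 = dd i \<phi>2 0"
    "\<forall>\<^sub>F X in nhds 0. \<phi>2 X = \<phi>2 0 + (\<Sum>i\<in>Basis. ((X - 0) \<bullet> i) * b i X)" using hadamard_at[OF s(2)] .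
  then have b: "smooth_at 0 (b i)" "b i 0 = dd i \<phi>2 0" for i by blast+
  define n where "n i X = (if i = ?e1 then a ?e2 X * b ?e3 X - a ?e3 X * b ?e2 X
     else if i = ?e2 then a ?e3 X * b ?e1 X - a ?e1 X * b ?e3 X
     else a ?e1 X * b ?e2 X - a ?e2 X * b ?e1 X)" for i X
  have n123: "n ?e1 = (\<lambda>X. a ?e2 X * b ?e3 X - a ?e3 X * b ?e2 X)"
    "n ?e2 = (\<lambda>X. a ?e3 X * b ?e1 X - a ?e1 X * b ?e3 X)"
    "n ?e3 = (\<lambda>X. a ?e1 X * b ?e2 X - a ?e2 X * b ?e1 X)"
    by (auto simp: n_def fun_eq_iff)
  have sn: "smooth_at 0 (n i)" for i
    unfolding n_def[abs_def] by (cases "i = ?e1"; cases "i = ?e2"; simp; intro smooth_at_mult smooth_at_diff a b)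
  have ev: "\<forall>\<^sub>F X in nhds 0. 
      \<phi>1 X = (X \<bullet> ?e1) * a ?e1 X + (X \<bullet> ?e2) * a ?e2 X + (X \<bullet> ?e3) * a ?e3 X \<and>
      \<phi>2 X = (X \<bullet> ?e1) * b ?e1 X + (X \<bullet> ?e2) * b ?e2 X + (X \<bullet> ?e3) * b ?e3 X"
    using a'(2) b'(2) unfolding sum_Basis_R3 z by eventually_elim simp
  have gen: "?I (\<lambda>X. x X * \<phi>2 X - y X * \<phi>1 X)"
    if "smooth_at 0 x" "smooth_at 0 y" for x y
    using that by (intro germ_ideal_diff germ_ideal_mult germ_ideal_generator) auto
  have K: "?I (\<lambda>X. (X \<bullet> ?e1) * n ?e2 X - (X \<bullet> ?e2) * n ?e1 X)"
    "?I (\<lambda>X. (X \<bullet> ?e2) * n ?e3 X - (X \<bullet> ?e3) * n ?e2 X)"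
    "?I (\<lambda>X. (X \<bullet> ?e3) * n ?e1 X - (X \<bullet> ?e1) * n ?e3 X)"
  proof -
    have 1: "\<forall>\<^sub>F X in nhds 0. (X \<bullet> ?e1) * n ?e2 X - (X \<bullet> ?e2) * n ?e1 X = a ?e3 X * \<phi>2 X - b ?e3 X * \<phi>1 X"
      using ev
    proof eventually_elim
      case (elim X)
      show ?case unfolding n123 elim[THEN conjunct1] elim[THEN conjunct2] by algebra
    qed
    have 2: "\<forall>\<^sub>F X in nhds 0. (X \<bullet> ?e2) * n ?e3 X - (X \<bullet> ?e3) * n ?e2 X = a ?e1 X * \<phi>2 X - b ?e1 X * \<phi>1 X"
      using ev
    proof eventually_elim
      case (elim X)
      show ?case unfolding n123 elim[THEN conjunct1] elim[THEN conjunct2] by algebra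
    qed
    have 3: "\<forall>\<^sub>F X in nhds 0. (X \<bullet> ?e3) * n ?e1 X - (X \<bullet> ?e1) * n ?e3 X = a ?e2 X * \<phi>2 X - b ?e2 X * \<phi>1 X"
      using ev
    proof eventually_elim
      case (elim X)
      show ?case unfolding n123 elim[THEN conjunct1] elim[THEN conjunct2] by algebra
    qed
    show "?I (\<lambda>X. (X \<bullet> ?e1) * n ?e2 X - (X \<bullet> ?e2) * n ?e1 X)"
      by (rule germ_ideal_cong[OF gen[OF a(1) b(1)] 1])
    show "?I (\<lambda>X. (X \<bullet> ?e2) * n ?e3 X - (X \<bullet> ?e3) * n ?e2 X)"
      by (rule germ_ideal_cong[OF gen[OF a(1) b(1)] 2])
    show "?I (\<lambda>X. (X \<bullet> ?e3) * n ?e1 X - (X \<bullet> ?e1) * n ?e3 X)"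
      by (rule germ_ideal_cong[OF gen[OF a(1) b(1)] 3])
  qed
  have neg: "?I (\<lambda>X. x X - y X)" if "?I (\<lambda>X. y X - x X)" for x y
    using germ_ideal_diff[OF germ_ideal_zero that] by simp
  have M: "?I (\<lambda>X. (X \<bullet> j) * n k X - (X \<bullet> k) * n j X)" if "j \<in> Basis" "k \<in> Basis" for j k
    using that K neg[OF K(1)] neg[OF K(2)] neg[OF K(3)] germ_ideal_zero[of ?\<Phi> 0]
    unfolding Basis_R3 by auto
  let ?q = "\<lambda>X. n ?e2 X * n ?e2 X - n ?e1 X * n ?e3 X"
  have sq: "smooth_at 0 ?q" by (intro smooth_at_mult smooth_at_diff sn)
  have q0: "?q 0 \<noteq> 0"
    using det by (simp add: n123 a(2) b(2) cone_form_def cross_def grad3_def power2_eq_square)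
  have e: "?e1 \<in> Basis" "?e2 \<in> Basis" "?e3 \<in> Basis" unfolding Basis_R3 by blast+
  have sx: "smooth_at 0 (\<lambda>X::R3. X \<bullet> i)" for i using smooth_at_inner_left[of 0 0 i] by simp
  \<comment> \<open>Two exchanges of indices turn \<open>x\<^sub>j x\<^sub>k n\<^sub>u n\<^sub>v\<close> into \<open>n\<^sub>j n\<^sub>k x\<^sub>u x\<^sub>v\<close>; summing up with the coefficients of the quadratic form gives a multiple of the equation of the cone.\<close>
  have quad: "?I (\<lambda>X. (X \<bullet> j) * (X \<bullet> k))" if jk: "j \<in> Basis" "k \<in> Basis" for j k
  proof (rule germ_ideal_cancel[OF _ sq q0])
    have P: "?I (\<lambda>X. ((X \<bullet> j) * n u X) * ((X \<bullet> k) * n v X - (X \<bullet> v) * n k X)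
        + (n k X * (X \<bullet> v)) * ((X \<bullet> j) * n u X - (X \<bullet> u) * n j X))" if "u \<in> Basis" "v \<in> Basis" for u v
      by (intro germ_ideal_add germ_ideal_mult M jk that smooth_at_mult sx sn)
    have big: "?I (\<lambda>X. (n j X * n k X) * cone_form X +
      ((((X \<bullet> j) * n ?e2 X) * ((X \<bullet> k) * n ?e2 X - (X \<bullet> ?e2) * n k X)
        + (n k X * (X \<bullet> ?e2)) * ((X \<bullet> j) * n ?e2 X - (X \<bullet> ?e2) * n j X))
      - (((X \<bullet> j) * n ?e1 X) * ((X \<bullet> k) * n ?e3 X - (X \<bullet> ?e3) * n k X)
        + (n k X * (X \<bullet> ?e3)) * ((X \<bullet> j) * n ?e1 X - (X \<bullet> ?e1) * n j X))))"
      by (intro germ_ideal_add[OF germ_ideal_mult germ_ideal_diff] P e germ_ideal_generator smooth_at_mult sn) auto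
    have cq: "cone_form X = (X \<bullet> ?e2) * (X \<bullet> ?e2) - (X \<bullet> ?e1) * (X \<bullet> ?e3)" for X
      by (cases X) (simp add: cone_form_def power2_eq_square)
    show "?I (\<lambda>X. ?q X * ((X \<bullet> j) * (X \<bullet> k)))"
    proof (rule germ_ideal_cong[OF big], intro always_eventually allI)
      fix X
      show "?q X * ((X \<bullet> j) * (X \<bullet> k)) = (n j X * n k X) * cone_form X +
      ((((X \<bullet> j) * n ?e2 X) * ((X \<bullet> k) * n ?e2 X - (X \<bullet> ?e2) * n k X)
        + (n k X * (X \<bullet> ?e2)) * ((X \<bullet> j) * n ?e2 X - (X \<bullet> ?e2) * n j X))
      - (((X \<bullet> j) * n ?e1 X) * ((X \<bullet> k) * n ?e3 X - (X \<bullet> ?e3) * n k X)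
        + (n k X * (X \<bullet> ?e3)) * ((X \<bullet> j) * n ?e1 X - (X \<bullet> ?e1) * n j X)))"
        unfolding cq by algebra
    qed
  qed
  have const: "?I (\<lambda>X. s X * (X \<bullet> j) - s 0 * (X \<bullet> j))" if sj: "smooth_at 0 s" "j \<in> Basis" for s j
  proof -
    obtain k where k: "\<forall>b. smooth_at 0 (k b) \<and> k b 0 = dd b s 0"
      "\<forall>\<^sub>F X in nhds 0. s X = s 0 + (\<Sum>b\<in>Basis. ((X - 0) \<bullet> b) * k b X)" using hadamard_at[OF sj(1)] .
    have "?I (\<lambda>X. \<Sum>i\<in>Basis. k i X * ((X \<bullet> i) * (X \<bullet> j)))"
      by (intro germ_ideal_sum germ_ideal_mult k(1)[rule_format, THEN conjunct1] quad sj(2))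
    then show ?thesis
      by (rule germ_ideal_cong)
        (use k(2) in eventually_elim, simp add: algebra_simps sum_distrib_left sum_distrib_right)
  qed
  obtain k where k: "k \<in> Basis" "n k 0 \<noteq> 0"
    using q0 e by (metis diff_zero mult_zero_left)
  have lin: "?I (\<lambda>X. (X \<bullet> j) - (n j 0 / n k 0) * (X \<bullet> k))" if "j \<in> Basis" for j
  proof -
    have "?I (\<lambda>X. (1 / n k 0) * (((X \<bullet> j) * n k X - (X \<bullet> k) * n j X) -
        ((n k X * (X \<bullet> j) - n k 0 * (X \<bullet> j)) - (n j X * (X \<bullet> k) - n j 0 * (X \<bullet> k)))))"
      by (intro germ_ideal_mult[OF germ_ideal_diff] germ_ideal_diff[OF const const] M that k sn smooth_at_const)
    then show ?thesis
      by (rule germ_ideal_cong) (use k(2) in \<open>simp add: field_simps\<close>)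
  qed
  let ?one = "\<lambda>X::R3. 1 :: real" and ?x = "\<lambda>X::R3. X \<bullet> k"
  have ne: "?one \<noteq> ?x" by (metis inner_zero_left zero_neq_one)
  have "local_multiplicity ?\<Phi> 0 \<le> enat (card {?one, ?x})"
  proof (rule local_multiplicity_le)
    fix h :: "R3 \<Rightarrow> real" assume sh: "smooth_at 0 h"
    obtain a where a: "\<forall>b. smooth_at 0 (a b) \<and> a b 0 = dd b h 0"
      "\<forall>\<^sub>F X in nhds 0. h X = h 0 + (\<Sum>b\<in>Basis. ((X - 0) \<bullet> b) * a b X)" using hadamard_at[OF sh] .
    define c1 where "c1 = (\<Sum>i\<in>Basis. a i 0 * (n i 0 / n k 0))"
    define c where "c e = (if e = ?one then h 0 else c1)" for e
    have "?I (\<lambda>X. \<Sum>i\<in>Basis. (a i X * (X \<bullet> i) - a i 0 * (X \<bullet> i)) + a i 0 * ((X \<bullet> i) - (n i 0 / n k 0) * (X \<bullet> k)))"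
      by (intro germ_ideal_sum germ_ideal_add germ_ideal_mult const lin a(1)[rule_format, THEN conjunct1] smooth_at_const)
    moreover have "(\<Sum>i\<in>Basis. (a i X * (X \<bullet> i) - a i 0 * (X \<bullet> i)) + a i 0 * ((X \<bullet> i) - (n i 0 / n k 0) * (X \<bullet> k)))
        = (\<Sum>i\<in>Basis. (X \<bullet> i) * a i X) - c1 * (X \<bullet> k)" for X
      unfolding c1_def sum_distrib_right sum_subtractf[symmetric]
      by (intro sum.cong refl) (simp add: algebra_simps)
    ultimately have "?I (\<lambda>X. (\<Sum>i\<in>Basis. (X \<bullet> i) * a i X) - c1 * (X \<bullet> k))" by simp
    then have "?I (\<lambda>X. h X - (\<Sum>e\<in>{?one, ?x}. c e * e X))"
      by (rule germ_ideal_cong) (use a(2) in eventually_elim, use ne in \<open>simp add: c_def\<close>)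
    then show "\<exists>c. ?I (\<lambda>X. h X - (\<Sum>e\<in>{?one, ?x}. c e * e X))" by blast
  qed (use sx[of k] in auto)
  also have "enat (card {?one, ?x}) \<le> 2" using ne by (simp add: numeral_eq_enat)
  finally show ?thesis .
qed

lemma dd_inner: "dd v (\<lambda>X. c * (X \<bullet> a)) P = c * (v \<bullet> a)"
  by (rule dd_unique) (auto intro!: derivative_eq_intros)

lemma smooth_at_inner_scaled: "smooth_at P (\<lambda>X. c * (X \<bullet> a))"
  by (intro smooth_at_mult smooth_at_const smooth_at_linear bounded_linear_inner_left)

lemma dd_const: "dd v (\<lambda>X. c) P = 0"
  by (simp add: dd_def)

lemma dd_const_add:
  assumes "smooth_at P h" shows "dd v (\<lambda>X. c + h X) P = dd v h P"
  using dd_add[OF smooth_at_differentiable[OF smooth_at_const] smooth_at_differentiable[OF assms], of v c]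
  by (simp add: dd_const)

lemma multiplicity_ge_2_tangent:
  fixes \<Phi> :: "('a::euclidean_space \<Rightarrow> real) set"
  assumes fin: "finite \<Phi>" and s: "\<And>\<phi>. \<phi> \<in> \<Phi> \<Longrightarrow> smooth_at P \<phi>"
    and z: "\<And>\<phi>. \<phi> \<in> \<Phi> \<Longrightarrow> \<phi> P = 0" and a: "a \<noteq> 0" "\<And>\<phi>. \<phi> \<in> \<Phi> \<Longrightarrow> dd a \<phi> P = 0"
  shows "2 \<le> local_multiplicity \<Phi> P"
proof -
  have "enat DIM(real \<times> real) \<le> local_multiplicity \<Phi> P"
  proof (rule local_multiplicity_ge[OF fin s, where \<Lambda>="\<lambda>h. (h P, dd a h P)"])
    fix h h' :: "'a \<Rightarrow> real" and c :: real
    assume h: "smooth_at P h"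
    show "(c * h P, dd a (\<lambda>X. c * h X) P) = c *\<^sub>R (h P, dd a h P)"
      by (simp add: dd_cmult[OF smooth_at_differentiable[OF h]])
    assume h': "smooth_at P h'"
    show "(h P + h' P, dd a (\<lambda>X. h X + h' X) P) = (h P, dd a h P) + (h' P, dd a h' P)"
      by (simp add: dd_add[OF smooth_at_differentiable[OF h] smooth_at_differentiable[OF h']])
  next
    fix h h' :: "'a \<Rightarrow> real" assume "\<forall>\<^sub>F X in nhds P. h X = h' X"
    then obtain U where U: "open U" "P \<in> U" "\<And>X. X \<in> U \<Longrightarrow> h X = h' X" unfolding eventually_nhds by blast
    then show "(h P, dd a h P) = (h' P, dd a h' P)" using dd_cong_open[OF U] by simp
  next
    fix c \<phi> :: "'a \<Rightarrow> real" assume c: "smooth_at P c" and p: "\<phi> \<in> \<Phi>"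
    show "(c P * \<phi> P, dd a (\<lambda>X. c X * \<phi> X) P) = 0"
      by (simp add: dd_mult[OF smooth_at_differentiable[OF c] smooth_at_differentiable[OF s[OF p]]] z[OF p] a(2)[OF p] zero_prod_def)
  next
    fix y :: "real \<times> real"
    define h where "h X = (fst y - snd y / (a \<bullet> a) * (P \<bullet> a)) + snd y / (a \<bullet> a) * (X \<bullet> a)" for X
    have "h P = fst y" by (simp add: h_def)
    moreover have "dd a h P = snd y"
      unfolding h_def[abs_def] dd_const_add[OF smooth_at_inner_scaled] dd_inner using a(1) by simp
    moreover have "smooth_at P h" unfolding h_def[abs_def]
      by (intro smooth_at_add smooth_at_const smooth_at_mult smooth_at_linear bounded_linear_inner_left)
    ultimately show "\<exists>h. smooth_at P h \<and> (h P, dd a h P) = y" by (intro exI[of _ h]) simp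
  qed
  then show ?thesis by (simp add: numeral_eq_enat numeral_eq_Suc)
qed

lemma multiplicity_ge_3_tangent_plane:
  fixes \<Phi> :: "('a::euclidean_space \<Rightarrow> real) set"
  assumes fin: "finite \<Phi>" and s: "\<And>\<phi>. \<phi> \<in> \<Phi> \<Longrightarrow> smooth_at P \<phi>"
    and z: "\<And>\<phi>. \<phi> \<in> \<Phi> \<Longrightarrow> \<phi> P = 0"
    and a: "a \<noteq> 0" "\<And>\<phi>. \<phi> \<in> \<Phi> \<Longrightarrow> dd a \<phi> P = 0"
    and b: "b \<noteq> 0" "\<And>\<phi>. \<phi> \<in> \<Phi> \<Longrightarrow> dd b \<phi> P = 0" and ab: "a \<bullet> b = 0"
  shows "3 \<le> local_multiplicity \<Phi> P"
proof -
  have "enat DIM(real \<times> real \<times> real) \<le> local_multiplicity \<Phi> P"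
  proof (rule local_multiplicity_ge[OF fin s, where \<Lambda>="\<lambda>h. (h P, dd a h P, dd b h P)"])
    fix h h' :: "'a \<Rightarrow> real" and c :: real
    assume h: "smooth_at P h"
    show "(c * h P, dd a (\<lambda>X. c * h X) P, dd b (\<lambda>X. c * h X) P) = c *\<^sub>R (h P, dd a h P, dd b h P)"
      by (simp add: dd_cmult[OF smooth_at_differentiable[OF h]])
    assume h': "smooth_at P h'"
    show "(h P + h' P, dd a (\<lambda>X. h X + h' X) P, dd b (\<lambda>X. h X + h' X) P)
        = (h P, dd a h P, dd b h P) + (h' P, dd a h' P, dd b h' P)"
      by (simp add: dd_add[OF smooth_at_differentiable[OF h] smooth_at_differentiable[OF h']])
  next
    fix h h' :: "'a \<Rightarrow> real" assume "\<forall>\<^sub>F X in nhds P. h X = h' X"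
    then obtain U where U: "open U" "P \<in> U" "\<And>X. X \<in> U \<Longrightarrow> h X = h' X" unfolding eventually_nhds by blast
    then show "(h P, dd a h P, dd b h P) = (h' P, dd a h' P, dd b h' P)" using dd_cong_open[OF U] by simp
  next
    fix c \<phi> :: "'a \<Rightarrow> real" assume c: "smooth_at P c" and p: "\<phi> \<in> \<Phi>"
    show "(c P * \<phi> P, dd a (\<lambda>X. c X * \<phi> X) P, dd b (\<lambda>X. c X * \<phi> X) P) = 0"
      by (simp add: dd_mult[OF smooth_at_differentiable[OF c] smooth_at_differentiable[OF s[OF p]]] z[OF p] a(2)[OF p]
          b(2)[OF p] zero_prod_def)
  next
    fix y :: "real \<times> real \<times> real"
    obtain y1 y2 y3 where y: "y = (y1, y2, y3)" by (cases y)
    define L where "L X = y2 / (a \<bullet> a) * (X \<bullet> a) + y3 / (b \<bullet> b) * (X \<bullet> b)" for X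
    define h where "h X = (y1 - L P) + L X" for X
    have dL: "dd v L P = y2 / (a \<bullet> a) * (v \<bullet> a) + y3 / (b \<bullet> b) * (v \<bullet> b)" for v
      unfolding L_def[abs_def]
      by (simp only: dd_add[OF smooth_at_differentiable smooth_at_differentiable, OF smooth_at_inner_scaled smooth_at_inner_scaled] dd_inner)
    have sL: "smooth_at P L" unfolding L_def[abs_def]
      by (intro smooth_at_add smooth_at_const smooth_at_mult smooth_at_linear bounded_linear_inner_left)
    have "h P = y1" by (simp add: h_def)
    moreover have dh: "dd v h P = dd v L P" for v
      unfolding h_def[abs_def] by (rule dd_const_add[OF sL])
    moreover have "dd a L P = y2" "dd b L P = y3"
      using a(1) b(1) ab by (simp_all add: dL inner_commute)
    moreover have "smooth_at P h" unfolding h_def[abs_def]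
      by (intro smooth_at_add smooth_at_const sL)
    ultimately show "\<exists>h. smooth_at P h \<and> (h P, dd a h P, dd b h P) = y" by (intro exI[of _ h]) (simp add: y)
  qed
  then show ?thesis by (simp add: numeral_eq_enat numeral_eq_Suc)
qed

lemma dirs_at_add:
  assumes "smooth_at P h" "smooth_at P h'"
  shows "dirs vs (\<lambda>X. h X + h' X) P = dirs vs h P + dirs vs h' P"
  using smooth_at_common[OF assms] dirs_add by metis

lemma dd_dd_mult_at:
  fixes h h' :: "'a::euclidean_space \<Rightarrow> real"
  assumes "smooth_at P h" "smooth_at P h'"
  shows "dd u (dd v (\<lambda>X. h X * h' X)) P =
    h P * dd u (dd v h') P + dd u h P * dd v h' P + dd v h P * dd u h' P + dd u (dd v h) P * h' P"
proof (rule smooth_at_common[OF assms])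
  fix U assume U: "open U" "P \<in> U" "smooth_on U h" "smooth_on U h'"
  have d: "h differentiable at X" "h' differentiable at X" "dd v h differentiable at X" "dd v h' differentiable at X"
    if "X \<in> U" for X
    using that U smooth_on_dd by (metis smooth_on_differentiable)+
  have "dd u (dd v (\<lambda>X. h X * h' X)) P = dd u (\<lambda>X. h X * dd v h' X + dd v h X * h' X) P"
    by (rule dd_cong_open[OF U(1,2)]) (rule dd_mult[OF d(1,2)])
  also have "\<dots> = dd u (\<lambda>X. h X * dd v h' X) P + dd u (\<lambda>X. dd v h X * h' X) P"
    using d[OF U(2)] by (intro dd_add) (auto intro!: derivative_intros)
  finally show ?thesis
    using d[OF U(2)] by (simp add: dd_mult)
qed

text \<open>The functional \<open>h \<mapsto> D\<^sub>n D\<^sub>n h + D\<^sub>m h\<close> is the second derivative of \<open>h\<close> along the curve \<open>P + t n + t\<^sup>2 m / 2\<close>. So the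
hypotheses say that all generators vanish to third order along this curve, and the 2-jets along the curve
give a map from the quotient onto a space of dimension three.\<close>

lemma multiplicity_ge_3_tangent_curve:
  fixes \<Phi> :: "('a::euclidean_space \<Rightarrow> real) set"
  assumes fin: "finite \<Phi>" and s: "\<And>\<phi>. \<phi> \<in> \<Phi> \<Longrightarrow> smooth_at P \<phi>"
    and z: "\<And>\<phi>. \<phi> \<in> \<Phi> \<Longrightarrow> \<phi> P = 0"
    and n: "n \<noteq> 0" "\<And>\<phi>. \<phi> \<in> \<Phi> \<Longrightarrow> dd n \<phi> P = 0"
    and m: "\<And>\<phi>. \<phi> \<in> \<Phi> \<Longrightarrow> dd n (dd n \<phi>) P + dd m \<phi> P = 0"
  shows "3 \<le> local_multiplicity \<Phi> P"
proof -
  let ?\<Lambda> = "\<lambda>h. (h P, dd n h P, dd n (dd n h) P + dd m h P) :: real \<times> real \<times> real"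
  have "enat DIM(real \<times> real \<times> real) \<le> local_multiplicity \<Phi> P"
  proof (rule local_multiplicity_ge[OF fin s, where \<Lambda>="?\<Lambda>"])
    fix h h' :: "'a \<Rightarrow> real" and c :: real
    assume h: "smooth_at P h"
    have "dd n (dd n (\<lambda>X. c * h X)) P = c * dd n (dd n h) P"
      using dd_dd_mult_at[OF smooth_at_const[of P c] h, of n n] by (simp add: dd_def)
    then show "?\<Lambda> (\<lambda>X. c * h X) = c *\<^sub>R ?\<Lambda> h"
      by (simp add: dd_cmult[OF smooth_at_differentiable[OF h]] algebra_simps)
    assume h': "smooth_at P h'"
    show "?\<Lambda> (\<lambda>X. h X + h' X) = ?\<Lambda> h + ?\<Lambda> h'"
      using dirs_at_add[OF h h', where vs="[n, n]"]
      by (simp add: dd_add[OF smooth_at_differentiable[OF h] smooth_at_differentiable[OF h']])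
  next
    fix h h' :: "'a \<Rightarrow> real" assume "\<forall>\<^sub>F X in nhds P. h X = h' X"
    then obtain U where U: "open U" "P \<in> U" "\<And>X. X \<in> U \<Longrightarrow> h X = h' X" unfolding eventually_nhds by blast
    then show "?\<Lambda> h = ?\<Lambda> h'" using dd_cong_open[OF U] dirs_cong_open[OF U(1,3,2), where vs="[n, n]"] by simp
  next
    fix c \<phi> :: "'a \<Rightarrow> real" assume c: "smooth_at P c" and p: "\<phi> \<in> \<Phi>"
    have "dd n (dd n (\<lambda>X. c X * \<phi> X)) P + dd m (\<lambda>X. c X * \<phi> X) P = c P * (dd n (dd n \<phi>) P + dd m \<phi> P)"
      by (simp add: dd_dd_mult_at[OF c s[OF p]] dd_mult[OF smooth_at_differentiable[OF c] smooth_at_differentiable[OF s[OF p]]]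
          z[OF p] n(2)[OF p] distrib_left)
    then show "?\<Lambda> (\<lambda>X. c X * \<phi> X) = 0"
      by (simp add: m[OF p] dd_mult[OF smooth_at_differentiable[OF c] smooth_at_differentiable[OF s[OF p]]]
          z[OF p] n(2)[OF p] zero_prod_def)
  next
    fix y :: "real \<times> real \<times> real"
    obtain y1 y2 y3 where y: "y = (y1, y2, y3)" by (cases y)
    define \<sigma> where "\<sigma> = y2 / (n \<bullet> n)"
    define \<tau> where "\<tau> = (y3 - \<sigma> * (m \<bullet> n)) / (2 * (n \<bullet> n) * (n \<bullet> n))"
    define l where "l X = 1 * (X \<bullet> n) + - (P \<bullet> n)" for X
    have nn: "n \<bullet> n \<noteq> 0" using n(1) by simp
    have sl: "smooth_at P l" unfolding l_def[abs_def]
      by (intro smooth_at_add smooth_at_const smooth_at_mult smooth_at_linear bounded_linear_inner_left)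
    have dl: "dd v l = (\<lambda>X. v \<bullet> n)" for v
    proof
      show "dd v l X = v \<bullet> n" for X
        by (rule dd_unique) (auto simp: l_def[abs_def] intro!: derivative_eq_intros)
    qed
    have l0: "l P = 0" by (simp add: l_def)
    have d0: "dd v (\<lambda>X. c) = (\<lambda>X. 0)" for v :: 'a and c :: real by (simp add: dd_def fun_eq_iff)
    define h where "h X = y1 + l X * (\<sigma> + \<tau> * l X)" for X
    have s2: "smooth_at P (\<lambda>X. \<sigma> + \<tau> * l X)" by (intro smooth_at_add smooth_at_const smooth_at_mult sl)
    have s3: "smooth_at P (\<lambda>X. l X * (\<sigma> + \<tau> * l X))" by (intro smooth_at_mult sl s2)
    have sh: "smooth_at P h" unfolding h_def[abs_def] by (intro smooth_at_add smooth_at_const s3)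
    have d2: "dd v (\<lambda>X. \<sigma> + \<tau> * l X) P = \<tau> * (v \<bullet> n)" for v
      using dd_add[OF smooth_at_differentiable smooth_at_differentiable, OF smooth_at_const smooth_at_mult[OF smooth_at_const sl]]
      by (simp add: d0 dd_cmult[OF smooth_at_differentiable[OF sl]] dl)
    have dh1: "dd v h P = \<sigma> * (v \<bullet> n)" for v
      unfolding h_def[abs_def]
      using dd_add[OF smooth_at_differentiable[OF smooth_at_const] smooth_at_differentiable[OF s3]]
        dd_mult[OF smooth_at_differentiable[OF sl] smooth_at_differentiable[OF s2]]
      by (simp add: d0 dl l0)
    have dh2: "dd n (dd n h) P = 2 * \<tau> * (n \<bullet> n) * (n \<bullet> n)"
      unfolding h_def[abs_def]
      using dirs_at_add[OF smooth_at_const s3, where vs="[n, n]"] dd_dd_mult_at[OF sl s2, of n n]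
      by (simp add: d0 dl l0 d2)
    have "h P = y1" by (simp add: h_def l0)
    moreover have "dd n h P = y2" using nn by (simp add: dh1 \<sigma>_def)
    moreover have "dd n (dd n h) P + dd m h P = y3"
    proof -
      have "2 * \<tau> * (n \<bullet> n) * (n \<bullet> n) = y3 - \<sigma> * (m \<bullet> n)" using nn by (simp add: \<tau>_def field_simps)
      then show ?thesis unfolding dh1 dh2 by linarith
    qed
    ultimately have "?\<Lambda> h = y" by (simp add: y)
    then show "\<exists>h. smooth_at P h \<and> ?\<Lambda> h = y" using sh by blast
  qed
  then show ?thesis by (simp add: numeral_eq_enat numeral_eq_Suc)
qed

lemma exists_orthogonal_pair_R3:
  fixes g1 g2 :: R3
  obtains a where "a \<noteq> 0" "g1 \<bullet> a = 0" "g2 \<bullet> a = 0"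
proof -
  have "dim {g1, g2} \<le> card {g1, g2}" by (rule dim_le_card') simp
  also have "\<dots> \<le> 2" by (simp add: card_insert_if)
  also have "2 < DIM(R3)" by simp
  finally obtain a where a: "a \<noteq> 0" "\<And>y. y \<in> span {g1, g2} \<Longrightarrow> orthogonal a y"
    using orthogonal_to_subspace_exists by blast
  show ?thesis using that[of a] a(1) a(2)[of g1] a(2)[of g2] by (simp add: orthogonal_def inner_commute span_base)
qed

lemma cross_eq_0_imp_multiple:
  assumes "cross g1 g2 = 0" "g1 \<noteq> 0"
  shows "\<exists>c. g2 = c *\<^sub>R g1"
proof -
  obtain a b c where g1: "g1 = (a, b, c)" by (cases g1)
  obtain a' b' c' where g2: "g2 = (a', b', c')" by (cases g2)
  have e: "b * c' = c * b'" "c * a' = a * c'" "a * b' = b * a'"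
    using assms(1) by (auto simp: g1 g2 cross_def zero_prod_def)
  consider "a \<noteq> 0" | "b \<noteq> 0" | "c \<noteq> 0" using assms(2) by (auto simp: g1 zero_prod_def)
  then show ?thesis
  proof cases
    case 1
    then show ?thesis using e by (intro exI[of _ "a' / a"]) (simp add: g1 g2 field_simps)
  next
    case 2
    then show ?thesis using e by (intro exI[of _ "b' / b"]) (simp add: g1 g2 field_simps)
  next
    case 3
    then show ?thesis using e by (intro exI[of _ "c' / c"]) (simp add: g1 g2 field_simps)
  qed
qed

lemma inner_cross: "cross g1 g2 \<bullet> g1 = 0" "cross g1 g2 \<bullet> g2 = 0"
  by (cases g1; cases g2; simp add: cross_def algebra_simps)+

lemma inner_cross_rotate: "g1 \<bullet> cross g2 n = cross g1 g2 \<bullet> n" "g2 \<bullet> cross n g1 = cross g1 g2 \<bullet> n"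
   "g1 \<bullet> cross n g1 = 0" "g2 \<bullet> cross g2 n = 0"
  by (cases g1; cases g2; cases n; simp add: cross_def algebra_simps)+

lemma vertex_multiplicity_ge_2:
  assumes s: "smooth_at 0 \<phi>1" "smooth_at 0 \<phi>2" and z: "\<phi>1 0 = 0" "\<phi>2 0 = 0"
  shows "2 \<le> local_multiplicity {\<phi>1, \<phi>2, cone_form} 0"
proof -
  obtain a where a: "a \<noteq> 0" "grad3 \<phi>1 0 \<bullet> a = 0" "grad3 \<phi>2 0 \<bullet> a = 0"
    by (rule exists_orthogonal_pair_R3)
  have "dd a \<phi>1 0 = 0" "dd a \<phi>2 0 = 0"
    using a s by (simp_all add: dd_grad3 smooth_at_differentiable)
  then show ?thesis
    by (intro multiplicity_ge_2_tangent[OF _ _ _ a(1)])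
      (use s z smooth_at_cone[of 0] dd_cone_0[of a] cone_0 in auto)
qed

lemma dd_dd_cone: "dd n (dd n cone_form) P = 2 * cone_form n"
proof -
  have e: "dd n cone_form = (\<lambda>P. 0 + P \<bullet> (- snd (snd n), 2 * fst (snd n), - fst n))"
    by (simp add: fun_eq_iff dd_cone inner_prod_def algebra_simps)
  have "bounded_linear (\<lambda>P. P \<bullet> (- snd (snd n), 2 * fst (snd n), - fst n))"
    by (rule bounded_linear_inner_left)
  then show ?thesis
    unfolding e using dd_inner[of n 1 "(- snd (snd n), 2 * fst (snd n), - fst n)" P]
    by (cases n) (simp add: cone_form_def power2_eq_square)
qed

text \<open>Let \<open>n\<close> be the cross product of the gradients. If \<open>n \<noteq> 0\<close>, the curve cut out by \<open>\<phi>1\<close> and \<open>\<phi>2\<close> has tangent \<open>n\<close>, which lies on the cone;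
the vector \<open>m\<close> is chosen so that \<open>\<phi>1\<close> and \<open>\<phi>2\<close> vanish to third order along the parabola \<open>t n + t\<^sup>2 m / 2\<close>. If \<open>n = 0\<close>, the gradients are
dependent, and there are two independent directions in which all generators vanish to second order.\<close>

lemma vertex_multiplicity_ge_3:
  assumes s: "smooth_at 0 \<phi>1" "smooth_at 0 \<phi>2" and z: "\<phi>1 0 = 0" "\<phi>2 0 = 0"
    and n: "cone_form (cross (grad3 \<phi>1 0) (grad3 \<phi>2 0)) = 0"
  shows "3 \<le> local_multiplicity {\<phi>1, \<phi>2, cone_form} 0"
proof (cases "cross (grad3 \<phi>1 0) (grad3 \<phi>2 0) = 0")
  case True
  define g where "g = (if grad3 \<phi>1 0 = 0 then grad3 \<phi>2 0 else grad3 \<phi>1 0)"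
  have g: "grad3 \<phi>1 0 \<bullet> x = 0 \<and> grad3 \<phi>2 0 \<bullet> x = 0" if "g \<bullet> x = 0" for x
    using that cross_eq_0_imp_multiple[OF True] by (auto simp: g_def split: if_splits)
  obtain a where a: "a \<noteq> 0" "g \<bullet> a = 0" "g \<bullet> a = 0" by (rule exists_orthogonal_pair_R3)
  obtain b where b: "b \<noteq> 0" "g \<bullet> b = 0" "a \<bullet> b = 0" by (rule exists_orthogonal_pair_R3)
  have "dd a \<phi>1 0 = 0" "dd a \<phi>2 0 = 0" "dd b \<phi>1 0 = 0" "dd b \<phi>2 0 = 0"
    using g[OF a(2)] g[OF b(2)] s by (simp_all add: dd_grad3 smooth_at_differentiable)
  then show ?thesis
    by (intro multiplicity_ge_3_tangent_plane[OF _ _ _ a(1) _ b(1) _ b(3)])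
      (use s z smooth_at_cone[of 0] dd_cone_0[of a] dd_cone_0[of b] cone_0 in auto)
next
  case False
  define g1 where "g1 = grad3 \<phi>1 0"
  define g2 where "g2 = grad3 \<phi>2 0"
  define n where "n = cross g1 g2"
  define N where "N = n \<bullet> n"
  have N: "N \<noteq> 0" using False by (simp add: N_def n_def g1_def g2_def)
  define m where "m = (- dd n (dd n \<phi>1) 0 / N) *\<^sub>R cross g2 n + (- dd n (dd n \<phi>2) 0 / N) *\<^sub>R cross n g1"
  have r: "g1 \<bullet> cross g2 n = N" "g2 \<bullet> cross n g1 = N" "g1 \<bullet> cross n g1 = 0" "g2 \<bullet> cross g2 n = 0"
    using inner_cross_rotate(1)[of g1 g2 n] inner_cross_rotate(2)[of g2 n g1] inner_cross_rotate(3)[of g1 n] inner_cross_rotate(4)[of g2 n] by (simp_all add: N_def n_def)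
  have "g1 \<bullet> m = - dd n (dd n \<phi>1) 0" "g2 \<bullet> m = - dd n (dd n \<phi>2) 0"
    unfolding m_def inner_add_right inner_scaleR_right r using N by simp_all
  then have m: "dd n (dd n \<phi>1) 0 + dd m \<phi>1 0 = 0" "dd n (dd n \<phi>2) 0 + dd m \<phi>2 0 = 0"
    using s by (simp_all add: dd_grad3 smooth_at_differentiable g1_def g2_def)
  have nn: "g1 \<bullet> n = 0" "g2 \<bullet> n = 0" unfolding n_def using inner_cross by (simp_all add: inner_commute)
  have c: "cone_form n = 0" using assms(5) by (simp add: n_def g1_def g2_def)
  show ?thesis
  proof (rule multiplicity_ge_3_tangent_curve[where n=n and m=m])
    show "n \<noteq> 0" using N by (auto simp: N_def)
    have "dd n \<phi>1 0 = 0" "dd n \<phi>2 0 = 0"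
      using nn s by (simp_all add: dd_grad3 smooth_at_differentiable g1_def g2_def)
    moreover have "dd n (dd n cone_form) 0 + dd m cone_form 0 = 0" by (simp add: dd_dd_cone c dd_cone_0)
    moreover fix \<phi> assume "\<phi> \<in> {\<phi>1, \<phi>2, cone_form}"
    ultimately show "smooth_at 0 \<phi>" "\<phi> 0 = 0" "dd n \<phi> 0 = 0" "dd n (dd n \<phi>) 0 + dd m \<phi> 0 = 0"
      using s z m smooth_at_cone[of 0] dd_cone_0[of n] dd_cone_0[of m] cone_0 by auto
  qed simp
qed

text \<open>The value 2 is attained by the line \<open>u = w = 0\<close>, on which the equation of the cone becomes \<open>v\<^sup>2 = 0\<close>.\<close>

lemma minimal_vertex_multiplicity_eq: "minimal_vertex_multiplicity = 2"
proof (rule antisym)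
  have c: "cone_multiplicity G 0 = local_multiplicity {fst \<circ> G, snd \<circ> G, cone_form} 0" for G
    by (simp add: cone_multiplicity_def cone_form_def)
  have sp: "smooth_at 0 (fst \<circ> G)" "smooth_at 0 (snd \<circ> G)" if "smooth_at 0 G" for G :: "R3 \<Rightarrow> real \<times> real"
    using that unfolding smooth_at_def comp_def using smooth_on_fst smooth_on_snd by blast+
  show "2 \<le> minimal_vertex_multiplicity"
    unfolding minimal_vertex_multiplicity_def c
    by (rule INF_greatest) (use vertex_multiplicity_ge_2 sp in \<open>auto simp: zero_prod_def\<close>)
  define G :: "R3 \<Rightarrow> real \<times> real" where "G = (\<lambda>X. (fst X, snd (snd X)))"
  have l: "bounded_linear G" unfolding G_def
    by (intro bounded_linear_Pair bounded_linear_fst bounded_linear_snd bounded_linear_compose[OF bounded_linear_snd bounded_linear_snd])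
  have l1: "bounded_linear (fst \<circ> G)" "bounded_linear (snd \<circ> G)"
    using bounded_linear_compose[OF bounded_linear_fst l] bounded_linear_compose[OF bounded_linear_snd l] by (simp_all add: o_def)
  have dg: "dd v (fst \<circ> G) 0 = fst v" "dd v (snd \<circ> G) 0 = snd (snd v)" for v
    using dd_unique[OF bounded_linear_imp_has_derivative[OF l1(1)]] dd_unique[OF bounded_linear_imp_has_derivative[OF l1(2)]]
    by (simp_all add: G_def)
  have "local_multiplicity {fst \<circ> G, snd \<circ> G, cone_form} 0 \<le> 2"
    by (rule multiplicity_le_2_vertex)
      (auto simp: smooth_at_linear l1 dg grad3_def cross_def cone_form_def, simp_all add: G_def)
  moreover have "smooth_at 0 G" "G 0 = 0" using smooth_at_linear[OF l] by (simp_all add: G_def zero_prod_def)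
  ultimately show "minimal_vertex_multiplicity \<le> 2"
    unfolding minimal_vertex_multiplicity_def c by (intro INF_lower2[of G]) auto
qed

section \<open>Normal forms of ordinary parabolic points\<close>

text \<open>The graph function in affine coordinates based at the point of the graph over \<open>z\<close>: \<open>L\<close> parametrizes the tangent directions, and the first order part is removed.\<close>

definition flat_graph :: "(real \<times> real \<Rightarrow> real) \<Rightarrow> real \<times> real \<Rightarrow> (real \<times> real \<Rightarrow> real \<times> real) \<Rightarrow> real \<times> real \<Rightarrow> real" where
  "flat_graph h z L p = h (z + L p) + (- h z + - dd (L p) h z)"

context
  fixes h :: "real \<times> real \<Rightarrow> real" and W z and L :: "real \<times> real \<Rightarrow> real \<times> real"
  assumes W: "open W" "smooth_on W h" "z \<in> W" and L: "bounded_linear L"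
begin

lemma open_affine_preimage: "open {p. z + L p \<in> W}"
proof -
  have "open ((\<lambda>p. z + L p) -` W)"
    by (rule open_vimage[OF W(1)]) (intro continuous_intros bounded_linear.continuous_on[OF L])
  then show ?thesis by (simp add: vimage_def)
qed

lemma flat_linear_part: "bounded_linear (\<lambda>p. - dd (L p) h z)"
proof -
  have "linear (\<lambda>v. dd v h z)" by (rule dd_linear[OF smooth_on_differentiable[OF W(2,3)]])
  then have "bounded_linear (\<lambda>v. dd v h z)" by (simp add: linear_conv_bounded_linear)
  from bounded_linear_minus[OF bounded_linear_compose[OF this L]] show ?thesis .
qed

lemma smooth_on_flat_parts:
  "smooth_on {p. z + L p \<in> W} (\<lambda>p. h (z + L p))"
  "smooth_on {p. z + L p \<in> W} (\<lambda>p. - h z + - dd (L p) h z)"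
proof -
  have "smooth_on {p. z + L p \<in> W} (\<lambda>p. z + L p)"
    by (rule smooth_on_add[OF open_affine_preimage smooth_on_const smooth_on_linear[OF L]])
  then show "smooth_on {p. z + L p \<in> W} (\<lambda>p. h (z + L p))"
    by (intro smooth_on_compose[OF open_affine_preimage W(1) _ _ W(2)]) auto
  show "smooth_on {p. z + L p \<in> W} (\<lambda>p. - h z + - dd (L p) h z)"
    by (rule smooth_on_add[OF open_affine_preimage smooth_on_const smooth_on_linear[OF flat_linear_part]])
qed

lemma smooth_on_flat_graph: "smooth_on {p. z + L p \<in> W} (flat_graph h z L)"
  unfolding flat_graph_def[abs_def]
  by (rule smooth_on_add[OF open_affine_preimage smooth_on_flat_parts])

lemma dirs_flat_graph:
  assumes "length vs \<ge> 2"
  shows "dirs vs (flat_graph h z L) 0 = dirs (map L vs) h z"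
proof -
  have L0: "L 0 = 0" using L by (simp add: linear_simps)
  have 0: "0 \<in> {p. z + L p \<in> W}" using W(3) L0 by simp
  have "dirs vs (flat_graph h z L) 0
      = dirs vs (\<lambda>p. h (z + L p)) 0 + dirs vs (\<lambda>p. - h z + - dd (L p) h z) 0"
    unfolding flat_graph_def[abs_def] by (rule dirs_add[OF open_affine_preimage smooth_on_flat_parts 0])
  also have "dirs vs (\<lambda>p. - h z + - dd (L p) h z) 0 = 0"
    by (simp only: dirs_affine_eq_0[OF flat_linear_part assms])
  also have "dirs vs (\<lambda>p. h (z + L p)) 0 = dirs (map L vs) h (z + L 0)"
    by (rule dirs_affine_compose[OF W(1,2) L]) (use W(3) L0 in simp)
  finally show ?thesis using L0 by simp
qed

lemma flat_graph_one_jet: "flat_graph h z L 0 = 0" "dd v (flat_graph h z L) 0 = 0"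
proof -
  have L0: "L 0 = 0" using L by (simp add: linear_simps)
  have d0: "dd 0 h z = 0" by (rule linear_0[OF dd_linear[OF smooth_on_differentiable[OF W(2,3)]]])
  show "flat_graph h z L 0 = 0" by (simp add: flat_graph_def L0 d0)
  have 1: "((\<lambda>p. z + L p) has_derivative L) (at 0)"
    using has_derivative_add[OF has_derivative_const bounded_linear_imp_has_derivative[OF L]] by simp
  have z': "h differentiable (at (z + L 0))" using smooth_on_differentiable[OF W(2,3)] L0 by simp
  have 2: "((\<lambda>p. h (z + L p)) has_derivative (\<lambda>v. dd (L v) h (z + L 0))) (at 0)"
    using diff_chain_at[OF 1 has_derivative_dd[OF z']] by (simp add: o_def)
  have 3: "((\<lambda>p. - h z + - dd (L p) h z) has_derivative (\<lambda>v. 0 + - dd (L v) h z)) (at 0)"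
    by (rule has_derivative_add[OF has_derivative_const bounded_linear_imp_has_derivative[OF flat_linear_part]])
  show "dd v (flat_graph h z L) 0 = 0"
    unfolding flat_graph_def[abs_def] using dd_unique[OF has_derivative_add[OF 2 3], of v] L0 by simp
qed

end

lemma two_jet_eq_dirs:
  "two_jet_eq h a b c \<longleftrightarrow> h 0 = 0 \<and> Dx h 0 = 0 \<and> Dy h 0 = 0 \<and>
     Dx (Dx h) 0 = 2 * a \<and> Dx (Dy h) 0 = b \<and> Dy (Dy h) 0 = 2 * c"
  by (auto simp: two_jet_eq_def taylor_coeff_dirs numeral_2_eq_2)

lemma dirs_diff_cmult:
  fixes f g :: "'a::euclidean_space \<Rightarrow> real"
  assumes W: "open W" "smooth_on W f" "smooth_on W g" "z \<in> W"
  shows "dirs vs (\<lambda>w. g w - c * f w) z = dirs vs g z - c * dirs vs f z"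
proof -
  have "smooth_on W (\<lambda>w. (- c) * f w)" by (intro smooth_on_mult smooth_on_const W)
  from dirs_add[OF W(1,3) this W(4), of vs]
  have "dirs vs (\<lambda>w. g w - c * f w) z = dirs vs g z + dirs vs (\<lambda>w. (- c) * f w) z" by simp
  also have "dirs vs (\<lambda>w. (- c) * f w) z = (- c) * dirs vs f z"
    by (rule dirs_cmult[OF W(1,2,4)])
  finally show ?thesis by simp
qed

text \<open>The situation at a parabolic point \<open>z\<close>: the direction \<open>e\<close> is a common root of the two Hessian forms, \<open>k\<close> is the
other root of the Hessian form of \<open>f\<close>, and \<open>h\<close> is the member of the pencil whose Hessian form degenerates along \<open>e\<close>.\<close>

locale parabolic_frame =
  fixes f g :: "real \<times> real \<Rightarrow> real" and W z e k lam and h :: "real \<times> real \<Rightarrow> real"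
  assumes W: "open W" "smooth_on W f" "smooth_on W g" "z \<in> W"
    and fee: "dd e (dd e f) z = 0" and fkk: "dd k (dd k f) z = 0" and fke: "dd k (dd e f) z \<noteq> 0"
    and gee: "dd e (dd e g) z = 0" and gkk: "dd k (dd k g) z \<noteq> 0"
    and gke: "dd k (dd e g) z = lam * dd k (dd e f) z"
    and h_eq: "h = (\<lambda>w. g w - lam * f w)"
    and quartic: "dirs [e, e, e, e] h z \<noteq> 0"
begin

lemma smooth_h: "smooth_on W h"
  unfolding h_eq by (intro smooth_on_diff smooth_on_mult smooth_on_const W)

lemma dirs_h: "dirs vs h z = dirs vs g z - lam * dirs vs f z"
  unfolding h_eq by (rule dirs_diff_cmult[OF W])

lemma frame_independent:
  assumes "a *\<^sub>R k + b *\<^sub>R e = 0"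
  shows "a = 0" "b = 0"
proof -
  have l: "linear (\<lambda>v. dd v (dd u f) z)" for u
    by (rule dd_linear[OF smooth_on_differentiable[OF smooth_on_dd[OF W(1,2)] W(4)]])
  have "dd (a *\<^sub>R k + b *\<^sub>R e) (dd u f) z = a * dd k (dd u f) z + b * dd e (dd u f) z" for u
    using linear_add[OF l] linear_cmul[OF l] by simp
  then have *: "a * dd k (dd u f) z + b * dd e (dd u f) z = 0" for u
    using linear_0[OF l] assms by simp
  show "a = 0" using *[of e] fee fke by simp
  show "b = 0" using *[of k] fkk fke dd_commute[OF W(1,2,4), of e k] by simp
qed

text \<open>In the basis \<open>k, e\<close> of the tangent plane, with \<open>h\<close> in place of \<open>g\<close>, the Hessian forms become multiples of \<open>x y\<close> and \<open>x\<^sup>2\<close>.\<close>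

lemma ordinary_parabolic_form_exists:
  assumes cubic: "dirs [e, e, e] h z \<noteq> 0 \<or> dirs [k, e, e] h z \<noteq> 0"
  shows "\<exists>f' g'. ordinary_parabolic_form f g W z f' g'"
proof -
  define L where "L p = fst p *\<^sub>R k + snd p *\<^sub>R e" for p :: "real \<times> real"
  have L: "bounded_linear L"
    unfolding L_def[abs_def] by (intro bounded_linear_add bounded_linear_scaleR_const bounded_linear_fst bounded_linear_snd)
  then have lL: "linear L" by (rule bounded_linear.linear)
  have Lkk: "L (1, 0) = k" "L (0, 1) = e" by (simp_all add: L_def)
  have "inj L"
    unfolding linear_injective_0[OF lL]
  proof (intro allI impI)
    fix p assume "L p = 0"
    then have *: "fst p *\<^sub>R k + snd p *\<^sub>R e = 0" by (simp add: L_def)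
    show "p = 0" using frame_independent[OF *] by (simp add: prod_eq_iff)
  qed
  then have bL: "bij L" using linear_injective_imp_surjective[OF lL] by (simp add: bij_def)
  define M where "M = inv L"
  have M_L: "M (L p) = p" and L_M: "L (M q) = q" for p q
    unfolding M_def by (rule inv_f_f[OF bij_is_inj[OF bL]], rule surj_f_inv_f[OF bij_is_surj[OF bL]])
  have lM: "linear M" unfolding M_def using inj_linear_imp_inv_linear[OF lL \<open>inj L\<close>] .
  define f' where "f' = flat_graph f z L"
  define g' where "g' = flat_graph h z L"
  let ?W = "{p. z + L p \<in> W}"
  define A :: "R4 \<Rightarrow> R4" where "A = (\<lambda>(a, b, w). (a - dd w f z, b - lam * a - dd w h z, M w))"
  have lf: "linear (\<lambda>v. dd v f z)" and lh: "linear (\<lambda>v. dd v h z)"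
    by (rule dd_linear[OF smooth_on_differentiable[OF W(2,4)]],
        rule dd_linear[OF smooth_on_differentiable[OF smooth_h W(4)]])
  have lA: "linear A"
  proof (rule linearI)
    fix u v :: R4 and r :: real
    obtain a b w where u: "u = (a, b, w)" by (cases u) auto
    obtain a' b' w' where v: "v = (a', b', w')" by (cases v) auto
    show "A (u + v) = A u + A v"
      by (simp add: A_def u v linear_add[OF lf] linear_add[OF lh] linear_add[OF lM] distrib_left)
    show "A (r *\<^sub>R u) = r *\<^sub>R A u"
      by (simp add: A_def u linear_cmul[OF lf] linear_cmul[OF lh] linear_cmul[OF lM] right_diff_distrib)
  qed
  have "inj A"
    unfolding linear_injective_0[OF lA]
  proof (intro allI impI)
    fix v assume "A v = 0"
    obtain a b w where v: "v = (a, b, w)" by (cases v) auto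
    have "M w = 0" using \<open>A v = 0\<close> by (simp add: v A_def zero_prod_def prod_eq_iff)
    then have "w = 0" using L_M[of w] linear_0[OF lL] by simp
    then show "v = 0" using \<open>A v = 0\<close> linear_0[OF lf] linear_0[OF lh] by (simp add: v A_def zero_prod_def)
  qed
  then have bA: "bij A" using linear_injective_imp_surjective[OF lA] by (simp add: bij_def)
  have point: "A (surface_point f g w - surface_point f g z) = surface_point f' g' (M (w - z))" for w
    by (simp add: A_def surface_point_def f'_def g'_def flat_graph_def L_M h_eq algebra_simps)
  have "(\<lambda>w. M (w - z)) ` W = ?W"
  proof (intro equalityI subsetI)
    fix p assume "p \<in> (\<lambda>w. M (w - z)) ` W"
    then show "p \<in> ?W" by (auto simp: L_M)
  next
    fix p assume "p \<in> ?W"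
    then have "z + L p \<in> W" by simp
    moreover have "p = M (z + L p - z)" by (simp add: M_L)
    ultimately show "p \<in> (\<lambda>w. M (w - z)) ` W" by (rule rev_image_eqI)
  qed
  then have dom: "?W = (\<lambda>w. M (w - z)) ` W" by simp
  have img: "(\<lambda>v. A (v - surface_point f g z)) ` (surface f g W \<inter> UNIV) = surface f' g' ?W"
    unfolding surface_def Int_UNIV_right dom by (simp only: image_image point)
  have df: "dirs vs f' 0 = dirs (map L vs) f z" if "length vs \<ge> 2" for vs
    unfolding f'_def by (rule dirs_flat_graph[OF W(1,2,4) L that])
  have dg: "dirs vs g' 0 = dirs (map L vs) h z" if "length vs \<ge> 2" for vs
    unfolding g'_def by (rule dirs_flat_graph[OF W(1) smooth_h W(4) L that])
  have jf: "two_jet_eq f' 0 (dd k (dd e f) z) 0"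
    unfolding two_jet_eq_dirs
    using flat_graph_one_jet[OF W(1,2,4) L] df[of "[(1,0), (1,0)]"] df[of "[(1,0), (0,1)]"] df[of "[(0,1), (0,1)]"]
    by (simp add: f'_def Lkk fee fkk)
  have jg: "two_jet_eq g' (dd k (dd k g) z / 2) 0 0"
    unfolding two_jet_eq_dirs
    using flat_graph_one_jet[OF W(1) smooth_h W(4) L] dg[of "[(1,0), (1,0)]"] dg[of "[(1,0), (0,1)]"] dg[of "[(0,1), (0,1)]"]
      dirs_h[of "[k, k]"] dirs_h[of "[k, e]"] dirs_h[of "[e, e]"]
    by (simp add: g'_def Lkk fee fkk gee gke)
  have "dd k (dd k g) z / 2 \<noteq> 0" using gkk by simp
  then have jets: "\<exists>f11 g20. f11 \<noteq> 0 \<and> g20 \<noteq> 0 \<and> two_jet_eq f' 0 f11 0 \<and> two_jet_eq g' g20 0 0"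
    using jf jg fke by blast
  have q: "taylor_coeff g' 0 4 \<noteq> 0"
    using quartic dg[of "replicate 4 (0,1)"] by (simp add: taylor_coeff_dirs Lkk numeral_eq_Suc)
  have c: "taylor_coeff g' 1 2 \<noteq> 0 \<or> taylor_coeff g' 0 3 \<noteq> 0"
    using cubic dg[of "[(0,1), (0,1), (0,1)]"] dg[of "[(1,0), (0,1), (0,1)]"]
    by (auto simp: taylor_coeff_dirs Lkk numeral_eq_Suc)
  have "0 \<in> ?W" using W(4) linear_0[OF lL] by simp
  then have "linear A \<and> bij A \<and> open UNIV \<and> surface_point f g z \<in> UNIV \<and> open ?W \<and> 0 \<in> ?W \<and>
      smooth_on ?W f' \<and> smooth_on ?W g' \<and>
      (\<lambda>v. A (v - surface_point f g z)) ` (surface f g W \<inter> UNIV) = surface f' g' ?W"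
    using lA bA img open_affine_preimage[OF W(1,2,4) L] smooth_on_flat_graph[OF W(1,2,4) L]
      smooth_on_flat_graph[OF W(1) smooth_h W(4) L] unfolding f'_def g'_def by simp
  then have "ordinary_parabolic_form f g W z f' g'"
    unfolding ordinary_parabolic_form_def using jets q c by blast
  then show ?thesis by blast
qed

end

section \<open>Independence of the sign from the normal form\<close>

lemma chain_pair:
  fixes q :: "real \<times> real \<Rightarrow> real" and x y :: "'a::euclidean_space \<Rightarrow> real"
  assumes "x differentiable (at w)" "y differentiable (at w)" "q differentiable (at (x w, y w))"
  shows "dd v (\<lambda>w. q (x w, y w)) w = dd v x w * Dx q (x w, y w) + dd v y w * Dy q (x w, y w)"
proof -
  have 1: "((\<lambda>w. (x w, y w)) has_derivative (\<lambda>v. (dd v x w, dd v y w))) (at w)"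
    by (rule has_derivative_Pair[OF has_derivative_dd[OF assms(1)] has_derivative_dd[OF assms(2)]])
  have "((\<lambda>w. q (x w, y w)) has_derivative (\<lambda>v. dd (dd v x w, dd v y w) q (x w, y w))) (at w)"
    using diff_chain_at[OF 1 has_derivative_dd[OF assms(3)]] by (simp add: o_def)
  from dd_unique[OF this] have "dd v (\<lambda>w. q (x w, y w)) w = dd (dd v x w *\<^sub>R (1, 0) + dd v y w *\<^sub>R (0, 1)) q (x w, y w)"
    by simp
  then show ?thesis
    by (simp only: dd_add_dir[OF assms(3)] dd_scale_dir[OF assms(3)] real_scaleR_def)
qed

text \<open>The curve has \<open>x = O(t\<^sup>3)\<close> and \<open>y = c t + o(t\<^sup>2)\<close>, and the 2-jet of \<open>q\<close> is a multiple of \<open>x\<^sup>2\<close>. Leaving the axis \<open>x = 0\<close> changes \<open>q\<close>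
by \<open>x\<close> times a value of \<open>\<partial>q/\<partial>x\<close>, which is \<open>o(t)\<close>; so the coefficient of \<open>t\<^sup>4\<close> only sees the coefficient of \<open>y\<^sup>4\<close>. The cubic
term does not interfere, since \<open>y\<^sup>3 - c\<^sup>3 t\<^sup>3 = o(t\<^sup>4)\<close>.\<close>

lemma quartic_along_curve:
  fixes q :: "real \<times> real \<Rightarrow> real" and x y :: "real \<Rightarrow> real"
  assumes q: "open W" "0 \<in> W" "smooth_on W q"
    and jet: "q 0 = 0" "Dx q 0 = 0" "Dy q 0 = 0" "Dy (Dx q) 0 = 0" "Dy (Dy q) 0 = 0"
    and x: "((\<lambda>t. x t / t ^ 3) \<longlongrightarrow> a) (at 0)"
    and y: "((\<lambda>t. (y t - c * t) / t ^ 2) \<longlongrightarrow> 0) (at 0)" and c: "c \<noteq> 0"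
    and G: "((\<lambda>t. (G t - l3 * t ^ 3) / t ^ 4) \<longlongrightarrow> l4) (at 0)"
    and eq: "\<forall>\<^sub>F t in at 0. G t = q (x t, y t)"
  shows "l4 = taylor_coeff q 0 4 * c ^ 4"
proof -
  let ?c3 = "taylor_coeff q 0 3" and ?c4 = "taylor_coeff q 0 4"
  have t0: "((\<lambda>t::real. t) \<longlongrightarrow> 0) (at 0)" by (rule tendsto_ident_at)
  have ne: "\<forall>\<^sub>F t::real in at 0. t \<noteq> 0" by (simp add: eventually_at_filter)
  have xt: "((\<lambda>t. x t / t) \<longlongrightarrow> 0) (at 0)"
  proof -
    have "((\<lambda>t. (x t / t ^ 3) * (t * t)) \<longlongrightarrow> a * (0 * 0)) (at 0)" by (intro tendsto_mult x t0)
    then have "((\<lambda>t. (x t / t ^ 3) * (t * t)) \<longlongrightarrow> 0) (at 0)" by simp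
    then show ?thesis
      by (rule Lim_transform_eventually) (use ne in eventually_elim, simp add: field_simps power3_eq_cube)
  qed
  have yt: "((\<lambda>t. y t / t) \<longlongrightarrow> c) (at 0)"
  proof -
    have "((\<lambda>t. ((y t - c * t) / t ^ 2) * t + c) \<longlongrightarrow> 0 * 0 + c) (at 0)" by (intro tendsto_mult tendsto_add y t0 tendsto_const)
    then have "((\<lambda>t. ((y t - c * t) / t ^ 2) * t + c) \<longlongrightarrow> c) (at 0)" by simp
    then show ?thesis
      by (rule Lim_transform_eventually) (use ne in eventually_elim, simp add: field_simps power2_eq_square)
  qed
  have x0: "(x \<longlongrightarrow> 0) (at 0)"
  proof -
    have "((\<lambda>t. (x t / t) * t) \<longlongrightarrow> 0 * 0) (at 0)" by (intro tendsto_mult xt t0)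
    then have "((\<lambda>t. (x t / t) * t) \<longlongrightarrow> 0) (at 0)" by simp
    then show ?thesis by (rule Lim_transform_eventually) (use ne in eventually_elim, simp)
  qed
  have y0: "(y \<longlongrightarrow> 0) (at 0)"
  proof -
    have "((\<lambda>t. (y t / t) * t) \<longlongrightarrow> c * 0) (at 0)" by (intro tendsto_mult yt t0)
    then have "((\<lambda>t. (y t / t) * t) \<longlongrightarrow> 0) (at 0)" by simp
    then show ?thesis by (rule Lim_transform_eventually) (use ne in eventually_elim, simp)
  qed
  have yne: "\<forall>\<^sub>F t in at 0. y t \<noteq> 0"
    using tendsto_imp_eventually_ne[OF yt c] by eventually_elim auto
  obtain r where r: "r > 0" "ball 0 r \<subseteq> W" using q(1,2) by (rule openE)
  \<comment> \<open>Moving from \<open>(0, y)\<close> to \<open>(x, y)\<close> costs \<open>x K(\<tau> x, y)\<close>. As \<open>x / t\<^sup>3\<close> is bounded, it suffices that \<open>K / t\<close> tends to 0; this holds since \<open>K\<close> and its derivative along the axis vanish at the origin.\<close>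
  define K where "K = Dx q"
  have sK: "smooth_at 0 K" using smooth_on_dd[OF q(1,3)] q(1,2) unfolding K_def by (intro smooth_atI)
  obtain k where k: "\<forall>b. smooth_at 0 (k b) \<and> k b 0 = dd b K 0"
    "\<forall>\<^sub>F X in nhds 0. K X = K 0 + (\<Sum>b\<in>Basis. ((X - 0) \<bullet> b) * k b X)" using hadamard_at[OF sK] .
  have B: "(Basis :: (real \<times> real) set) = {(1, 0), (0, 1)}" by (auto simp: Basis_prod_def)
  have k2: "\<forall>\<^sub>F X in nhds 0. K X = fst X * k (1, 0) X + snd X * k (0, 1) X"
    using k(2) by eventually_elim (use jet in \<open>simp add: K_def B inner_prod_def\<close>)
  have "\<forall>\<^sub>F t in at 0. \<bar>x t\<bar> < r / 2" using tendstoD[OF x0, of "r / 2"] r(1) by (simp add: dist_real_def)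
  moreover have "\<forall>\<^sub>F t in at 0. \<bar>y t\<bar> < r / 2" using tendstoD[OF y0, of "r / 2"] r(1) by (simp add: dist_real_def)
  ultimately have "\<forall>\<^sub>F t in at 0. \<exists>\<tau>. 0 < \<tau> \<and> \<tau> < 1 \<and> q (x t, y t) - q (0, y t) = x t * K (\<tau> * x t, y t)"
  proof eventually_elim
    case (elim t)
    have seg: "\<forall>s\<in>{0..1}. (0, y t) + s *\<^sub>R (x t, 0) \<in> W"
    proof
      fix s :: real assume s: "s \<in> {0..1}"
      have "norm ((0, y t) + s *\<^sub>R (x t, 0)) \<le> \<bar>s * x t\<bar> + \<bar>y t\<bar>"
        using norm_Pair_le[of "s * x t" "y t"] by simp
      also have "\<bar>s * x t\<bar> \<le> \<bar>x t\<bar>" using s by (simp add: abs_mult mult_left_le_one_le)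
      finally have "norm ((0, y t) + s *\<^sub>R (x t, 0)) < r" using elim by linarith
      then show "(0, y t) + s *\<^sub>R (x t, 0) \<in> W" using r(2) by (auto simp: subset_iff dist_norm)
    qed
    from taylor_dirs[OF q(1,3) zero_less_one seg]
    obtain \<tau> where \<tau>: "0 < \<tau>" "\<tau> < 1" and e: "q ((0, y t) + (x t, 0)) =
        (\<Sum>m<1. dirs (replicate m (x t, 0)) q (0, y t) / fact m) + dirs (replicate 1 (x t, 0)) q ((0, y t) + \<tau> *\<^sub>R (x t, 0)) / fact 1"
      by (elim exE conjE)
    have "(0, y t) + \<tau> *\<^sub>R (x t, 0) \<in> W" using seg \<tau> by auto
    then have d: "q differentiable (at (\<tau> * x t, y t))" using smooth_on_differentiable[OF q(3)] by simp
    have "dd (x t, 0) q (\<tau> * x t, y t) = x t * K (\<tau> * x t, y t)"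
      using dd_scale_dir[OF d, of "x t" "(1, 0)"] by (simp add: K_def)
    then show ?case using e \<tau> by (intro exI[of _ \<tau>]) simp
  qed
  then obtain \<tau> where \<tau>: "\<forall>\<^sub>F t in at 0. 0 < \<tau> t \<and> \<tau> t < 1 \<and> q (x t, y t) - q (0, y t) = x t * K (\<tau> t * x t, y t)"
    unfolding eventually_ex by blast
  have \<tau>x: "((\<lambda>t. \<tau> t * x t) \<longlongrightarrow> 0) (at 0)"
  proof (rule Lim_null_comparison[OF _ tendsto_rabs_zero[OF x0]])
    show "\<forall>\<^sub>F t in at 0. norm (\<tau> t * x t) \<le> \<bar>x t\<bar>"
      using \<tau> by eventually_elim (simp add: abs_mult mult_left_le_one_le)
  qed
  have \<tau>xt: "((\<lambda>t. \<tau> t * x t / t) \<longlongrightarrow> 0) (at 0)"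
  proof (rule Lim_null_comparison[OF _ tendsto_rabs_zero[OF xt]])
    show "\<forall>\<^sub>F t in at 0. norm (\<tau> t * x t / t) \<le> \<bar>x t / t\<bar>"
      using \<tau> by eventually_elim (simp add: abs_mult mult_left_le_one_le divide_right_mono)
  qed
  have p0: "((\<lambda>t. (\<tau> t * x t, y t)) \<longlongrightarrow> 0) (at 0)"
    using tendsto_Pair[OF \<tau>x y0] by (simp add: zero_prod_def)
  have kl: "((\<lambda>t. k b (\<tau> t * x t, y t)) \<longlongrightarrow> dd b K 0) (at 0)" for b
    using isCont_tendsto_compose[OF smooth_at_isCont p0, of "k b"] k(1) by simp
  have part1: "((\<lambda>t. (q (x t, y t) - q (0, y t)) / t ^ 4) \<longlongrightarrow> 0) (at 0)"
  proof -
    have "((\<lambda>t. (x t / t ^ 3) * ((\<tau> t * x t / t) * k (1, 0) (\<tau> t * x t, y t) + (y t / t) * k (0, 1) (\<tau> t * x t, y t)))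
        \<longlongrightarrow> a * (0 * Dx K 0 + c * Dy K 0)) (at 0)"
      by (intro tendsto_mult tendsto_add x \<tau>xt yt kl)
    then have "((\<lambda>t. (x t / t ^ 3) * ((\<tau> t * x t / t) * k (1, 0) (\<tau> t * x t, y t) + (y t / t) * k (0, 1) (\<tau> t * x t, y t)))
        \<longlongrightarrow> 0) (at 0)" using jet by (simp add: K_def)
    then show ?thesis
    proof (rule Lim_transform_eventually)
      have "\<forall>\<^sub>F t in at 0. K (\<tau> t * x t, y t) = (\<tau> t * x t) * k (1, 0) (\<tau> t * x t, y t) + y t * k (0, 1) (\<tau> t * x t, y t)"
        using eventually_compose_filterlim[OF k2 p0] by simp
      with \<tau> ne show "\<forall>\<^sub>F t in at 0. (x t / t ^ 3) * ((\<tau> t * x t / t) * k (1, 0) (\<tau> t * x t, y t) + (y t / t) * k (0, 1) (\<tau> t * x t, y t))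
         = (q (x t, y t) - q (0, y t)) / t ^ 4"
        by eventually_elim (simp add: field_simps power3_eq_cube power4_eq_xxxx)
    qed
  qed
  \<comment> \<open>On the axis only the cubic and the quartic coefficient of \<open>q\<close> contribute up to order four.\<close>
  have tay: "((\<lambda>s. (q (0, s) - ?c3 * s ^ 3) / s ^ 4) \<longlongrightarrow> ?c4) (at 0)"
  proof -
    have "((\<lambda>s. (q (0 + s *\<^sub>R (0, 1)) - (\<Sum>m<4. s ^ m * dirs (replicate m (0, 1)) q 0 / fact m)) / s ^ 4)
       \<longlongrightarrow> dirs (replicate 4 (0, 1)) q 0 / fact 4) (at 0)"
      by (rule taylor_dirs_peano[OF q(1,3,2)]) simp
    moreover have "(\<Sum>m<4. s ^ m * dirs (replicate m (0, 1)) q 0 / fact m) = ?c3 * s ^ 3" for s :: real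
      using jet by (simp add: taylor_coeff_dirs numeral_eq_Suc)
    ultimately show ?thesis by (simp add: taylor_coeff_dirs)
  qed
  have part2: "((\<lambda>t. (q (0, y t) - ?c3 * y t ^ 3) / t ^ 4) \<longlongrightarrow> ?c4 * c ^ 4) (at 0)"
  proof -
    have "filterlim y (at 0) (at 0)" using y0 yne by (simp add: filterlim_at)
    from tendsto_mult[OF filterlim_compose[OF tay this] tendsto_power[OF yt, of 4]]
    have "((\<lambda>t. (q (0, y t) - ?c3 * y t ^ 3) / y t ^ 4 * (y t / t) ^ 4) \<longlongrightarrow> ?c4 * c ^ 4) (at 0)" .
    then show ?thesis
      by (rule Lim_transform_eventually) (use ne yne in eventually_elim, simp add: power_divide)
  qed
  have part3: "((\<lambda>t. ?c3 * ((y t) ^ 3 - c ^ 3 * t ^ 3) / t ^ 4) \<longlongrightarrow> 0) (at 0)"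
  proof -
    have "((\<lambda>t. ?c3 * (((y t - c * t) / t ^ 2) * ((y t / t) ^ 2 + c * (y t / t) + c ^ 2))) \<longlongrightarrow> ?c3 * (0 * (c ^ 2 + c * c + c ^ 2))) (at 0)"
      by (intro tendsto_mult tendsto_add tendsto_power tendsto_const y yt)
    then have "((\<lambda>t. ?c3 * (((y t - c * t) / t ^ 2) * ((y t / t) ^ 2 + c * (y t / t) + c ^ 2))) \<longlongrightarrow> 0) (at 0)" by simp
    then show ?thesis
    proof (rule Lim_transform_eventually)
      show "\<forall>\<^sub>F t in at 0. ?c3 * (((y t - c * t) / t ^ 2) * ((y t / t) ^ 2 + c * (y t / t) + c ^ 2))
          = ?c3 * ((y t) ^ 3 - c ^ 3 * t ^ 3) / t ^ 4"
        using ne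
      proof eventually_elim
        case (elim t)
        have "(y t / t) ^ 2 + c * (y t / t) + c ^ 2 = (y t ^ 2 + c * y t * t + c ^ 2 * t ^ 2) / t ^ 2"
          using elim by (simp add: field_simps power2_eq_square)
        then have "((y t - c * t) / t ^ 2) * ((y t / t) ^ 2 + c * (y t / t) + c ^ 2)
            = ((y t - c * t) * (y t ^ 2 + c * y t * t + c ^ 2 * t ^ 2)) / (t ^ 2 * t ^ 2)" by simp
        also have "(y t - c * t) * (y t ^ 2 + c * y t * t + c ^ 2 * t ^ 2) = y t ^ 3 - c ^ 3 * t ^ 3" by algebra
        also have "t ^ 2 * t ^ 2 = t ^ 4" by (simp flip: power_add)
        finally show ?case by simp
      qed
    qed
  qed
  define d where "d = ?c3 * c ^ 3 - l3"
  have "((\<lambda>t. (G t - l3 * t ^ 3) / t ^ 4 - ((q (x t, y t) - q (0, y t)) / t ^ 4 + (q (0, y t) - ?c3 * y t ^ 3) / t ^ 4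
      + ?c3 * ((y t) ^ 3 - c ^ 3 * t ^ 3) / t ^ 4)) \<longlongrightarrow> l4 - (0 + ?c4 * c ^ 4 + 0)) (at 0)"
    by (intro tendsto_diff tendsto_add G part1 part2 part3)
  then have lim: "((\<lambda>t. d / t) \<longlongrightarrow> l4 - ?c4 * c ^ 4) (at 0)"
    unfolding add_0_left add_0_right
  proof (rule Lim_transform_eventually)
    show "\<forall>\<^sub>F t in at 0. (G t - l3 * t ^ 3) / t ^ 4 - ((q (x t, y t) - q (0, y t)) / t ^ 4 + (q (0, y t) - ?c3 * y t ^ 3) / t ^ 4
      + ?c3 * ((y t) ^ 3 - c ^ 3 * t ^ 3) / t ^ 4) = d / t"
      using ne eq
    proof eventually_elim
      case (elim t)
      have "d / t = d * t ^ 3 / t ^ 4" using elim(1) by (simp add: power3_eq_cube power4_eq_xxxx)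
      then show ?case unfolding elim(2) d_def
        by (simp add: add_divide_distrib[symmetric] diff_divide_distrib[symmetric] algebra_simps)
    qed
  qed
  have "((\<lambda>t. t * (d / t)) \<longlongrightarrow> 0 * (l4 - ?c4 * c ^ 4)) (at 0)" by (intro tendsto_mult t0 lim)
  then have "((\<lambda>t::real. d) \<longlongrightarrow> 0) (at 0)"
    unfolding mult_zero_left by (rule Lim_transform_eventually) (use ne in eventually_elim, simp)
  then have "d = 0" by (simp add: tendsto_const_iff)
  then have "((\<lambda>t::real. 0) \<longlongrightarrow> l4 - ?c4 * c ^ 4) (at 0)" using lim by simp
  then have "0 = l4 - ?c4 * c ^ 4" by (simp only: tendsto_const_iff[OF trivial_limit_at])
  then show ?thesis by simp
qed

context parabolic_frame
begin

text \<open>Let \<open>x\<close> and \<open>y\<close> be the coordinates of an arbitrary normal form, as functions on the original parameter plane, and \<open>G\<close> the second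
graph coordinate. All four coordinates are combinations of \<open>f\<close>, \<open>g\<close> and an affine function. The second derivative of \<open>G\<close> is
\<open>2 g\<^sub>2\<^sub>0 dx\<^sup>2\<close>; evaluating it on \<open>e\<close> and \<open>k\<close> shows \<open>dx(e) = 0\<close> and that \<open>G\<close> is \<open>b h\<close> plus an affine function, with \<open>b h''(k,k) = 2 g\<^sub>2\<^sub>0 dx(k)\<^sup>2\<close>.
Both Hessian forms vanish on \<open>(e,e)\<close>, so along the line \<open>z + t e\<close> one has \<open>x = O(t\<^sup>3)\<close> and \<open>y = dy(e) t + O(t\<^sup>3)\<close>, and comparing the
coefficients of \<open>t\<^sup>4\<close> gives \<open>b D\<^sub>e\<^sup>4 h = 24 g\<^sub>0\<^sub>4 dy(e)\<^sup>4\<close>. The product of the two equations relates the signs.\<close>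

lemma normal_form_sign:
  assumes "ordinary_parabolic_form f g W z f' g'"
  shows "sgn (taylor_coeff g' 2 0 * taylor_coeff g' 0 4) = sgn (dd k (dd k g) z * dirs [e, e, e, e] h z)"
proof -
  have ex: "\<exists>(A :: R4 \<Rightarrow> R4) N W'.
        linear A \<and> bij A \<and> open N \<and> surface_point f g z \<in> N \<and>
        open W' \<and> 0 \<in> W' \<and> smooth_on W' f' \<and> smooth_on W' g' \<and>
        (\<lambda>v. A (v - surface_point f g z)) ` (surface f g W \<inter> N) = surface f' g' W'"
    and jets: "\<exists>f11 g20. f11 \<noteq> 0 \<and> g20 \<noteq> 0 \<and> two_jet_eq f' 0 f11 0 \<and> two_jet_eq g' g20 0 0"
    using assms unfolding ordinary_parabolic_form_def by simp_all
  from ex obtain A :: "R4 \<Rightarrow> R4" and N W' where parts: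
        "linear A \<and> bij A \<and> open N \<and> surface_point f g z \<in> N \<and>
        open W' \<and> 0 \<in> W' \<and> smooth_on W' f' \<and> smooth_on W' g' \<and>
        (\<lambda>v. A (v - surface_point f g z)) ` (surface f g W \<inter> N) = surface f' g' W'"
    by (elim exE)
  have A: "linear A" "bij A" and N: "open N" "surface_point f g z \<in> N"
    and W': "open W'" "0 \<in> W'" "smooth_on W' f'" "smooth_on W' g'"
    and img: "(\<lambda>v. A (v - surface_point f g z)) ` (surface f g W \<inter> N) = surface f' g' W'"
    using parts by simp_all
  obtain f11 g20 where jet: "g20 \<noteq> 0" "two_jet_eq f' 0 f11 0" "two_jet_eq g' g20 0 0"
    using jets by (elim exE conjE)
  note jf = jet(2)[unfolded two_jet_eq_dirs] and jg = jet(3)[unfolded two_jet_eq_dirs]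
  define S where "S w = surface_point f g w - surface_point f g z" for w
  define U where "U = W \<inter> surface_point f g -` N"
  have cs: "continuous_on W (surface_point f g)"
    unfolding surface_point_def
    by (intro continuous_on_Pair continuous_on_id smooth_on_continuous[OF W(2)] smooth_on_continuous[OF W(3)])
  have U: "open U" "z \<in> U" "U \<subseteq> W"
    using continuous_open_preimage[OF cs W(1) N(1)] W(4) N(2) by (auto simp: U_def)
  \<comment> \<open>A linear functional \<open>T\<close> of the ambient space restricts to a combination of \<open>f\<close>, \<open>g\<close> and an affine function; derivatives of order at least two only see \<open>f\<close> and \<open>g\<close>.\<close>
  define co where "co T w = (T (S w) :: real)" for T :: "R4 \<Rightarrow> real" and w
  define \<alpha> where "\<alpha> T = T ((1, 0, 0, 0) :: R4)" for T :: "R4 \<Rightarrow> real"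
  define \<beta> where "\<beta> T = T ((0, 1, 0, 0) :: R4)" for T :: "R4 \<Rightarrow> real"
  have co_eq: "co T = (\<lambda>w. (\<alpha> T * f w + \<beta> T * g w) + (- T (surface_point f g z) + T (0, 0, w)))"
    and co_lin: "bounded_linear (\<lambda>w. T (0, 0, w))" if T: "linear T" for T
  proof -
    have bT: "bounded_linear T" using T by (simp add: linear_conv_bounded_linear)
    have "bounded_linear (\<lambda>w :: real \<times> real. (0 :: real, 0 :: real, w))"
      by (intro bounded_linear_Pair bounded_linear_zero bounded_linear_ident)
    from bounded_linear_compose[OF bT this]
    show "bounded_linear (\<lambda>w. T (0, 0, w))" .
    show "co T = (\<lambda>w. (\<alpha> T * f w + \<beta> T * g w) + (- T (surface_point f g z) + T (0, 0, w)))"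
    proof
      fix w
      have "S w = f w *\<^sub>R (1, 0, 0, 0) + g w *\<^sub>R (0, 1, 0, 0) + (0, 0, w) - surface_point f g z"
        by (simp add: S_def surface_point_def zero_prod_def)
      then show "co T w = (\<alpha> T * f w + \<beta> T * g w) + (- T (surface_point f g z) + T (0, 0, w))"
        unfolding co_def \<alpha>_def \<beta>_def
        by (simp only: linear_diff[OF T] linear_add[OF T] linear_cmul[OF T] real_scaleR_def) simp
    qed
  qed
  have s1: "smooth_on W (\<lambda>w. a * f w + b * g w)" for a b
    by (intro smooth_on_add smooth_on_mult smooth_on_const W)
  have s2: "smooth_on W (\<lambda>w. - T (surface_point f g z) + T (0, 0, w))" if T: "linear T" for T :: "R4 \<Rightarrow> real"
    by (intro smooth_on_add smooth_on_const W smooth_on_linear co_lin[OF T])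
  have co_smooth: "smooth_on W (co T)" if T: "linear T" for T
    unfolding co_eq[OF T] by (rule smooth_on_add[OF W(1) s1 s2[OF T]])
  have co_dirs: "dirs vs (co T) z = \<alpha> T * dirs vs f z + \<beta> T * dirs vs g z"
    if T: "linear T" and l: "length vs \<ge> 2" for T vs
  proof -
    have "dirs vs (co T) z = dirs vs (\<lambda>w. \<alpha> T * f w + \<beta> T * g w) z
        + dirs vs (\<lambda>w. - T (surface_point f g z) + T (0, 0, w)) z"
      unfolding co_eq[OF T] by (rule dirs_add[OF W(1) s1 s2[OF T] W(4)])
    also have "dirs vs (\<lambda>w. - T (surface_point f g z) + T (0, 0, w)) z = 0"
      by (simp only: dirs_affine_eq_0[OF co_lin[OF T] l])
    also have "dirs vs (\<lambda>w. \<alpha> T * f w + \<beta> T * g w) z = dirs vs (\<lambda>w. \<alpha> T * f w) z + dirs vs (\<lambda>w. \<beta> T * g w) z"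
      by (intro dirs_add[OF W(1) _ _ W(4)] smooth_on_mult smooth_on_const W)
    finally show ?thesis using dirs_cmult[OF W(1,2,4)] dirs_cmult[OF W(1,3,4)] by simp
  qed
  have co_dd: "dd v (co T) z = T (dd v f z, dd v g z, v)" if T: "linear T" for T v
  proof -
    have bT: "bounded_linear T" using T by (simp add: linear_conv_bounded_linear)
    have "(S has_derivative (\<lambda>v. (dd v f z, dd v g z, v))) (at z)"
      unfolding S_def[abs_def] surface_point_def
      by (auto intro!: derivative_eq_intros has_derivative_Pair smooth_on_has_derivative[OF W(2,4)] smooth_on_has_derivative[OF W(3,4)])
    from dd_unique[OF bounded_linear.has_derivative[OF bT this]] show ?thesis by (simp add: co_def[abs_def])
  qed
  have S0: "S z = 0" by (simp add: S_def)
  define T1 where "T1 v = fst (A v)" for v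
  define T2 where "T2 v = fst (snd (A v))" for v
  define TX where "TX v = fst (snd (snd (A v)))" for v
  define TY where "TY v = snd (snd (snd (A v)))" for v
  have lT: "linear T1" "linear T2" "linear TX" "linear TY"
    by (rule linearI; simp only: T1_def T2_def TX_def TY_def linear_add[OF A(1)] linear_cmul[OF A(1)]
        fst_add snd_add fst_scaleR snd_scaleR)+
  define F where "F = co T1"
  define G where "G = co T2"
  define x where "x = co TX"
  define y where "y = co TY"
  have zero: "F z = 0" "G z = 0" "x z = 0" "y z = 0"
    using linear_0[OF lT(1)] linear_0[OF lT(2)] linear_0[OF lT(3)] linear_0[OF lT(4)]
    by (simp_all add: F_def G_def x_def y_def co_def S0)
  have sm: "smooth_on W F" "smooth_on W G" "smooth_on W x" "smooth_on W y"
    using co_smooth lT by (auto simp: F_def G_def x_def y_def)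
  have dif: "F differentiable (at w)" "G differentiable (at w)" "x differentiable (at w)" "y differentiable (at w)"
    if "w \<in> W" for w
    by (rule smooth_on_differentiable[OF _ that], rule sm)+
  have graph: "(x w, y w) \<in> W' \<and> F w = f' (x w, y w) \<and> G w = g' (x w, y w)" if "w \<in> U" for w
  proof -
    have "surface_point f g w \<in> surface f g W \<inter> N" using that by (auto simp: U_def surface_def)
    then have "A (S w) \<in> surface f' g' W'" unfolding img[symmetric] S_def by (rule imageI)
    then obtain p where "p \<in> W'" "A (S w) = (f' p, g' p, p)" by (auto simp: surface_def surface_point_def)
    then show ?thesis by (simp add: F_def G_def x_def y_def co_def T1_def T2_def TX_def TY_def)
  qed
  have p0: "(x z, y z) = 0" by (simp add: zero zero_prod_def)
  have dW': "q differentiable (at (x w, y w))" if "smooth_on W' q" "w \<in> U" for q :: "real \<times> real \<Rightarrow> real" and w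
    using smooth_on_differentiable[OF that(1)] graph[OF that(2)] by blast
  have chain: "dd v (\<lambda>w. q (x w, y w)) w = dd v x w * Dx q (x w, y w) + dd v y w * Dy q (x w, y w)"
    if "smooth_on W' q" "w \<in> U" for q v w
    by (rule chain_pair[OF dif(3,4) dW'[OF that]]) (use that(2) U(3) in auto)
  \<comment> \<open>The affine map is injective on the tangent plane, and the graph coordinates \<open>F\<close> and \<open>G\<close> have no first order part; so \<open>x\<close> and \<open>y\<close> have independent differentials at \<open>z\<close>.\<close>
  have dF: "dd v F z = 0" for v
    using dd_cong_open[OF U(1,2), of F "\<lambda>w. f' (x w, y w)" v] graph chain[OF W'(3) U(2)] jf p0 by simp
  have dG_U: "dd v G w = dd v x w * Dx g' (x w, y w) + dd v y w * Dy g' (x w, y w)" if "w \<in> U" for v w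
    using dd_cong_open[OF U(1) that, of G "\<lambda>w. g' (x w, y w)" v] graph chain[OF W'(4) that] by simp
  have dG: "dd v G z = 0" for v using dG_U[OF U(2)] jg p0 by simp
  have inj: "v = 0" if "dd v x z = 0" "dd v y z = 0" for v
  proof -
    have "A (dd v f z, dd v g z, v) = 0"
      using dF[of v] dG[of v] that co_dd[OF lT(1)] co_dd[OF lT(2)] co_dd[OF lT(3)] co_dd[OF lT(4)]
      by (simp add: F_def G_def x_def y_def T1_def T2_def TX_def TY_def prod_eq_iff)
    moreover have "inj A" using A(2) by (rule bij_is_inj)
    ultimately have "(dd v f z, dd v g z, v) = 0" using A(1) linear_injective_0 by blast
    then show ?thesis by (simp add: zero_prod_def)
  qed
  \<comment> \<open>As the 2-jet of \<open>g'\<close> is \<open>g20 x\<^sup>2\<close>, the second derivative of \<open>G\<close> is the square of \<open>dx\<close>, up to the factor \<open>2 g20\<close>.\<close>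
  have ddG: "dd u (dd v G) z = 2 * g20 * dd u x z * dd v x z" for u v
  proof -
    let ?q1 = "Dx g'" and ?q2 = "Dy g'"
    have sq: "smooth_on W' ?q1" "smooth_on W' ?q2" by (rule smooth_on_dd[OF W'(1,4)])+
    have d: "dd v x differentiable (at z)" "dd v y differentiable (at z)"
      by (rule smooth_on_differentiable[OF smooth_on_dd[OF W(1) sm(3)] W(4)],
          rule smooth_on_differentiable[OF smooth_on_dd[OF W(1) sm(4)] W(4)])
    have dq: "(\<lambda>w. q (x w, y w)) differentiable (at z)" if "smooth_on W' q" for q :: "real \<times> real \<Rightarrow> real"
      using differentiable_chain_at[of "\<lambda>w. (x w, y w)" z q] dif(3,4)[OF W(4)] dW'[OF that U(2)]
      by (auto simp: o_def intro: differentiable_Pair)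
    have "dd u (dd v G) z = dd u (\<lambda>w. dd v x w * ?q1 (x w, y w) + dd v y w * ?q2 (x w, y w)) z"
      by (rule dd_cong_open[OF U(1,2) dG_U])
    also have "\<dots> = dd u (\<lambda>w. dd v x w * ?q1 (x w, y w)) z + dd u (\<lambda>w. dd v y w * ?q2 (x w, y w)) z"
      by (rule dd_add) (intro differentiable_mult d dq sq)+
    also have "dd u (\<lambda>w. dd v x w * ?q1 (x w, y w)) z = dd v x z * (2 * g20 * dd u x z)"
      using dd_mult[OF d(1) dq[OF sq(1)], of u] chain[OF sq(1) U(2), of u] jg p0
        dd_commute[OF W'(1,4,2), of "(0,1)" "(1,0)"] by simp
    also have "dd u (\<lambda>w. dd v y w * ?q2 (x w, y w)) z = 0"
      using dd_mult[OF d(2) dq[OF sq(2)], of u] chain[OF sq(2) U(2), of u] jg p0 by simp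
    finally show ?thesis by simp
  qed
  have lx: "linear (\<lambda>v. dd v x z)" and ly: "linear (\<lambda>v. dd v y z)"
    by (rule dd_linear[OF dif(3)[OF W(4)]], rule dd_linear[OF dif(4)[OF W(4)]])
  define a where "a = \<alpha> T2"
  define b where "b = \<beta> T2"
  have Gab: "dirs vs G z = a * dirs vs f z + b * dirs vs g z" if "length vs \<ge> 2" for vs
    using co_dirs[OF lT(2) that] by (simp add: G_def a_def b_def)
  have xe: "dd e x z = 0" using Gab[of "[e, e]"] ddG[of e e] fee gee jet(1) by simp
  have ye: "dd e y z \<noteq> 0"
  proof
    assume "dd e y z = 0"
    then have "e = 0" using inj xe by blast
    then show False using frame_independent[of 0 1] by simp
  qed
  have xk: "dd k x z \<noteq> 0"
  proof
    assume 0: "dd k x z = 0"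
    have "dd e y z *\<^sub>R k + (- dd k y z) *\<^sub>R e = 0"
      by (rule inj) (simp_all only: linear_add[OF lx] linear_cmul[OF lx] linear_add[OF ly] linear_cmul[OF ly] 0 xe, simp_all)
    then show False using frame_independent(1) ye by blast
  qed
  have kk: "b * dd k (dd k g) z = 2 * g20 * (dd k x z)\<^sup>2"
    using Gab[of "[k, k]"] ddG[of k k] fkk by (simp add: power2_eq_square)
  have "a * dd k (dd e f) z + b * (lam * dd k (dd e f) z) = 0"
    using Gab[of "[k, e]"] ddG[of k e] xe gke by simp
  then have "(a + b * lam) * dd k (dd e f) z = 0" by (simp add: algebra_simps)
  then have ab: "a = - b * lam" using fke by simp
  have b0: "b \<noteq> 0" using kk xk jet(1) by auto
  \<comment> \<open>Since \<open>G\<close> is \<open>b h\<close> plus an affine function, its fourth derivative along \<open>e\<close> is that of \<open>b h\<close>.\<close>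
  have G4: "dirs (replicate 4 e) G z = b * dirs [e, e, e, e] h z"
  proof -
    have 1: "dirs (replicate 4 e) G z = a * dirs [e, e, e, e] f z + b * dirs [e, e, e, e] g z"
      using Gab[of "[e, e, e, e]"] by (simp add: numeral_eq_Suc)
    have 2: "dirs [e, e, e, e] g z = dirs [e, e, e, e] h z + lam * dirs [e, e, e, e] f z"
      using dirs_h[of "[e, e, e, e]"] by linarith
    show ?thesis unfolding 1 2 ab by algebra
  qed
  have xee: "dd e (dd e x) z = 0" and yee: "dd e (dd e y) z = 0"
    using co_dirs[OF lT(3), of "[e, e]"] co_dirs[OF lT(4), of "[e, e]"] fee gee by (simp_all add: x_def y_def)
  have "b * dirs [e, e, e, e] h z / fact 4 = taylor_coeff g' 0 4 * (dd e y z) ^ 4"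
  proof (rule quartic_along_curve[OF W'(1,2,4)])
    show "g' 0 = 0" "Dx g' 0 = 0" "Dy g' 0 = 0" "Dy (Dy g') 0 = 0" using jg by auto
    show "Dy (Dx g') 0 = 0" using jg dd_commute[OF W'(1,4,2)] by metis
    show "dd e y z \<noteq> 0" by (rule ye)
    show "((\<lambda>t. x (z + t *\<^sub>R e) / t ^ 3) \<longlongrightarrow> dirs (replicate 3 e) x z / fact 3) (at 0)"
      using taylor_dirs_peano[OF W(1) sm(3) W(4), of 3 e] zero(3) xe xee by (simp add: numeral_eq_Suc)
    show "((\<lambda>t. (y (z + t *\<^sub>R e) - dd e y z * t) / t\<^sup>2) \<longlongrightarrow> 0) (at 0)"
      using taylor_dirs_peano[OF W(1) sm(4) W(4), of 2 e] zero(4) yee by (simp add: numeral_eq_Suc mult.commute)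
    show "((\<lambda>t. (G (z + t *\<^sub>R e) - dirs (replicate 3 e) G z / fact 3 * t ^ 3) / t ^ 4) \<longlongrightarrow> b * dirs [e, e, e, e] h z / fact 4) (at 0)"
      using taylor_dirs_peano[OF W(1) sm(2) W(4), of 4 e] zero(2) dG[of e] ddG[of e e] xe G4
      by (simp add: numeral_eq_Suc mult.commute)
    have "((\<lambda>t. z + t *\<^sub>R e) \<longlongrightarrow> z + 0 *\<^sub>R e) (at 0)" by (intro tendsto_intros)
    then have "\<forall>\<^sub>F t in at 0. z + t *\<^sub>R e \<in> U" using topological_tendstoD[OF _ U(1)] U(2) by simp
    then show "\<forall>\<^sub>F t in at 0. G (z + t *\<^sub>R e) = g' (x (z + t *\<^sub>R e), y (z + t *\<^sub>R e))"
      by eventually_elim (use graph in blast)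
  qed
  then have q4: "b * dirs [e, e, e, e] h z = (fact 4 * (dd e y z) ^ 4) * taylor_coeff g' 0 4"
    by (simp add: field_simps)
  have g20': "taylor_coeff g' 2 0 = g20" using jet(3) by (simp add: two_jet_eq_def)
  have "(b * dd k (dd k g) z) * (b * dirs [e, e, e, e] h z)
      = (2 * (dd k x z)\<^sup>2 * (fact 4 * (dd e y z) ^ 4)) * (g20 * taylor_coeff g' 0 4)"
    unfolding kk q4 by simp
  then have eq: "(b * b) * (dd k (dd k g) z * dirs [e, e, e, e] h z)
      = (2 * (dd k x z)\<^sup>2 * (fact 4 * (dd e y z) ^ 4)) * (g20 * taylor_coeff g' 0 4)" by (simp only: mult_ac)
  have "(dd k x z)\<^sup>2 > 0" using xk by simp
  moreover have "(dd e y z) ^ 4 > 0" using ye by (simp add: zero_less_power_eq)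
  ultimately have p: "2 * (dd k x z)\<^sup>2 * (fact 4 * (dd e y z) ^ 4) > 0" by simp
  have "b * b > 0" using b0 by (simp add: power2_eq_square[symmetric])
  then have "sgn (dd k (dd k g) z * dirs [e, e, e, e] h z) = sgn ((b * b) * (dd k (dd k g) z * dirs [e, e, e, e] h z))"
    unfolding sgn_mult[of "b * b"] by (simp only: sgn_pos mult_1)
  also have "\<dots> = sgn (g20 * taylor_coeff g' 0 4)"
    unfolding eq sgn_mult[of "2 * (dd k x z)\<^sup>2 * (fact 4 * (dd e y z) ^ 4)"] sgn_pos[OF p] by (rule mult_1)
  finally show ?thesis unfolding g20' by (rule sym)
qed

text \<open>As all normal forms give the same sign, the definite description denotes it.\<close>

theorem ordinary_parabolic_point_and_sign:
  assumes cubic: "dirs [e, e, e] h z \<noteq> 0 \<or> dirs [k, e, e] h z \<noteq> 0"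
  shows "ordinary_parabolic_point f g W z"
    and "parabolic_sign f g W z = sgn (dd k (dd k g) z * dirs [e, e, e, e] h z)"
proof -
  obtain f' g' where f: "ordinary_parabolic_form f g W z f' g'"
    using ordinary_parabolic_form_exists[OF cubic] by blast
  then show "ordinary_parabolic_point f g W z"
    unfolding ordinary_parabolic_point_def using W(4) by blast
  show "parabolic_sign f g W z = sgn (dd k (dd k g) z * dirs [e, e, e, e] h z)"
    unfolding parabolic_sign_def
  proof (rule the_equality)
    show "\<exists>f' g'. ordinary_parabolic_form f g W z f' g' \<and>
        sgn (dd k (dd k g) z * dirs [e, e, e, e] h z) = sgn (taylor_coeff g' 2 0 * taylor_coeff g' 0 4)"
      using f normal_form_sign[OF f] by metis
  qed (use normal_form_sign in auto)
qed

end

section \<open>Absence of tangencies near the inflexion point\<close>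

lemma taylor_along:
  fixes h :: "'a::euclidean_space \<Rightarrow> real"
  assumes W: "open W" "smooth_on W h" and seg: "\<forall>s. \<bar>s\<bar> \<le> \<bar>r\<bar> \<longrightarrow> z + s *\<^sub>R e \<in> W" and n: "n > 0"
  shows "\<exists>s. \<bar>s\<bar> \<le> \<bar>r\<bar> \<and> h (z + r *\<^sub>R e) =
    (\<Sum>m<n. r ^ m * dirs (replicate m e) h z / fact m) + r ^ n * dirs (replicate n e) h (z + s *\<^sub>R e) / fact n"
proof -
  have b: "\<bar>t * r\<bar> \<le> \<bar>r\<bar>" if "0 \<le> t" "t \<le> 1" for t
    using that by (simp add: abs_mult mult_left_le_one_le)
  have "\<forall>t\<in>{0..1}. z + t *\<^sub>R (r *\<^sub>R e) \<in> W" using seg b by simp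
  from taylor_dirs[OF W n this] obtain t where t: "0 < t" "t < 1" and e: "h (z + r *\<^sub>R e) =
     (\<Sum>m<n. dirs (replicate m (r *\<^sub>R e)) h z / fact m) + dirs (replicate n (r *\<^sub>R e)) h (z + t *\<^sub>R (r *\<^sub>R e)) / fact n"
    by (elim exE conjE)
  have "z \<in> W" "z + (t * r) *\<^sub>R e \<in> W" using seg[rule_format, of 0] seg[rule_format, OF b, of t] t by simp_all
  then have "h (z + r *\<^sub>R e) =
    (\<Sum>m<n. r ^ m * dirs (replicate m e) h z / fact m) + r ^ n * dirs (replicate n e) h (z + (t * r) *\<^sub>R e) / fact n"
    using e by (simp add: dirs_replicate_scale[OF W])
  then show ?thesis using b[of t] t by (intro exI[of _ "t * r"]) simp
qed

definition even_part :: "('a::euclidean_space \<Rightarrow> real) \<Rightarrow> 'a \<Rightarrow> 'a \<Rightarrow> real" where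
  "even_part h z X = h (z + X) + h (z - X) - 2 * h z"

definition even_part_deriv :: "('a::euclidean_space \<Rightarrow> real) \<Rightarrow> 'a \<Rightarrow> 'a \<Rightarrow> 'a \<Rightarrow> real" where
  "even_part_deriv h z v X = dd v h (z + X) - dd v h (z - X)"

text \<open>Odd terms cancel. The second and third expansions together give \<open>r D\<^sub>e F - 2 F\<close> as a combination of fourth
derivatives only, because the quadratic parts cancel.\<close>

lemma even_part_expansions:
  fixes h :: "'a::euclidean_space \<Rightarrow> real"
  assumes W: "open W" "smooth_on W h" and seg: "\<forall>s. \<bar>s\<bar> \<le> \<bar>r\<bar> \<longrightarrow> z + s *\<^sub>R e \<in> W"
  shows "\<exists>s1 s2. \<bar>s1\<bar> \<le> \<bar>r\<bar> \<and> \<bar>s2\<bar> \<le> \<bar>r\<bar> \<and> even_part h z (r *\<^sub>R e) =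
      r ^ 2 * (dd e (dd e h) (z + s1 *\<^sub>R e) + dd e (dd e h) (z + s2 *\<^sub>R e)) / 2" (is ?A)
    and "\<exists>s1 s2. \<bar>s1\<bar> \<le> \<bar>r\<bar> \<and> \<bar>s2\<bar> \<le> \<bar>r\<bar> \<and> even_part h z (r *\<^sub>R e) = r ^ 2 * dd e (dd e h) z +
      r ^ 4 * (dirs [e, e, e, e] h (z + s1 *\<^sub>R e) + dirs [e, e, e, e] h (z + s2 *\<^sub>R e)) / 24" (is ?B)
    and "\<exists>s1 s2. \<bar>s1\<bar> \<le> \<bar>r\<bar> \<and> \<bar>s2\<bar> \<le> \<bar>r\<bar> \<and> even_part_deriv h z e (r *\<^sub>R e) = 2 * r * dd e (dd e h) z +
      r ^ 3 * (dirs [e, e, e, e] h (z + s1 *\<^sub>R e) + dirs [e, e, e, e] h (z + s2 *\<^sub>R e)) / 6" (is ?C)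
    and "\<exists>s1 s2. \<bar>s1\<bar> \<le> \<bar>r\<bar> \<and> \<bar>s2\<bar> \<le> \<bar>r\<bar> \<and> even_part_deriv h z k (r *\<^sub>R e) =
      r * (dd k (dd e h) (z + s1 *\<^sub>R e) + dd k (dd e h) (z + s2 *\<^sub>R e))" (is ?D)
proof -
  have seg': "\<forall>s. \<bar>s\<bar> \<le> \<bar>- r\<bar> \<longrightarrow> z + s *\<^sub>R e \<in> W" using seg by simp
  have m: "z + (- r) *\<^sub>R e = z - r *\<^sub>R e" by simp
  have T: "\<exists>s. \<bar>s\<bar> \<le> \<bar>r\<bar> \<and> q (z + r *\<^sub>R e) =
    (\<Sum>m<n. r ^ m * dirs (replicate m e) q z / fact m) + r ^ n * dirs (replicate n e) q (z + s *\<^sub>R e) / fact n"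
    "\<exists>s. \<bar>s\<bar> \<le> \<bar>r\<bar> \<and> q (z - r *\<^sub>R e) =
    (\<Sum>m<n. (- r) ^ m * dirs (replicate m e) q z / fact m) + (- r) ^ n * dirs (replicate n e) q (z + s *\<^sub>R e) / fact n"
    if "smooth_on W q" "n > 0" for q n
    using taylor_along[OF W(1) that(1) seg that(2)] taylor_along[OF W(1) that(1) seg' that(2)]
    unfolding m by simp_all
  show ?A
  proof -
    obtain s1 where 1: "\<bar>s1\<bar> \<le> \<bar>r\<bar>" "h (z + r *\<^sub>R e) =
      (\<Sum>m<2. r ^ m * dirs (replicate m e) h z / fact m) + r ^ 2 * dirs (replicate 2 e) h (z + s1 *\<^sub>R e) / fact 2"
      using T(1)[OF W(2), of 2] by auto
    obtain s2 where 2: "\<bar>s2\<bar> \<le> \<bar>r\<bar>" "h (z - r *\<^sub>R e) =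
      (\<Sum>m<2. (- r) ^ m * dirs (replicate m e) h z / fact m) + (- r) ^ 2 * dirs (replicate 2 e) h (z + s2 *\<^sub>R e) / fact 2"
      using T(2)[OF W(2), of 2] by auto
    show ?thesis using 1 2
      by (intro exI[of _ s1] exI[of _ s2]) (simp add: even_part_def numeral_eq_Suc algebra_simps add_divide_distrib)
  qed
  show ?B
  proof -
    obtain s1 where 1: "\<bar>s1\<bar> \<le> \<bar>r\<bar>" "h (z + r *\<^sub>R e) =
      (\<Sum>m<4. r ^ m * dirs (replicate m e) h z / fact m) + r ^ 4 * dirs (replicate 4 e) h (z + s1 *\<^sub>R e) / fact 4"
      using T(1)[OF W(2), of 4] by auto
    obtain s2 where 2: "\<bar>s2\<bar> \<le> \<bar>r\<bar>" "h (z - r *\<^sub>R e) =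
      (\<Sum>m<4. (- r) ^ m * dirs (replicate m e) h z / fact m) + (- r) ^ 4 * dirs (replicate 4 e) h (z + s2 *\<^sub>R e) / fact 4"
      using T(2)[OF W(2), of 4] by auto
    have "(\<Sum>m<4. r ^ m * dirs (replicate m e) h z / fact m) + (\<Sum>m<4. (- r) ^ m * dirs (replicate m e) h z / fact m)
        = 2 * h z + r ^ 2 * dd e (dd e h) z"
      by (simp add: eval_nat_numeral)
    moreover have "replicate 4 e = [e, e, e, e]" by (simp add: eval_nat_numeral)
    moreover have "fact 4 = (24 :: real)" by (simp add: eval_nat_numeral)
    moreover have "(- r) ^ 4 = r ^ 4" by simp
    ultimately show ?thesis using 1 2
      by (intro exI[of _ s1] exI[of _ s2]) (simp add: even_part_def distrib_left add_divide_distrib)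
  qed
  show ?C
  proof -
    have q: "smooth_on W (dd e h)" by (rule smooth_on_dd[OF W])
    obtain s1 where 1: "\<bar>s1\<bar> \<le> \<bar>r\<bar>" "dd e h (z + r *\<^sub>R e) =
      (\<Sum>m<3. r ^ m * dirs (replicate m e) (dd e h) z / fact m) + r ^ 3 * dirs (replicate 3 e) (dd e h) (z + s1 *\<^sub>R e) / fact 3"
      using T(1)[OF q, of 3] by auto
    obtain s2 where 2: "\<bar>s2\<bar> \<le> \<bar>r\<bar>" "dd e h (z - r *\<^sub>R e) =
      (\<Sum>m<3. (- r) ^ m * dirs (replicate m e) (dd e h) z / fact m) + (- r) ^ 3 * dirs (replicate 3 e) (dd e h) (z + s2 *\<^sub>R e) / fact 3"
      using T(2)[OF q, of 3] by auto
    have "(\<Sum>m<3. r ^ m * dirs (replicate m e) (dd e h) z / fact m) - (\<Sum>m<3. (- r) ^ m * dirs (replicate m e) (dd e h) z / fact m)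
        = 2 * r * dd e (dd e h) z"
      by (simp add: eval_nat_numeral)
    moreover have "dirs (replicate 3 e) (dd e h) = dirs [e, e, e, e] h" by (simp add: eval_nat_numeral)
    moreover have "fact 3 = (6 :: real)" by (simp add: eval_nat_numeral)
    moreover have "(- r) ^ 3 = - (r ^ 3)" by simp
    ultimately show ?thesis using 1 2
      by (intro exI[of _ s1] exI[of _ s2]) (simp add: even_part_deriv_def distrib_left add_divide_distrib)
  qed
  show ?D
  proof -
    have q: "smooth_on W (dd k h)" by (rule smooth_on_dd[OF W])
    obtain s1 where 1: "\<bar>s1\<bar> \<le> \<bar>r\<bar>" "dd k h (z + r *\<^sub>R e) =
      (\<Sum>m<1. r ^ m * dirs (replicate m e) (dd k h) z / fact m) + r ^ 1 * dirs (replicate 1 e) (dd k h) (z + s1 *\<^sub>R e) / fact 1"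
      using T(1)[OF q, of 1] by auto
    obtain s2 where 2: "\<bar>s2\<bar> \<le> \<bar>r\<bar>" "dd k h (z - r *\<^sub>R e) =
      (\<Sum>m<1. (- r) ^ m * dirs (replicate m e) (dd k h) z / fact m) + (- r) ^ 1 * dirs (replicate 1 e) (dd k h) (z + s2 *\<^sub>R e) / fact 1"
      using T(2)[OF q, of 1] by auto
    have "dd e (dd k h) (z + s *\<^sub>R e) = dd k (dd e h) (z + s *\<^sub>R e)" if "\<bar>s\<bar> \<le> \<bar>r\<bar>" for s
      by (rule dd_commute[OF W]) (use seg that in blast)
    then show ?thesis using 1 2
      by (intro exI[of _ s1] exI[of _ s2]) (simp add: even_part_deriv_def distrib_left)
  qed
qed

lemma abs_add_ge_of_close:
  fixes c p q :: real
  assumes "\<bar>p - c\<bar> < \<bar>c\<bar> / 2" "\<bar>q - c\<bar> < \<bar>c\<bar> / 2"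
  shows "\<bar>c\<bar> \<le> \<bar>p + q\<bar>"
  using assms by (auto simp: abs_if split: if_splits)

text \<open>Suppose that \<open>r e\<close> is a degenerate zero. The two gradients are then proportional, so that
\<open>D\<^sub>k F\<^sub>f \<cdot> E\<^sub>g = E\<^sub>f \<cdot> D\<^sub>k F\<^sub>g\<close> with \<open>E = r D\<^sub>e F = r D\<^sub>e F - 2 F\<close>. After division by \<open>r\<^sup>5\<close>, the left side stays away from 0 by the conditions on
\<open>f\<close> and on the fourth derivative of \<open>g\<close>; on the right, \<open>E\<^sub>f\<close> is bounded and \<open>D\<^sub>k F\<^sub>g\<close> is small because the mixed derivative of \<open>g\<close> vanishes at the origin.\<close>

lemma no_tangency_near_direction:
  fixes f g :: "'a::euclidean_space \<Rightarrow> real"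
  assumes W: "open W" "0 \<in> W" "smooth_on W f" "smooth_on W g"
    and f: "dd k (dd e0 f) 0 \<noteq> 0" and g: "dd k (dd e0 g) 0 = 0" "dirs [e0, e0, e0, e0] g 0 \<noteq> 0"
  shows "\<exists>\<eta>>0. \<forall>z e r. norm z < \<eta> \<longrightarrow> norm (e - e0) < \<eta> \<longrightarrow> 0 < \<bar>r\<bar> \<longrightarrow> \<bar>r\<bar> < \<eta> \<longrightarrow>
    even_part f z (r *\<^sub>R e) = 0 \<longrightarrow> even_part g z (r *\<^sub>R e) = 0 \<longrightarrow>
    even_part_deriv f z k (r *\<^sub>R e) * even_part_deriv g z e (r *\<^sub>R e) \<noteq>
    even_part_deriv f z e (r *\<^sub>R e) * even_part_deriv g z k (r *\<^sub>R e)"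
proof -
  define c where "c = dd k (dd e0 f) 0"
  define c4 where "c4 = dirs [e0, e0, e0, e0] g 0"
  define C where "C = \<bar>dirs [e0, e0, e0, e0] f 0\<bar> + 1"
  \<comment> \<open>The factor 40 makes the upper bound \<open>2 C \<kappa>\<close> for one side of the proportionality half of the lower bound \<open>\<bar>c\<bar> \<bar>c4\<bar> / 10\<close> for the other.\<close>
  define \<kappa> where "\<kappa> = \<bar>c\<bar> * \<bar>c4\<bar> / (40 * C)"
  have pos: "C > 0" "c \<noteq> 0" "c4 \<noteq> 0" using f g by (auto simp: C_def c_def c4_def)
  then have \<kappa>: "\<kappa> > 0" by (simp add: \<kappa>_def)
  let ?N = "nhds (0 :: 'a, e0)"
  have w: "(fst \<longlongrightarrow> 0) ?N" and e: "(snd \<longlongrightarrow> e0) ?N"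
    using tendsto_fst[OF filterlim_ident] tendsto_snd[OF filterlim_ident] by fastforce+
  have l1: "((\<lambda>p. dd k (dd (snd p) h) (fst p)) \<longlongrightarrow> dd k (dd e0 h) 0) ?N" if "smooth_on W h" for h :: "'a \<Rightarrow> real"
    using tendsto_dirs[OF W(1,2) w that, of "[\<lambda>_. k, snd]" "[k, e0]"] e by simp
  have l4: "((\<lambda>p. dirs [snd p, snd p, snd p, snd p] h (fst p)) \<longlongrightarrow> dirs [e0, e0, e0, e0] h 0) ?N" if "smooth_on W h" for h :: "'a \<Rightarrow> real"
    using tendsto_dirs[OF W(1,2) w that, of "[snd, snd, snd, snd]" "[e0, e0, e0, e0]"] e by simp
  have "\<forall>\<^sub>F p in ?N. fst p \<in> W" by (rule topological_tendstoD[OF w W(1,2)])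
  moreover have "\<forall>\<^sub>F p in ?N. \<bar>dd k (dd (snd p) f) (fst p) - c\<bar> < \<bar>c\<bar> / 2"
    using tendstoD[OF l1[OF W(3)], of "\<bar>c\<bar> / 2"] pos by (simp add: c_def dist_real_def)
  moreover have "\<forall>\<^sub>F p in ?N. \<bar>dd k (dd (snd p) g) (fst p)\<bar> < \<kappa>"
    using tendstoD[OF l1[OF W(4)] \<kappa>] g by (simp add: dist_real_def)
  moreover have "\<forall>\<^sub>F p in ?N. \<bar>dirs [snd p, snd p, snd p, snd p] f (fst p)\<bar> < C"
    using tendstoD[OF l4[OF W(3)] zero_less_one]
  proof eventually_elim
    case (elim p)
    then show ?case
      using abs_triangle_ineq2[of "dirs [snd p, snd p, snd p, snd p] f (fst p)" "dirs [e0, e0, e0, e0] f 0"]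
      unfolding C_def dist_real_def by linarith
  qed
  moreover have "\<forall>\<^sub>F p in ?N. \<bar>dirs [snd p, snd p, snd p, snd p] g (fst p) - c4\<bar> < \<bar>c4\<bar> / 10"
    using tendstoD[OF l4[OF W(4)], of "\<bar>c4\<bar> / 10"] pos by (simp add: c4_def dist_real_def)
  ultimately have "\<forall>\<^sub>F p in ?N. fst p \<in> W \<and> \<bar>dd k (dd (snd p) f) (fst p) - c\<bar> < \<bar>c\<bar> / 2 \<and>
      \<bar>dd k (dd (snd p) g) (fst p)\<bar> < \<kappa> \<and> \<bar>dirs [snd p, snd p, snd p, snd p] f (fst p)\<bar> < C \<and>
      \<bar>dirs [snd p, snd p, snd p, snd p] g (fst p) - c4\<bar> < \<bar>c4\<bar> / 10"
    by eventually_elim (intro conjI)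
  then obtain d where d: "d > 0" and D: "\<And>w e. dist (w, e) (0, e0) < d \<Longrightarrow> w \<in> W \<and>
      \<bar>dd k (dd e f) w - c\<bar> < \<bar>c\<bar> / 2 \<and>
      \<bar>dd k (dd e g) w\<bar> < \<kappa> \<and> \<bar>dirs [e, e, e, e] f w\<bar> < C \<and>
      \<bar>dirs [e, e, e, e] g w - c4\<bar> < \<bar>c4\<bar> / 10"
    unfolding eventually_nhds_metric by force
  define \<eta> where "\<eta> = min 1 (d / (2 * (norm e0 + 3)))"
  have n0: "norm e0 + 3 > 0" by (smt (verit) norm_ge_zero)
  have \<eta>: "\<eta> > 0" "\<eta> \<le> 1" using d n0 by (auto simp: \<eta>_def)
  have \<eta>d: "\<eta> * (norm e0 + 3) \<le> d / 2"
  proof -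
    have "\<eta> * (norm e0 + 3) \<le> d / (2 * (norm e0 + 3)) * (norm e0 + 3)"
      using n0 by (intro mult_right_mono) (auto simp: \<eta>_def)
    also have "\<dots> = d / 2"
    proof -
      have "d / (2 * N) * N = d / 2" if "N > 0" for N :: real using that by simp
      then show ?thesis using n0 .
    qed
    finally show ?thesis .
  qed
  show ?thesis
  proof (intro exI[of _ \<eta>] conjI \<eta>(1) allI impI notI)
    fix z e :: 'a and r :: real
    assume z: "norm z < \<eta>" and e: "norm (e - e0) < \<eta>" and r: "0 < \<bar>r\<bar>" "\<bar>r\<bar> < \<eta>"
      and F: "even_part f z (r *\<^sub>R e) = 0" "even_part g z (r *\<^sub>R e) = 0"
      and J: "even_part_deriv f z k (r *\<^sub>R e) * even_part_deriv g z e (r *\<^sub>R e) =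
        even_part_deriv f z e (r *\<^sub>R e) * even_part_deriv g z k (r *\<^sub>R e)"
    have near: "dist (z + s *\<^sub>R e, e) (0, e0) < d" if "\<bar>s\<bar> \<le> \<bar>r\<bar>" for s
    proof -
      have ne: "norm e \<le> norm e0 + 1" using e \<eta>(2) norm_triangle_sub[of e e0] by linarith
      have "norm (z + s *\<^sub>R e) \<le> norm z + \<bar>s\<bar> * norm e" using norm_triangle_ineq[of z "s *\<^sub>R e"] by simp
      also have "\<bar>s\<bar> * norm e \<le> \<eta> * (norm e0 + 1)"
        using that r ne \<eta> by (intro mult_mono) auto
      finally have "norm (z + s *\<^sub>R e) < \<eta> * (norm e0 + 2)" using z by (simp add: distrib_left)
      moreover have "dist (z + s *\<^sub>R e, e) (0, e0) \<le> norm (z + s *\<^sub>R e) + norm (e - e0)"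
        using norm_Pair_le[of "z + s *\<^sub>R e" "e - e0"] by (simp add: dist_norm)
      ultimately have "dist (z + s *\<^sub>R e, e) (0, e0) < \<eta> * (norm e0 + 3)" using e by (simp add: distrib_left)
      then show ?thesis using \<eta>d d by linarith
    qed
    note D' = D[OF near]
    have seg: "\<forall>s. \<bar>s\<bar> \<le> \<bar>r\<bar> \<longrightarrow> z + s *\<^sub>R e \<in> W" using D' by blast
    \<comment> \<open>Subtracting \<open>2 F = 0\<close> removes the quadratic part.\<close>
    have E: "\<exists>A1 A2 B1 B2. (\<forall>A\<in>{A1, A2, B1, B2}. \<exists>s. \<bar>s\<bar> \<le> \<bar>r\<bar> \<and> A = dirs [e, e, e, e] h (z + s *\<^sub>R e)) \<and>
        r * even_part_deriv h z e (r *\<^sub>R e) = r ^ 4 * ((A1 + A2) / 6 - (B1 + B2) / 12)"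
      if h: "smooth_on W h" "even_part h z (r *\<^sub>R e) = 0" for h
    proof -
      obtain s1 s2 where 1: "\<bar>s1\<bar> \<le> \<bar>r\<bar>" "\<bar>s2\<bar> \<le> \<bar>r\<bar>" "even_part h z (r *\<^sub>R e) = r ^ 2 * dd e (dd e h) z +
        r ^ 4 * (dirs [e, e, e, e] h (z + s1 *\<^sub>R e) + dirs [e, e, e, e] h (z + s2 *\<^sub>R e)) / 24"
        using even_part_expansions(2)[OF W(1) h(1) seg] by (elim exE conjE)
      obtain s3 s4 where 2: "\<bar>s3\<bar> \<le> \<bar>r\<bar>" "\<bar>s4\<bar> \<le> \<bar>r\<bar>" "even_part_deriv h z e (r *\<^sub>R e) = 2 * r * dd e (dd e h) z +
        r ^ 3 * (dirs [e, e, e, e] h (z + s3 *\<^sub>R e) + dirs [e, e, e, e] h (z + s4 *\<^sub>R e)) / 6"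
        using even_part_expansions(3)[OF W(1) h(1) seg] by (elim exE conjE)
      have a: "a * Q + b * S / 24 = 0 \<Longrightarrow> r * T = 2 * (a * Q) + b * U / 6 \<Longrightarrow> r * T = b * (U / 6 - S / 12)"
        for a b Q S T U :: real by (simp add: field_simps)
      have "r * even_part_deriv h z e (r *\<^sub>R e) = 2 * (r ^ 2 * dd e (dd e h) z) +
        r ^ 4 * (dirs [e, e, e, e] h (z + s3 *\<^sub>R e) + dirs [e, e, e, e] h (z + s4 *\<^sub>R e)) / 6"
        unfolding 2(3) by (simp add: eval_nat_numeral distrib_left)
      from a[OF _ this] 1(3) h(2)
      have "r * even_part_deriv h z e (r *\<^sub>R e) =
        r ^ 4 * ((dirs [e, e, e, e] h (z + s3 *\<^sub>R e) + dirs [e, e, e, e] h (z + s4 *\<^sub>R e)) / 6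
          - (dirs [e, e, e, e] h (z + s1 *\<^sub>R e) + dirs [e, e, e, e] h (z + s2 *\<^sub>R e)) / 12)" by simp
      then show ?thesis using 1(1,2) 2(1,2) by blast
    qed
    obtain A1 A2 B1 B2 where Ef: "\<forall>A\<in>{A1, A2, B1, B2}. \<exists>s. \<bar>s\<bar> \<le> \<bar>r\<bar> \<and> A = dirs [e, e, e, e] f (z + s *\<^sub>R e)"
      "r * even_part_deriv f z e (r *\<^sub>R e) = r ^ 4 * ((A1 + A2) / 6 - (B1 + B2) / 12)"
      using E[OF W(3) F(1)] by (elim exE conjE)
    have "\<bar>A\<bar> < C" if "A \<in> {A1, A2, B1, B2}" for A
    proof -
      obtain s where "\<bar>s\<bar> \<le> \<bar>r\<bar>" "A = dirs [e, e, e, e] f (z + s *\<^sub>R e)" using Ef(1) \<open>A \<in> _\<close> by blast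
      then show ?thesis using D'[of s] by simp
    qed
    then have cl: "A1 < C" "- A1 < C" "A2 < C" "- A2 < C" "B1 < C" "- B1 < C" "B2 < C" "- B2 < C"
      by (simp_all add: abs_less_iff)
    have av: "S / 6 - T / 12 < C \<and> - (S / 6 - T / 12) < C"
      if "S < 2 * C" "- S < 2 * C" "T < 2 * C" "- T < 2 * C" for S T :: real
      using that by (simp add: field_simps)
    have "A1 + A2 < 2 * C" using cl(1,3) by linarith
    moreover have "- (A1 + A2) < 2 * C" using cl(2,4) by linarith
    moreover have "B1 + B2 < 2 * C" using cl(5,7) by linarith
    moreover have "- (B1 + B2) < 2 * C" using cl(6,8) by linarith
    ultimately have "(A1 + A2) / 6 - (B1 + B2) / 12 < C" "- ((A1 + A2) / 6 - (B1 + B2) / 12) < C"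
      using av by blast+
    then have bf: "\<bar>(A1 + A2) / 6 - (B1 + B2) / 12\<bar> < C" by (simp only: abs_less_iff simp_thms)
    obtain A1' A2' B1' B2' where Eg: "\<forall>A\<in>{A1', A2', B1', B2'}. \<exists>s. \<bar>s\<bar> \<le> \<bar>r\<bar> \<and> A = dirs [e, e, e, e] g (z + s *\<^sub>R e)"
      "r * even_part_deriv g z e (r *\<^sub>R e) = r ^ 4 * ((A1' + A2') / 6 - (B1' + B2') / 12)"
      using E[OF W(4) F(2)] by (elim exE conjE)
    have "\<bar>A - c4\<bar> < \<bar>c4\<bar> / 10" if "A \<in> {A1', A2', B1', B2'}" for A
    proof -
      obtain s where "\<bar>s\<bar> \<le> \<bar>r\<bar>" "A = dirs [e, e, e, e] g (z + s *\<^sub>R e)" using Eg(1) \<open>A \<in> _\<close> by blast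
      then show ?thesis using D'[of s] by simp
    qed
    then have cl: "A1' - c4 < \<bar>c4\<bar> / 10" "- (A1' - c4) < \<bar>c4\<bar> / 10" "A2' - c4 < \<bar>c4\<bar> / 10" "- (A2' - c4) < \<bar>c4\<bar> / 10"
      "B1' - c4 < \<bar>c4\<bar> / 10" "- (B1' - c4) < \<bar>c4\<bar> / 10" "B2' - c4 < \<bar>c4\<bar> / 10" "- (B2' - c4) < \<bar>c4\<bar> / 10"
      by (simp_all only: abs_less_iff insert_iff simp_thms)
    \<comment> \<open>If all four numbers were equal to \<open>c4\<close>, this expression would be \<open>c4 / 6\<close>.\<close>
    have bg: "\<bar>(A1' + A2') / 6 - (B1' + B2') / 12\<bar> \<ge> \<bar>c4\<bar> / 10"
    proof -
      have av: "c / 10 \<le> S / 6 - T / 12" if "18 * c \<le> 10 * S" "10 * T \<le> 22 * c" "0 \<le> c" for c S T :: real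
        using that by (simp add: field_simps)
      have av': "c / 10 \<le> - (S / 6 - T / 12)" if "18 * c \<le> 10 * (- S)" "10 * (- T) \<le> 22 * c" "0 \<le> c" for c S T :: real
        using that by (simp add: field_simps)
      show ?thesis
      proof (cases "c4 \<ge> 0")
        case True
        then have a: "\<bar>c4\<bar> = c4" by simp
        have "18 * c4 \<le> 10 * (A1' + A2')" using cl(2,4) unfolding a by (simp add: field_simps)
        moreover have "10 * (B1' + B2') \<le> 22 * c4" using cl(5,7) unfolding a by (simp add: field_simps)
        ultimately have "c4 / 10 \<le> (A1' + A2') / 6 - (B1' + B2') / 12" using True by (rule av)
        then show ?thesis unfolding a using abs_ge_self order_trans by blast
      next
        case False
        then have a: "\<bar>c4\<bar> = - c4" by simp
        have "18 * (- c4) \<le> 10 * (- (A1' + A2'))" using cl(1,3) unfolding a by (simp add: field_simps)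
        moreover have "10 * (- (B1' + B2')) \<le> 22 * (- c4)" using cl(6,8) unfolding a by (simp add: field_simps)
        moreover have "0 \<le> - c4" using False by simp
        ultimately have "- c4 / 10 \<le> - ((A1' + A2') / 6 - (B1' + B2') / 12)" by (rule av')
        then show ?thesis unfolding a using abs_ge_minus_self order_trans by blast
      qed
    qed
    obtain s1 s2 where kf: "\<bar>s1\<bar> \<le> \<bar>r\<bar>" "\<bar>s2\<bar> \<le> \<bar>r\<bar>" "even_part_deriv f z k (r *\<^sub>R e) =
        r * (dd k (dd e f) (z + s1 *\<^sub>R e) + dd k (dd e f) (z + s2 *\<^sub>R e))"
      using even_part_expansions(4)[OF W(1,3) seg, where k=k] by (elim exE conjE)
    define Kf where "Kf = dd k (dd e f) (z + s1 *\<^sub>R e) + dd k (dd e f) (z + s2 *\<^sub>R e)"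
    have Kf: "\<bar>Kf\<bar> \<ge> \<bar>c\<bar>"
      unfolding Kf_def by (rule abs_add_ge_of_close) (use D'[OF kf(1)] D'[OF kf(2)] in blast)+
    obtain s3 s4 where kg: "\<bar>s3\<bar> \<le> \<bar>r\<bar>" "\<bar>s4\<bar> \<le> \<bar>r\<bar>" "even_part_deriv g z k (r *\<^sub>R e) =
        r * (dd k (dd e g) (z + s3 *\<^sub>R e) + dd k (dd e g) (z + s4 *\<^sub>R e))"
      using even_part_expansions(4)[OF W(1,4) seg, where k=k] by (elim exE conjE)
    define Kg where "Kg = dd k (dd e g) (z + s3 *\<^sub>R e) + dd k (dd e g) (z + s4 *\<^sub>R e)"
    have Kg: "\<bar>Kg\<bar> < 2 * \<kappa>"
    proof -
      have "\<bar>p + q\<bar> < 2 * \<kappa>" if "\<bar>p\<bar> < \<kappa>" "\<bar>q\<bar> < \<kappa>" for p q using that by linarith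
      then show ?thesis unfolding Kg_def using D'[OF kg(1)] D'[OF kg(2)] by blast
    qed
    define Vf where "Vf = (A1 + A2) / 6 - (B1 + B2) / 12"
    define Vg where "Vg = (A1' + A2') / 6 - (B1' + B2') / 12"
    have "even_part_deriv f z k (r *\<^sub>R e) * (r * even_part_deriv g z e (r *\<^sub>R e)) =
        (r * even_part_deriv f z e (r *\<^sub>R e)) * even_part_deriv g z k (r *\<^sub>R e)" using J by (simp add: mult_ac)
    then have "(r * Kf) * (r ^ 4 * Vg) = (r ^ 4 * Vf) * (r * Kg)"
      unfolding Ef(2) Eg(2) kf(3) kg(3) Kf_def Kg_def Vf_def Vg_def .
    then have "(r * r ^ 4) * (Kf * Vg) = (r * r ^ 4) * (Vf * Kg)" by (simp only: mult_ac)
    then have KV: "Kf * Vg = Vf * Kg" using r by simp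
    have "\<bar>c\<bar> * (\<bar>c4\<bar> / 10) \<le> \<bar>Kf\<bar> * \<bar>Vg\<bar>"
      using Kf bg unfolding Vg_def by (intro mult_mono) auto
    also have "\<dots> = \<bar>Vf\<bar> * \<bar>Kg\<bar>" using KV by (metis abs_mult)
    also have "\<dots> \<le> C * (2 * \<kappa>)"
      using bf Kg unfolding Vf_def by (intro mult_mono) auto
    also have "\<dots> = \<bar>c\<bar> * \<bar>c4\<bar> / 20" using pos by (simp add: \<kappa>_def)
    finally have "\<bar>c\<bar> * \<bar>c4\<bar> \<le> 0" by (simp add: mult.commute)
    moreover have "\<bar>c\<bar> * \<bar>c4\<bar> > 0" using pos by simp
    ultimately show False by linarith
  qed
qed

lemma hess_expand:
  fixes h :: "real \<times> real \<Rightarrow> real"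
  assumes W: "open W" "smooth_on W h" "w \<in> W"
  shows "dd (a, b) (dd (c, d) h) w = a * c * Dx (Dx h) w
     + (a * d + b * c) * Dx (Dy h) w + b * d * Dy (Dy h) w"
proof -
  have e: "dd (a, b) q x = a * Dx q x + b * Dy q x" if "smooth_on W q" "x \<in> W" for q :: "real \<times> real \<Rightarrow> real" and a b x
    using dd_linear_expand[OF smooth_on_differentiable[OF that], of "(a, b)"]
    by (simp add: Basis_prod_def)
  have s: "smooth_on W (dd v h)" for v by (rule smooth_on_dd[OF W(1,2)])
  have "dd v (dd (c, d) h) w = c * dd v (Dx h) w + d * dd v (Dy h) w" for v
  proof -
    have "dd v (dd (c, d) h) w = dd v (\<lambda>x. c * Dx h x + d * Dy h x) w"
      by (rule dd_cong_open[OF W(1,3)]) (rule e[OF W(2)])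
    also have "\<dots> = dd v (\<lambda>x. c * Dx h x) w + dd v (\<lambda>x. d * Dy h x) w"
      by (rule dd_add; rule smooth_on_differentiable[OF _ W(3)]; intro smooth_on_mult smooth_on_const W s)
    finally show ?thesis
      using dd_cmult[OF smooth_on_differentiable[OF s W(3)]] by simp
  qed
  note l = this
  have "Dy (Dx h) w = Dx (Dy h) w" by (rule dd_commute[OF W])
  moreover have "dd (a, b) (dd v h) w = a * Dx (dd v h) w + b * Dy (dd v h) w" for v
    by (rule e[OF s W(3)])
  ultimately show ?thesis unfolding l by (simp add: algebra_simps)
qed

text \<open>The vanishing of \<open>f''(X,X) + \<dots>\<close>, with \<open>f''\<close> close to a multiple of \<open>x y\<close>, makes \<open>x y\<close> small compared with \<open>x\<^sup>2 + y\<^sup>2\<close>; so \<open>X\<close> is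
nearly parallel to one of the axes.\<close>

lemma no_tangency:
  fixes f g :: "real \<times> real \<Rightarrow> real"
  assumes W: "open W" "0 \<in> W" "smooth_on W f" "smooth_on W g"
    and f: "Dx (Dx f) 0 = 0" "Dy (Dy f) 0 = 0" "Dx (Dy f) 0 \<noteq> 0"
    and g: "Dx (Dy g) 0 = 0"
      "dirs [(1, 0), (1, 0), (1, 0), (1, 0)] g 0 \<noteq> 0" "dirs [(0, 1), (0, 1), (0, 1), (0, 1)] g 0 \<noteq> 0"
  shows "\<exists>\<eta>>0. \<forall>z X. norm z < \<eta> \<longrightarrow> X \<noteq> 0 \<longrightarrow> norm X < \<eta> \<longrightarrow>
    even_part f z X = 0 \<longrightarrow> even_part g z X = 0 \<longrightarrow>
    (\<exists>u v. even_part_deriv f z u X * even_part_deriv g z v X \<noteq> even_part_deriv f z v X * even_part_deriv g z u X)"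
proof -
  have com: "Dy (Dx h) 0 = Dx (Dy h) 0" if "smooth_on W h" for h :: "real \<times> real \<Rightarrow> real"
    by (rule dd_commute[OF W(1) that W(2)])
  define bad where "bad z e r \<longleftrightarrow> even_part f z (r *\<^sub>R e) = 0 \<and> even_part g z (r *\<^sub>R e) = 0 \<and>
    (\<forall>u v. even_part_deriv f z u (r *\<^sub>R e) * even_part_deriv g z v (r *\<^sub>R e) =
      even_part_deriv f z v (r *\<^sub>R e) * even_part_deriv g z u (r *\<^sub>R e))" for z e and r :: real
  have "Dy (Dx f) 0 \<noteq> 0" "Dy (Dx g) 0 = 0" using com[OF W(3)] com[OF W(4)] f g by simp_all
  from no_tangency_near_direction[OF W this g(2)] obtain \<eta>1 where
    \<eta>1: "\<eta>1 > 0" "\<And>z e r. norm z < \<eta>1 \<Longrightarrow> norm (e - (1, 0)) < \<eta>1 \<Longrightarrow> 0 < \<bar>r\<bar> \<Longrightarrow> \<bar>r\<bar> < \<eta>1 \<Longrightarrow> \<not> bad z e r"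
    unfolding bad_def by metis
  from no_tangency_near_direction[OF W f(3) g(1,3)] obtain \<eta>2 where
    \<eta>2: "\<eta>2 > 0" "\<And>z e r. norm z < \<eta>2 \<Longrightarrow> norm (e - (0, 1)) < \<eta>2 \<Longrightarrow> 0 < \<bar>r\<bar> \<Longrightarrow> \<bar>r\<bar> < \<eta>2 \<Longrightarrow> \<not> bad z e r"
    unfolding bad_def by metis
  define m where "m = min \<eta>1 \<eta>2"
  define b0 where "b0 = Dx (Dy f) 0"
  define \<kappa> where "\<kappa> = m * \<bar>b0\<bar> / 4"
  have pos: "m > 0" "b0 \<noteq> 0" "\<kappa> > 0" using \<eta>1 \<eta>2 f by (auto simp: m_def b0_def \<kappa>_def)
  have lim: "(dd u (dd v f) \<longlongrightarrow> dd u (dd v f) 0) (nhds 0)" for u v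
    using smooth_on_isCont[OF smooth_on_dd[OF W(1) smooth_on_dd[OF W(1,3)]] W(2)] by (simp add: isCont_def tendsto_nhds_iff)
  have "\<forall>\<^sub>F w in nhds 0. w \<in> W" using W(1,2) by (rule eventually_nhds_in_open)
  moreover have "\<forall>\<^sub>F w in nhds 0. \<bar>Dx (Dx f) w\<bar> < \<kappa>"
    using tendstoD[OF lim pos(3), of "(1, 0)" "(1, 0)"] f by (simp add: dist_real_def)
  moreover have "\<forall>\<^sub>F w in nhds 0. \<bar>Dy (Dy f) w\<bar> < \<kappa>"
    using tendstoD[OF lim pos(3), of "(0, 1)" "(0, 1)"] f by (simp add: dist_real_def)
  moreover have "\<forall>\<^sub>F w in nhds 0. \<bar>Dx (Dy f) w - b0\<bar> < \<bar>b0\<bar> / 2"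
    using tendstoD[OF lim, of "\<bar>b0\<bar> / 2" "(1, 0)" "(0, 1)"] pos by (simp add: dist_real_def b0_def)
  ultimately have "\<forall>\<^sub>F w in nhds 0. w \<in> W \<and> \<bar>Dx (Dx f) w\<bar> < \<kappa> \<and> \<bar>Dy (Dy f) w\<bar> < \<kappa> \<and>
      \<bar>Dx (Dy f) w - b0\<bar> < \<bar>b0\<bar> / 2"
    by eventually_elim (intro conjI)
  then obtain d where d: "d > 0" and D: "\<And>w. norm w < d \<Longrightarrow> w \<in> W \<and> \<bar>Dx (Dx f) w\<bar> < \<kappa> \<and> \<bar>Dy (Dy f) w\<bar> < \<kappa> \<and>
      \<bar>Dx (Dy f) w - b0\<bar> < \<bar>b0\<bar> / 2"
    unfolding eventually_nhds_metric by (auto simp: dist_norm)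
  define \<eta> where "\<eta> = min m (d / 2)"
  have \<eta>: "\<eta> > 0" "\<eta> \<le> m" "\<eta> \<le> d / 2" using pos d by (auto simp: \<eta>_def)
  have main: "\<not> (even_part f z X = 0 \<and> even_part g z X = 0 \<and>
    (\<forall>u v. even_part_deriv f z u X * even_part_deriv g z v X = even_part_deriv f z v X * even_part_deriv g z u X))"
    if z: "norm z < \<eta>" and X: "X \<noteq> 0" "norm X < \<eta>" for z X
  proof
    assume bad: "even_part f z X = 0 \<and> even_part g z X = 0 \<and>
    (\<forall>u v. even_part_deriv f z u X * even_part_deriv g z v X = even_part_deriv f z v X * even_part_deriv g z u X)"
    obtain x y where xy: "X = (x, y)" by (cases X)
    have near: "norm (z + s *\<^sub>R X) < d" if "\<bar>s\<bar> \<le> \<bar>1 :: real\<bar>" for s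
    proof -
      have "norm (z + s *\<^sub>R X) \<le> norm z + \<bar>s\<bar> * norm X" using norm_triangle_ineq[of z "s *\<^sub>R X"] by simp
      also have "\<bar>s\<bar> * norm X \<le> norm X" using that by (simp add: mult_left_le_one_le)
      finally show ?thesis using z X \<eta> by linarith
    qed
    have seg: "\<forall>s. \<bar>s\<bar> \<le> \<bar>1 :: real\<bar> \<longrightarrow> z + s *\<^sub>R X \<in> W" using D[OF near] by blast
    obtain s1 s2 :: real where s: "\<bar>s1\<bar> \<le> \<bar>1\<bar>" "\<bar>s2\<bar> \<le> \<bar>1\<bar>" "even_part f z (1 *\<^sub>R X) =
      1 ^ 2 * (dd X (dd X f) (z + s1 *\<^sub>R X) + dd X (dd X f) (z + s2 *\<^sub>R X)) / 2"
      using even_part_expansions(1)[OF W(1,3) seg] by (elim exE conjE)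
    define w1 where "w1 = z + s1 *\<^sub>R X"
    define w2 where "w2 = z + s2 *\<^sub>R X"
    note D1 = D[OF near[OF s(1)], folded w1_def] and D2 = D[OF near[OF s(2)], folded w2_def]
    have tri: "\<bar>p + q\<bar> \<le> 2 * \<kappa>" if "\<bar>p\<bar> < \<kappa>" "\<bar>q\<bar> < \<kappa>" for p q using that by linarith
    have bound: "\<bar>Dx (Dx f) w1 + Dx (Dx f) w2\<bar> \<le> 2 * \<kappa>"
      "\<bar>Dy (Dy f) w1 + Dy (Dy f) w2\<bar> \<le> 2 * \<kappa>"
      using D1 D2 by (simp_all only: tri)
    have "dd X (dd X f) w1 + dd X (dd X f) w2 = 0" using s(3) bad by (simp add: w1_def w2_def)
    moreover have "dd X (dd X f) w = x * x * Dx (Dx f) w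
      + (x * y + y * x) * Dx (Dy f) w + y * y * Dy (Dy f) w" if "w \<in> W" for w
      unfolding xy by (rule hess_expand[OF W(1,3) that])
    moreover have in_W: "w1 \<in> W" "w2 \<in> W" using D1 D2 by blast+
    ultimately have "(2 * x * y) * (Dx (Dy f) w1 + Dx (Dy f) w2) =
       - (x * x * (Dx (Dx f) w1 + Dx (Dx f) w2)) - y * y * (Dy (Dy f) w1 + Dy (Dy f) w2)"
      by (simp add: algebra_simps)
    then have "\<bar>2 * x * y\<bar> * \<bar>Dx (Dy f) w1 + Dx (Dy f) w2\<bar> \<le>
       \<bar>x * x * (Dx (Dx f) w1 + Dx (Dx f) w2)\<bar> + \<bar>y * y * (Dy (Dy f) w1 + Dy (Dy f) w2)\<bar>"
      unfolding abs_mult[symmetric] by linarith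
    also have "\<bar>x * x * (Dx (Dx f) w1 + Dx (Dx f) w2)\<bar> \<le> (x * x) * (2 * \<kappa>)"
      unfolding abs_mult[of "x * x"] using bound(1) by (intro mult_mono) auto
    also have "\<bar>y * y * (Dy (Dy f) w1 + Dy (Dy f) w2)\<bar> \<le> (y * y) * (2 * \<kappa>)"
      unfolding abs_mult[of "y * y"] using bound(2) by (intro mult_mono) auto
    finally have le: "\<bar>2 * x * y\<bar> * \<bar>Dx (Dy f) w1 + Dx (Dy f) w2\<bar> \<le> (x * x + y * y) * (2 * \<kappa>)"
      by (simp add: distrib_right)
    have "\<bar>b0\<bar> \<le> \<bar>Dx (Dy f) w1 + Dx (Dy f) w2\<bar>"
      by (rule abs_add_ge_of_close) (use D1 D2 in blast)+
    then have "\<bar>2 * x * y\<bar> * \<bar>b0\<bar> \<le> \<bar>2 * x * y\<bar> * \<bar>Dx (Dy f) w1 + Dx (Dy f) w2\<bar>"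
      by (intro mult_left_mono) auto
    with le have "\<bar>2 * x * y\<bar> * \<bar>b0\<bar> \<le> (x * x + y * y) * (2 * \<kappa>)" by linarith
    then have "(\<bar>x\<bar> * \<bar>y\<bar>) * \<bar>b0\<bar> \<le> ((x * x + y * y) * (m / 4)) * \<bar>b0\<bar>"
      by (simp add: \<kappa>_def abs_mult field_simps)
    then have key: "\<bar>x\<bar> * \<bar>y\<bar> \<le> (x * x + y * y) * (m / 4)" using pos(2) by simp
    have slope: "\<bar>b / a\<bar> < m" if "\<bar>b\<bar> \<le> \<bar>a\<bar>" "a \<noteq> 0" "\<bar>a\<bar> * \<bar>b\<bar> \<le> (a * a + b * b) * (m / 4)" for a b :: real
    proof -
      have "b * b \<le> a * a" using that(1) by (metis abs_mult_self_eq abs_ge_zero mult_mono)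
      then have "\<bar>a\<bar> * \<bar>b\<bar> \<le> (2 * (a * a)) * (m / 4)"
        using that(3) pos(1) mult_right_mono[of "a * a + b * b" "2 * (a * a)" "m / 4"] by linarith
      also have "\<dots> = \<bar>a\<bar> * (\<bar>a\<bar> * (m / 2))" by (simp add: abs_mult_self_eq)
      finally have "\<bar>b\<bar> \<le> \<bar>a\<bar> * (m / 2)" using that(2) by simp
      also have "\<dots> < \<bar>a\<bar> * m" using that(2) pos(1) by simp
      finally show ?thesis using that(2) by (simp add: abs_divide field_simps)
    qed
    have xm: "\<bar>x\<bar> < m" "\<bar>y\<bar> < m"
      using norm_fst_le[of x y] norm_snd_le[of y x] X(2) \<eta>(2) by (simp_all add: xy)
    show False
    proof (cases "\<bar>y\<bar> \<le> \<bar>x\<bar>")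
      case True
      then have x: "x \<noteq> 0" using X(1) by (auto simp: xy zero_prod_def)
      have e: "X = x *\<^sub>R (1, y / x)" using x by (simp add: xy)
      have "norm ((1, y / x) - (1, 0)) < m" using slope[OF True x key] by simp
      then have "\<not> bad z (1, y / x) x"
        using z \<eta>(2) x xm by (intro \<eta>1(2)) (auto simp: m_def)
      then show False using bad unfolding bad_def e[symmetric] by blast
    next
      case False
      then have y: "y \<noteq> 0" by auto
      have e: "X = y *\<^sub>R (x / y, 1)" using y by (simp add: xy)
      have "norm ((x / y, 1) - (0, 1)) < m" using slope[of x y] False y key by (simp add: mult.commute add.commute)
      then have "\<not> bad z (x / y, 1) y"
        using z \<eta>(2) y xm by (intro \<eta>2(2)) (auto simp: m_def)
      then show False using bad unfolding bad_def e[symmetric] by blast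
    qed
  qed
  show ?thesis
    by (rule exI[of _ \<eta>]) (use \<eta>(1) main in blast)
qed

section \<open>The bifurcation set is the parabolic set\<close>

lemma contact_map_even_part: "contact_map f g z X = (even_part f z X, even_part g z X)"
  by (cases z; cases X) (simp add: contact_map_def even_part_def)

text \<open>The parametrization \<open>(x, y) \<mapsto> (u, v, w)\<close> of the half-cone by the plane.\<close>

definition veronese :: "real \<times> real \<Rightarrow> R3" where
  "veronese X = ((fst X)\<^sup>2, fst X * snd X, (snd X)\<^sup>2)"

lemma veronese_has_derivative:
  "(veronese has_derivative (\<lambda>v. (2 * fst X * fst v, fst X * snd v + fst v * snd X, 2 * snd X * snd v))) (at X)"
  unfolding veronese_def[abs_def]
  by (auto intro!: derivative_eq_intros has_derivative_Pair simp: algebra_simps)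

lemma even_part_has_derivative:
  fixes h :: "'a::euclidean_space \<Rightarrow> real"
  assumes "h differentiable (at (z + X))" "h differentiable (at (z - X))"
  shows "(even_part h z has_derivative (\<lambda>v. even_part_deriv h z v X)) (at X)"
proof -
  have 1: "((\<lambda>X. h (z + X)) has_derivative (\<lambda>v. dd v h (z + X))) (at X)"
    using diff_chain_at[OF has_derivative_add[OF has_derivative_const has_derivative_ident], of h "\<lambda>v. dd v h (z + X)" z X]
      has_derivative_dd[OF assms(1)] by (simp add: o_def)
  have "((\<lambda>X. h (z - X)) has_derivative (\<lambda>v. dd (- v) h (z - X))) (at X)"
    using diff_chain_at[OF has_derivative_diff[OF has_derivative_const has_derivative_ident], of h "\<lambda>v. dd v h (z - X)" z X]
      has_derivative_dd[OF assms(2)] by (simp add: o_def)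
  moreover have "dd (- v) h (z - X) = - dd v h (z - X)" for v
    using linear_neg[OF dd_linear[OF assms(2)]] by simp
  ultimately have 2: "((\<lambda>X. h (z - X)) has_derivative (\<lambda>v. - dd v h (z - X))) (at X)" by simp
  show ?thesis
    unfolding even_part_def[abs_def] even_part_deriv_def
    using has_derivative_diff[OF has_derivative_add[OF 1 2] has_derivative_const[of "2 * h z"]] by simp
qed

lemma even_part_deriv_veronese:
  fixes h :: "real \<times> real \<Rightarrow> real"
  assumes W: "smooth_on W h" "z + X \<in> W" "z - X \<in> W"
    and \<phi>: "smooth_on (ball 0 \<rho>) \<phi>" "veronese X \<in> ball 0 \<rho>"
    and rep: "\<And>Y. veronese Y \<in> ball 0 \<rho> \<Longrightarrow> even_part h z Y = \<phi> (veronese Y)"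
  shows "even_part_deriv h z v X =
    grad3 \<phi> (veronese X) \<bullet> (2 * fst X * fst v, fst X * snd v + fst v * snd X, 2 * snd X * snd v)"
proof -
  have d\<phi>: "\<phi> differentiable (at (veronese X))" by (rule smooth_on_differentiable[OF \<phi>])
  have cv: "continuous_on UNIV veronese"
    by (intro continuous_at_imp_continuous_on ballI has_derivative_continuous[OF veronese_has_derivative])
  have o: "open (veronese -` ball 0 \<rho>)" by (rule open_vimage[OF open_ball cv])
  have 1: "(even_part h z has_derivative (\<lambda>v. even_part_deriv h z v X)) (at X)"
    by (intro even_part_has_derivative smooth_on_differentiable[OF W(1)] W(2,3))
  have 2: "((\<lambda>Y. \<phi> (veronese Y)) has_derivative
     (\<lambda>v. dd (2 * fst X * fst v, fst X * snd v + fst v * snd X, 2 * snd X * snd v) \<phi> (veronese X))) (at X)"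
    using diff_chain_at[OF veronese_has_derivative has_derivative_dd[OF d\<phi>]] by (simp add: o_def)
  have "dd v (even_part h z) X = dd v (\<lambda>Y. \<phi> (veronese Y)) X"
    by (rule dd_cong_open[OF o]) (use \<phi>(2) rep in auto)
  then have "even_part_deriv h z v X = dd (2 * fst X * fst v, fst X * snd v + fst v * snd X, 2 * snd X * snd v) \<phi> (veronese X)"
    using dd_unique[OF 1, of v] dd_unique[OF 2, of v] by simp
  then show ?thesis by (simp only: dd_grad3[OF d\<phi>])
qed

lemma half_cone_veronese:
  assumes "P \<in> half_cone"
  obtains X where "P = veronese X"
proof -
  obtain u v w where P: "P = (u, v, w)" by (cases P)
  have h: "v\<^sup>2 = u * w" "u \<ge> 0" "w \<ge> 0" using assms by (auto simp: P half_cone_def)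
  have v: "\<bar>v\<bar> = sqrt u * sqrt w" using h by (metis real_sqrt_abs real_sqrt_mult)
  show ?thesis
  proof (cases "v \<ge> 0")
    case True
    then show ?thesis using that[of "(sqrt u, sqrt w)"] h v by (simp add: P veronese_def)
  next
    case False
    then show ?thesis using that[of "(sqrt u, - sqrt w)"] h v by (simp add: P veronese_def)
  qed
qed

lemma norm_veronese: "(norm X)\<^sup>2 \<le> 2 * norm (veronese X)"
proof -
  obtain x y where X: "X = (x, y)" by (cases X)
  have "x\<^sup>2 \<le> norm (veronese X)" using norm_fst_le[of "x\<^sup>2" "(x * y, y\<^sup>2)"] by (simp add: X veronese_def)
  moreover have "y\<^sup>2 \<le> norm (veronese X)"
    using norm_snd_le[of "(x * y, y\<^sup>2)" "x\<^sup>2"] norm_snd_le[of "y\<^sup>2" "x * y"] by (simp add: X veronese_def)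
  ultimately show ?thesis by (simp add: X norm_prod_def)
qed

text \<open>The parametrization of the half-cone is an immersion away from the origin, and the cross product of its partial derivatives is a multiple
of the gradient of the cone; hence the Jacobian determinant of the contact map is a multiple of the determinant of the
three gradients, which vanishes at a point of multiplicity greater than 1.\<close>

lemma multiple_point_imp_degenerate:
  fixes G :: "R3 \<Rightarrow> real \<times> real"
  assumes W: "smooth_on W f" "smooth_on W g" "z + X \<in> W" "z - X \<in> W"
    and G: "smooth_on (ball 0 \<rho>) G" "veronese X \<in> ball 0 \<rho>" "G (veronese X) = 0"
    and rep: "\<And>Y. veronese Y \<in> ball 0 \<rho> \<Longrightarrow> contact_map f g z Y = G (veronese Y)"
    and mult: "cone_multiplicity G (veronese X) > 1"
  shows "even_part f z X = 0" "even_part g z X = 0"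
    "even_part_deriv f z u X * even_part_deriv g z v X = even_part_deriv f z v X * even_part_deriv g z u X"
proof -
  have r1: "even_part f z Y = (fst \<circ> G) (veronese Y)" and r2: "even_part g z Y = (snd \<circ> G) (veronese Y)"
    if "veronese Y \<in> ball 0 \<rho>" for Y using rep[OF that] by (simp_all add: contact_map_even_part prod_eq_iff)
  show "even_part f z X = 0" "even_part g z X = 0" using r1[OF G(2)] r2[OF G(2)] G(3) by simp_all
  have s: "smooth_on (ball 0 \<rho>) (fst \<circ> G)" "smooth_on (ball 0 \<rho>) (snd \<circ> G)"
    using smooth_on_fst[OF open_ball G(1)] smooth_on_snd[OF open_ball G(1)] by (simp_all add: o_def)
  let ?P = "veronese X" and ?g1 = "grad3 (fst \<circ> G) (veronese X)" and ?g2 = "grad3 (snd \<circ> G) (veronese X)"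
  have sa: "smooth_at ?P (fst \<circ> G)" "smooth_at ?P (snd \<circ> G)"
    using smooth_atI[OF open_ball G(2)] s by blast+
  obtain x y where X: "X = (x, y)" by (cases X)
  have c0: "cone_form ?P = 0" by (simp add: cone_form_def veronese_def power_mult_distrib)
  have gc: "grad3 cone_form ?P = (- y\<^sup>2, 2 * x * y, - x\<^sup>2)"
    by (simp add: grad3_def dd_cone veronese_def X)
  have "cross ?g1 ?g2 \<bullet> grad3 cone_form ?P = 0"
  proof (rule ccontr)
    assume "cross ?g1 ?g2 \<bullet> grad3 cone_form ?P \<noteq> 0"
    then have "local_multiplicity {fst \<circ> G, snd \<circ> G, cone_form} ?P \<le> 1"
      by (intro multiplicity_le_1_transversal sa smooth_at_cone c0) (simp_all add: G(3))
    then show False using mult by (simp add: cone_multiplicity_def cone_form_def)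
  qed
  then have det: "cross ?g1 ?g2 \<bullet> (- y\<^sup>2, 2 * x * y, - x\<^sup>2) = 0" unfolding gc .
  obtain a b c where g1: "?g1 = (a, b, c)" by (cases ?g1)
  obtain a' b' c' where g2: "?g2 = (a', b', c')" by (cases ?g2)
  have det': "(b * c' - c * b') * (- y\<^sup>2) + ((c * a' - a * c') * (2 * x * y) + (a * b' - b * a') * (- x\<^sup>2)) = 0"
    using det unfolding g1 g2 cross_def by simp
  obtain u1 u2 v1 v2 where uv: "u = (u1, u2)" "v = (v1, v2)" by (cases u; cases v)
  have e1: "even_part_deriv f z w X = ?g1 \<bullet> (2 * fst X * fst w, fst X * snd w + fst w * snd X, 2 * snd X * snd w)" for w
    by (rule even_part_deriv_veronese[OF W(1,3,4) s(1) G(2) r1])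
  have e2: "even_part_deriv g z w X = ?g2 \<bullet> (2 * fst X * fst w, fst X * snd w + fst w * snd X, 2 * snd X * snd w)" for w
    by (rule even_part_deriv_veronese[OF W(2,3,4) s(2) G(2) r2])
  show "even_part_deriv f z u X * even_part_deriv g z v X = even_part_deriv f z v X * even_part_deriv g z u X"
    unfolding e1 e2 g1 g2 unfolding uv X using det' by (simp, algebra)
qed

text \<open>Only the values of \<open>\<phi>\<close> on the half-cone are known. They determine the gradient at the vertex, because the half-cone
contains three independent rays; along each ray, comparing second order terms gives the derivative.\<close>

lemma vertex_gradient:
  fixes h :: "real \<times> real \<Rightarrow> real"
  assumes W: "open W" "smooth_on W h" "z \<in> W"
    and \<phi>: "smooth_on (ball 0 \<rho>) \<phi>" "\<rho> > 0"
    and rep: "\<And>Y. veronese Y \<in> ball 0 \<rho> \<Longrightarrow> even_part h z Y = \<phi> (veronese Y)"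
  shows "\<phi> 0 = 0"
    and "grad3 \<phi> 0 = (Dx (Dx h) z, 2 * Dx (Dy h) z, Dy (Dy h) z)"
proof -
  have v0: "veronese 0 = 0" by (simp add: veronese_def zero_prod_def)
  show \<phi>0: "\<phi> 0 = 0" using rep[of 0] \<phi>(2) by (simp add: v0 even_part_def)
  have b0: "0 \<in> ball (0 :: R3) \<rho>" using \<phi>(2) by simp
  have key: "dd (veronese X) \<phi> 0 = dd X (dd X h) z" for X
  proof -
    have l1: "((\<lambda>s. \<phi> (0 + s *\<^sub>R veronese X) / s) \<longlongrightarrow> dd (veronese X) \<phi> 0) (at 0)"
      using taylor_dirs_peano[OF open_ball \<phi>(1) b0, of 1 "veronese X"] \<phi>0 by simp
    have sq: "filterlim (\<lambda>t :: real. t\<^sup>2) (at 0) (at 0)"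
    proof -
      have "((\<lambda>t :: real. t\<^sup>2) \<longlongrightarrow> 0\<^sup>2) (at 0)" by (intro tendsto_intros)
      moreover have "\<forall>\<^sub>F t :: real in at 0. t\<^sup>2 \<noteq> 0" by (simp add: eventually_at_filter)
      ultimately show ?thesis by (simp add: filterlim_at)
    qed
    have l2: "((\<lambda>t. \<phi> (t\<^sup>2 *\<^sub>R veronese X) / t\<^sup>2) \<longlongrightarrow> dd (veronese X) \<phi> 0) (at 0)"
      using filterlim_compose[OF l1 sq] by simp
    have T: "((\<lambda>t. (h (z + t *\<^sub>R Y) - (h z + t * dd Y h z)) / t\<^sup>2) \<longlongrightarrow> dd Y (dd Y h) z / 2) (at 0)" for Y
      using taylor_dirs_peano[OF W, of 2 Y] by (simp add: numeral_eq_Suc)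
    have n1: "dd (- X) h z = - dd X h z"
      using linear_neg[OF dd_linear[OF smooth_on_differentiable[OF W(2,3)]]] .
    have n2: "dd (- X) (dd (- X) h) z = dd X (dd X h) z"
      using dirs_replicate_scale[OF W(1,2,3), of 2 "-1" X] by (simp add: numeral_eq_Suc)
    have "((\<lambda>t. (h (z + t *\<^sub>R X) - (h z + t * dd X h z)) / t\<^sup>2 + (h (z + t *\<^sub>R (- X)) - (h z + t * dd (- X) h z)) / t\<^sup>2)
      \<longlongrightarrow> dd X (dd X h) z / 2 + dd (- X) (dd (- X) h) z / 2) (at 0)"
      by (intro tendsto_add T)
    moreover have "(h (z + t *\<^sub>R X) - (h z + t * dd X h z)) / t\<^sup>2 + (h (z + t *\<^sub>R (- X)) - (h z + t * dd (- X) h z)) / t\<^sup>2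
        = even_part h z (t *\<^sub>R X) / t\<^sup>2" for t
      unfolding add_divide_distrib[symmetric] n1 by (simp add: even_part_def)
    ultimately have l3: "((\<lambda>t. even_part h z (t *\<^sub>R X) / t\<^sup>2) \<longlongrightarrow> dd X (dd X h) z) (at 0)" by (simp add: n2)
    have sc: "veronese (t *\<^sub>R X) = t\<^sup>2 *\<^sub>R veronese X" for t
      by (simp add: veronese_def power_mult_distrib power2_eq_square)
    have "((\<lambda>t :: real. t\<^sup>2 *\<^sub>R veronese X) \<longlongrightarrow> 0\<^sup>2 *\<^sub>R veronese X) (at 0)" by (intro tendsto_intros)
    then have "((\<lambda>t :: real. t\<^sup>2 *\<^sub>R veronese X) \<longlongrightarrow> 0) (at 0)" by simp
    from topological_tendstoD[OF this open_ball b0]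
    have "\<forall>\<^sub>F t in at 0. even_part h z (t *\<^sub>R X) / t\<^sup>2 = \<phi> (t\<^sup>2 *\<^sub>R veronese X) / t\<^sup>2"
      by eventually_elim (use rep sc in simp)
    from Lim_transform_eventually[OF l3 this] show ?thesis
      using tendsto_unique[OF trivial_limit_at l2] by blast
  qed
  have d: "\<phi> differentiable (at 0)" by (rule smooth_on_differentiable[OF \<phi>(1) b0])
  have 1: "dd (1, 0, 0) \<phi> 0 = Dx (Dx h) z" using key[of "(1, 0)"] by (simp add: veronese_def)
  have 2: "dd (0, 0, 1) \<phi> 0 = Dy (Dy h) z" using key[of "(0, 1)"] by (simp add: veronese_def)
  have 3: "dd (1, 1, 1) \<phi> 0 = dd (1, 1) (dd (1, 1) h) z" using key[of "(1, 1)"] by (simp add: veronese_def)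
  have "dd (1, 1, 1) \<phi> 0 = dd (1, 0, 0) \<phi> 0 + dd (0, 1, 0) \<phi> 0 + dd (0, 0, 1) \<phi> 0"
    using dd_grad3[OF d, of "(1, 1, 1)"] by (simp add: grad3_def)
  then have "dd (0, 1, 0) \<phi> 0 = 2 * Dx (Dy h) z"
    using 1 2 3 hess_expand[OF W, of 1 1 1 1] by simp
  then show "grad3 \<phi> 0 = (Dx (Dx h) z, 2 * Dx (Dy h) z, Dy (Dy h) z)"
    using 1 2 by (simp add: grad3_def)
qed

lemma vertex_multiplicity_parabolic:
  fixes G :: "R3 \<Rightarrow> real \<times> real"
  assumes W: "open W" "smooth_on W f" "smooth_on W g" "z \<in> W"
    and G: "smooth_on (ball 0 \<rho>) G" "\<rho> > 0"
    and rep: "\<And>Y. veronese Y \<in> ball 0 \<rho> \<Longrightarrow> contact_map f g z Y = G (veronese Y)"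
  shows "cone_multiplicity G 0 > minimal_vertex_multiplicity \<longleftrightarrow> z \<in> parabolic_set f g W"
proof -
  have r1: "even_part f z Y = (fst \<circ> G) (veronese Y)" and r2: "even_part g z Y = (snd \<circ> G) (veronese Y)"
    if "veronese Y \<in> ball 0 \<rho>" for Y using rep[OF that] by (simp_all add: contact_map_even_part prod_eq_iff)
  have s: "smooth_on (ball 0 \<rho>) (fst \<circ> G)" "smooth_on (ball 0 \<rho>) (snd \<circ> G)"
    using smooth_on_fst[OF open_ball G(1)] smooth_on_snd[OF open_ball G(1)] by (simp_all add: o_def)
  have b0: "0 \<in> ball (0 :: R3) \<rho>" using G(2) by simp
  have sa: "smooth_at 0 (fst \<circ> G)" "smooth_at 0 (snd \<circ> G)"
    using smooth_atI[OF open_ball b0] s by blast+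
  note v1 = vertex_gradient[OF W(1,2,4) s(1) G(2) r1] and v2 = vertex_gradient[OF W(1,3,4) s(2) G(2) r2]
  have gf: "grad3 (fst \<circ> G) 0 = (Dx (Dx f) z, 2 * Dx (Dy f) z, Dy (Dy f) z)"
    by (rule v1(2))
  have gg: "grad3 (snd \<circ> G) 0 = (Dx (Dx g) z, 2 * Dx (Dy g) z, Dy (Dy g) z)"
    by (rule v2(2))
  have cm: "cone_multiplicity G 0 = local_multiplicity {fst \<circ> G, snd \<circ> G, cone_form} 0"
    by (simp add: cone_multiplicity_def cone_form_def)
  have "cone_form (cross (grad3 (fst \<circ> G) 0) (grad3 (snd \<circ> G) 0)) = 0 \<longleftrightarrow> z \<in> parabolic_set f g W"
    unfolding gf gg parabolic_set_def dx_eq_dd dy_eq_dd cross_def cone_form_def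
    using W(4) by (simp add: power2_eq_square algebra_simps)
  moreover have "3 \<le> cone_multiplicity G 0" if "cone_form (cross (grad3 (fst \<circ> G) 0) (grad3 (snd \<circ> G) 0)) = 0"
    unfolding cm by (rule vertex_multiplicity_ge_3[OF sa v1(1) v2(1) that])
  moreover have "cone_multiplicity G 0 \<le> 2" if "cone_form (cross (grad3 (fst \<circ> G) 0) (grad3 (snd \<circ> G) 0)) \<noteq> 0"
    unfolding cm by (rule multiplicity_le_2_vertex[OF sa v1(1) v2(1) that])
  moreover have "(2 :: enat) < 3" by simp
  ultimately show ?thesis
    unfolding minimal_vertex_multiplicity_eq by (meson leD less_le_trans)
qed

lemma bifurcation_set_eq_parabolic_set:
  fixes f g :: "real \<times> real \<Rightarrow> real"
  assumes W: "open W" "0 \<in> W" "smooth_on W f" "smooth_on W g"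
    and f: "Dx (Dx f) 0 = 0" "Dy (Dy f) 0 = 0" "Dx (Dy f) 0 \<noteq> 0"
    and g: "Dx (Dy g) 0 = 0"
      "dirs [(1, 0), (1, 0), (1, 0), (1, 0)] g 0 \<noteq> 0" "dirs [(0, 1), (0, 1), (0, 1), (0, 1)] g 0 \<noteq> 0"
    and H: "represents_contact_maps f g H"
  shows "\<exists>\<epsilon>0>0. \<exists>\<delta>>0. \<forall>\<epsilon> z. 0 < \<epsilon> \<longrightarrow> \<epsilon> \<le> \<epsilon>0 \<longrightarrow> norm z < \<delta> \<longrightarrow>
    (z \<in> bifurcation_set H \<epsilon> \<longleftrightarrow> z \<in> parabolic_set f g W)"
proof -
  obtain \<delta>1 \<rho> where \<delta>1: "\<delta>1 > 0" and \<rho>: "\<rho> > 0" and rep0: "\<forall>z\<in>ball 0 \<delta>1. smooth_on (ball 0 \<rho>) (H z) \<and>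
        (\<forall>x y. (x\<^sup>2, x * y, y\<^sup>2) \<in> ball 0 \<rho> \<longrightarrow> contact_map f g z (x, y) = H z (x\<^sup>2, x * y, y\<^sup>2))"
    using H unfolding represents_contact_maps_def by (elim exE conjE)
  have sm: "smooth_on (ball 0 \<rho>) (H z)" if "norm z < \<delta>1" for z using rep0 that by simp
  have rep: "contact_map f g z Y = H z (veronese Y)" if "norm z < \<delta>1" "veronese Y \<in> ball 0 \<rho>" for z Y
    using rep0[rule_format, of z] that by (cases Y) (simp add: veronese_def)
  obtain \<eta> where \<eta>: "\<eta> > 0" and nt: "\<forall>z X. norm z < \<eta> \<longrightarrow> X \<noteq> 0 \<longrightarrow> norm X < \<eta> \<longrightarrow>
    even_part f z X = 0 \<longrightarrow> even_part g z X = 0 \<longrightarrow>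
    (\<exists>u v. even_part_deriv f z u X * even_part_deriv g z v X \<noteq> even_part_deriv f z v X * even_part_deriv g z u X)"
    using no_tangency[OF W f g] by (elim exE conjE)
  obtain d where d: "d > 0" "ball 0 d \<subseteq> W" using W(1,2) by (rule openE)
  define m where "m = min \<eta> (d / 2)"
  have m: "m > 0" "m \<le> \<eta>" "m \<le> d / 2" using \<eta> d by (auto simp: m_def)
  \<comment> \<open>By the bound on the parametrization of the half-cone, points at distance less than \<open>m\<^sup>2 / 2\<close> from the vertex come from \<open>norm X < m\<close>.\<close>
  define \<epsilon>0 where "\<epsilon>0 = min \<rho> (m\<^sup>2 / 2)"
  define \<delta> where "\<delta> = min \<delta>1 m"
  have "\<epsilon>0 > 0" "\<delta> > 0" using \<rho> m \<delta>1 by (auto simp: \<epsilon>0_def \<delta>_def)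
  moreover have "z \<in> bifurcation_set H \<epsilon> \<longleftrightarrow> z \<in> parabolic_set f g W"
    if \<epsilon>: "0 < \<epsilon>" "\<epsilon> \<le> \<epsilon>0" and z: "norm z < \<delta>" for \<epsilon> z
  proof -
    have z1: "norm z < \<delta>1" and z2: "norm z < m" using z by (auto simp: \<delta>_def)
    have zW: "z \<in> W" using z2 m d by (intro subsetD[OF d(2)]) simp
    have "\<not> (\<exists>P \<in> half_cone \<inter> ball 0 \<epsilon>. P \<noteq> 0 \<and> H z P = 0 \<and> cone_multiplicity (H z) P > 1)"
    proof (rule notI, elim bexE conjE)
      fix P assume P: "P \<in> half_cone \<inter> ball 0 \<epsilon>" "P \<noteq> 0" "H z P = 0" "cone_multiplicity (H z) P > 1"
      obtain X where X: "P = veronese X" using half_cone_veronese P(1) by blast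
      have "norm P < \<epsilon>0" using P(1) \<epsilon>(2) by simp
      then have PB: "P \<in> ball 0 \<rho>" and "norm P < m\<^sup>2 / 2" by (auto simp: \<epsilon>0_def)
      then have "(norm X)\<^sup>2 < m\<^sup>2" using norm_veronese[of X] by (simp add: X)
      then have Xm: "norm X < m" using m(1) by (rule_tac power_less_imp_less_base) auto
      have "X \<noteq> 0" using P(2) by (auto simp: X veronese_def zero_prod_def)
      have in_W: "z + X \<in> W" "z - X \<in> W"
        using norm_triangle_ineq[of z X] norm_triangle_ineq4[of z X] z2 Xm m by (auto intro!: subsetD[OF d(2)])
      note deg = multiple_point_imp_degenerate[OF W(3,4) in_W sm[OF z1] PB[unfolded X] P(3)[unfolded X] rep[OF z1] P(4)[unfolded X]]
      have "norm z < \<eta>" "norm X < \<eta>" using z2 Xm m by auto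
      then show False using nt \<open>X \<noteq> 0\<close> deg by blast
    qed
    then have "z \<in> bifurcation_set H \<epsilon> \<longleftrightarrow> cone_multiplicity (H z) 0 > minimal_vertex_multiplicity"
      unfolding bifurcation_set_def by blast
    also have "\<dots> \<longleftrightarrow> z \<in> parabolic_set f g W"
      by (rule vertex_multiplicity_parabolic[OF W(1,3,4) zW sm[OF z1] \<rho> rep[OF z1]])
    finally show ?thesis .
  qed
  ultimately show ?thesis by blast
qed

section \<open>Branches of a node\<close>

text \<open>A function that is proportional to the parameter along the curve provides the continuous inverse and excludes zero velocity.\<close>

lemma smooth_arc_of_coordinate:
  fixes K :: "real \<times> real \<Rightarrow> real"
  assumes s: "smooth_on {-1<..<1} \<gamma>" and K: "open U" "smooth_on U K"
    and im: "\<And>t. t \<in> {-1<..<1} \<Longrightarrow> \<gamma> t \<in> U" and coord: "\<And>t. t \<in> {-1<..<1} \<Longrightarrow> K (\<gamma> t) = c * t" and c: "c \<noteq> 0"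
  shows "smooth_arc \<gamma>"
  unfolding smooth_arc_def
proof (intro conjI ballI s)
  let ?I = "{-1<..<1 :: real}"
  fix t assume t: "t \<in> ?I"
  show "vector_derivative \<gamma> (at t) \<noteq> 0"
  proof
    assume 0: "vector_derivative \<gamma> (at t) = 0"
    have "\<gamma> differentiable (at t)" by (rule smooth_on_differentiable[OF s t])
    then have "(\<gamma> has_derivative (\<lambda>s. s *\<^sub>R vector_derivative \<gamma> (at t))) (at t)"
      using vector_derivative_works unfolding has_vector_derivative_def by blast
    then have d0: "(\<gamma> has_derivative (\<lambda>s. 0)) (at t)" unfolding 0 by simp
    have dK: "(K has_derivative (\<lambda>v. dd v K (\<gamma> t))) (at (\<gamma> t))" by (rule smooth_on_has_derivative[OF K(2) im[OF t]])
    have "dd 0 K (\<gamma> t) = 0" by (rule linear_0[OF dd_linear[OF smooth_on_differentiable[OF K(2) im[OF t]]]])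
    then have "((\<lambda>t. K (\<gamma> t)) has_derivative (\<lambda>s. 0)) (at t)"
      using diff_chain_at[OF d0 dK] by (simp add: o_def)
    then have "((\<lambda>t. c * t) has_derivative (\<lambda>s. 0)) (at t)"
      by (rule has_derivative_transform_within_open[OF _ open_greaterThanLessThan t]) (rule coord)
    moreover have "((\<lambda>t. c * t) has_derivative (\<lambda>s. c * s)) (at t)"
      by (auto intro!: derivative_eq_intros)
    ultimately have "(\<lambda>s. 0) = (\<lambda>s. c * s)" by (rule has_derivative_unique)
    then show False using c by (metis mult.right_neutral)
  qed
next
  let ?I = "{-1<..<1 :: real}"
  have "homeomorphism ?I (\<gamma> ` ?I) \<gamma> (\<lambda>z. K z / c)"
  proof (rule homeomorphismI)
    show "continuous_on ?I \<gamma>" by (rule smooth_on_continuous[OF s])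
    have "continuous_on (\<gamma> ` ?I) K"
      by (rule continuous_on_subset[OF smooth_on_continuous[OF K(2)]]) (use im in auto)
    then show "continuous_on (\<gamma> ` ?I) (\<lambda>z. K z / c)" using c by (intro continuous_intros) auto
    show "(\<lambda>z. K z / c) ` \<gamma> ` ?I \<subseteq> ?I" using coord c by auto
  qed (use coord c in auto)
  then show "\<exists>h. homeomorphism ?I (\<gamma> ` ?I) \<gamma> h" by blast
qed

text \<open>The derivative of the inverse is given by Cramer's rule as a smooth function of the inverse itself; bootstrapping yields smoothness.\<close>

lemma smooth_local_inverse:
  fixes G1 G2 :: "real \<times> real \<Rightarrow> real"
  assumes V: "open V" "x0 \<in> V" "smooth_on V G1" "smooth_on V G2"
    and det: "Dx G1 x0 * Dy G2 x0 - Dy G1 x0 * Dx G2 x0 \<noteq> 0"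
  obtains U' V' \<Psi> where "open U'" "U' \<subseteq> V" "x0 \<in> U'" "open V'" "(G1 x0, G2 x0) \<in> V'"
    "homeomorphism U' V' (\<lambda>z. (G1 z, G2 z)) \<Psi>" "smooth_on V' \<Psi>"
proof -
  define F where "F z = (G1 z, G2 z)" for z
  define D where "D w v = (dd v G1 w, dd v G2 w)" for w v
  have sF: "smooth_on V F" unfolding F_def[abs_def] by (rule smooth_on_Pair[OF V(1,3,4)])
  have DF: "(F has_derivative D w) (at w)" if "w \<in> V" for w
    unfolding F_def[abs_def] D_def[abs_def]
    by (intro has_derivative_Pair smooth_on_has_derivative[OF V(3) that] smooth_on_has_derivative[OF V(4) that])
  have bD: "bounded_linear (D w)" if "w \<in> V" for w by (rule has_derivative_bounded_linear[OF DF[OF that]])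
  define f' where "f' w = Blinfun (D w)" for w
  have f': "blinfun_apply (f' w) = D w" if "w \<in> V" for w
    unfolding f'_def by (rule bounded_linear_Blinfun_apply[OF bD[OF that]])
  have lin: "dd v h w = fst v * Dx h w + snd v * Dy h w"
    if "smooth_on V h" "w \<in> V" for h :: "real \<times> real \<Rightarrow> real" and v w
    using dd_linear_expand[OF smooth_on_differentiable[OF that], of v] by (cases v) (simp add: Basis_prod_def)
  define \<Delta> where "\<Delta> w = Dx G1 w * Dy G2 w - Dy G1 w * Dx G2 w" for w
  have inj: "v = 0" if "D w v = 0" "w \<in> V" "\<Delta> w \<noteq> 0" for w v
  proof -
    have e: "fst v * Dx G1 w + snd v * Dy G1 w = 0" "fst v * Dx G2 w + snd v * Dy G2 w = 0"
      using that lin[OF V(3), of w v] lin[OF V(4), of w v] by (simp_all add: D_def zero_prod_def)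
    then have "fst v * \<Delta> w = 0" "snd v * \<Delta> w = 0" unfolding \<Delta>_def by algebra+
    then show ?thesis using that(3) by (simp add: prod_eq_iff)
  qed
  obtain B where B: "linear B" "B \<circ> D x0 = id"
    using linear_injective_left_inverse[of "D x0"] bounded_linear.linear[OF bD[OF V(2)]] inj[OF _ V(2)] det
    by (auto simp: linear_injective_0 \<Delta>_def)
  have bB: "bounded_linear B" using B(1) by (simp add: linear_conv_bounded_linear)
  have inv: "Blinfun B o\<^sub>L f' x0 = id_blinfun"
  proof (rule blinfun_eqI)
    fix i show "blinfun_apply (Blinfun B o\<^sub>L f' x0) i = blinfun_apply id_blinfun i"
      using fun_cong[OF B(2), of i] by (simp add: f'[OF V(2)] bounded_linear_Blinfun_apply[OF bB])
  qed
  have cont: "continuous_on V f'"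
  proof (rule continuous_on_blinfun_componentwise)
    fix i :: "real \<times> real" assume "i \<in> Basis"
    have "continuous_on V (\<lambda>w. D w i)" unfolding D_def
      by (intro continuous_on_Pair smooth_on_continuous smooth_on_dd V)
    then show "continuous_on V (\<lambda>w. blinfun_apply (f' w) i)"
      using continuous_on_cong[OF refl, of V "\<lambda>w. blinfun_apply (f' w) i" "\<lambda>w. D w i"] f' by simp
  qed
  have der: "(F has_derivative blinfun_apply (f' w)) (at w)" if "w \<in> V" for w
    using DF[OF that] by (simp add: f'[OF that])
  show ?thesis
  proof (rule inverse_function_theorem[OF V(1) der cont V(2) inv])
    fix U' V' \<Psi> g'
    assume U': "open U'" "U' \<subseteq> V" "x0 \<in> U'" and V': "open V'" "F x0 \<in> V'" and hom: "homeomorphism U' V' F \<Psi>"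
      and dP: "\<And>y. y \<in> V' \<Longrightarrow> (\<Psi> has_derivative g' y) (at y)"
      and g': "\<And>y. y \<in> V' \<Longrightarrow> g' y = inv (blinfun_apply (f' (\<Psi> y)))"
      and bij: "\<And>y. y \<in> V' \<Longrightarrow> bij (blinfun_apply (f' (\<Psi> y)))"
    have PU: "\<Psi> y \<in> U'" if "y \<in> V'" for y using hom that by (auto simp: homeomorphism_def)
    have FP: "F (\<Psi> y) = y" if "y \<in> V'" for y using hom that by (auto simp: homeomorphism_def)
    have \<Delta>0: "\<Delta> (\<Psi> y) \<noteq> 0" if y: "y \<in> V'" for y
    proof
      let ?w = "\<Psi> y"
      assume 0: "\<Delta> ?w = 0"
      have w: "?w \<in> V" using PU[OF y] U'(2) by blast
      have i: "inj (D ?w)" using bij[OF y] f'[OF w] by (simp add: bij_is_inj)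
      have k: "D ?w v = D ?w 0 \<Longrightarrow> v = 0" for v using i by (auto dest: injD)
      have D0: "D ?w 0 = 0" using linear_0[OF bounded_linear.linear[OF bD[OF w]]] .
      have Dv: "D ?w v = (fst v * Dx G1 ?w + snd v * Dy G1 ?w, fst v * Dx G2 ?w + snd v * Dy G2 ?w)" for v
        using lin[OF V(3) w, of v] lin[OF V(4) w, of v] by (simp add: D_def)
      have "D ?w (Dy G1 ?w, - Dx G1 ?w) = 0" "D ?w (Dy G2 ?w, - Dx G2 ?w) = 0"
        using 0 unfolding Dv \<Delta>_def by (simp_all add: zero_prod_def algebra_simps)
      then have "Dy G1 ?w = 0" "Dx G1 ?w = 0"
        using k[of "(Dy G1 ?w, - Dx G1 ?w)"] D0 by (simp_all add: zero_prod_def)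
      moreover have "Dy G2 ?w = 0" "Dx G2 ?w = 0"
        using k[of "(Dy G2 ?w, - Dx G2 ?w)"] D0 \<open>D ?w (Dy G2 ?w, - Dx G2 ?w) = 0\<close>
        by (simp_all add: zero_prod_def)
      ultimately have "D ?w (1, 0) = 0" unfolding Dv by (simp add: zero_prod_def)
      then show False using k[of "(1, 0)"] D0 by (simp add: zero_prod_def)
    qed
    define Q where "Q v w = ((fst v * Dy G2 w - snd v * Dy G1 w) / \<Delta> w,
        (snd v * Dx G1 w - fst v * Dx G2 w) / \<Delta> w)" for v w
    let ?U = "\<Psi> ` V'"
    have UU: "?U = U'" using hom by (auto simp: homeomorphism_def)
    have dQ: "Q v (\<Psi> y) = dd v \<Psi> y" if y: "y \<in> V'" for v y
    proof -
      let ?w = "\<Psi> y"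
      have w: "?w \<in> V" using PU[OF y] U'(2) by blast
      have "D ?w (Q v ?w) = v"
        using \<Delta>0[OF y] unfolding D_def lin[OF V(3) w, of "Q v ?w"] lin[OF V(4) w, of "Q v ?w"]
        unfolding Q_def \<Delta>_def by (simp add: prod_eq_iff divide_simps) (simp add: algebra_simps)
      moreover have "inj (D ?w)" using bij[OF y] f'[OF w] by (simp add: bij_is_inj)
      ultimately have "inv (D ?w) v = Q v ?w" by (metis inv_f_f)
      moreover have "dd v \<Psi> y = inv (D ?w) v" using dd_unique[OF dP[OF y]] g'[OF y] f'[OF w] by simp
      ultimately show ?thesis by simp
    qed
    have sQ: "smooth_on U' (Q v)" for v
    proof -
      have s: "smooth_on U' (dd u G1)" "smooth_on U' (dd u G2)" for u
        using smooth_on_subset[OF smooth_on_dd[OF V(1,3)] U'(2)] smooth_on_subset[OF smooth_on_dd[OF V(1,4)] U'(2)] by blast+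
      have "\<Delta> w \<noteq> 0" if "w \<in> U'" for w using that \<Delta>0 UU by auto
      then show ?thesis unfolding Q_def[abs_def] unfolding \<Delta>_def
        by (intro smooth_on_Pair smooth_on_divide smooth_on_diff smooth_on_mult smooth_on_const s U'(1)) auto
    qed
    have "smooth_on V' \<Psi>"
    proof (rule Ck_on_bootstrap[OF V'(1)])
      show "continuous_on V' \<Psi>" using hom by (simp add: homeomorphism_def)
      show "\<Psi> differentiable at y" if "y \<in> V'" for y using dP[OF that] by (rule differentiableI)
      show "Ck_on k V' (dd i \<Psi>)" if "i \<in> Basis" "Ck_on k V' \<Psi>" for k i
      proof (rule Ck_on_cong[OF V'(1) dQ])
        show "Ck_on k V' (\<lambda>y. Q i (\<Psi> y))"
          by (rule Ck_on_compose[OF V'(1) U'(1) _ that(2)]) (use sQ UU in \<open>auto simp: smooth_on_def\<close>)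
      qed
    qed
    then show thesis using that[OF U' V'(1) _ _ ] V'(2) hom unfolding F_def[abs_def] by blast
  qed
qed

text \<open>In the local coordinates \<open>(G1, G2)\<close> the two zero sets are the coordinate axes.\<close>

lemma node_branches:
  fixes G1 G2 :: "real \<times> real \<Rightarrow> real"
  assumes V: "open V" "0 \<in> V" "smooth_on V G1" "smooth_on V G2" and z: "G1 0 = 0" "G2 0 = 0"
    and det: "Dx G1 0 * Dy G2 0 - Dy G1 0 * Dx G2 0 \<noteq> 0"
  obtains \<gamma>1 \<gamma>2 c U where "c > 0" "open U" "0 \<in> U" "U \<subseteq> V" "smooth_arc \<gamma>1" "smooth_arc \<gamma>2" "\<gamma>1 0 = 0" "\<gamma>2 0 = 0"
    "\<forall>t\<in>{-1<..<1}. \<gamma>1 t \<in> U \<and> G1 (\<gamma>1 t) = 0 \<and> G2 (\<gamma>1 t) = c * t"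
    "\<forall>t\<in>{-1<..<1}. \<gamma>2 t \<in> U \<and> G1 (\<gamma>2 t) = c * t \<and> G2 (\<gamma>2 t) = 0"
    "{z \<in> U. G1 z = 0} = \<gamma>1 ` {-1<..<1}" "{z \<in> U. G2 z = 0} = \<gamma>2 ` {-1<..<1}"
proof -
  obtain U' V' \<Psi> where U': "open U'" "U' \<subseteq> V" "0 \<in> U'" and V': "open V'" "(G1 0, G2 0) \<in> V'"
    and hom: "homeomorphism U' V' (\<lambda>z. (G1 z, G2 z)) \<Psi>" and sP: "smooth_on V' \<Psi>"
    by (rule smooth_local_inverse[OF V det])
  have PU: "\<Psi> y \<in> U'" and FP0: "(G1 (\<Psi> y), G2 (\<Psi> y)) = y" if "y \<in> V'" for y
    using hom that unfolding homeomorphism_def by blast+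
  have FP: "G1 (\<Psi> y) = fst y" "G2 (\<Psi> y) = snd y" if "y \<in> V'" for y
    using arg_cong[OF FP0[OF that], of fst] arg_cong[OF FP0[OF that], of snd] by simp_all
  have PF: "\<Psi> (G1 z, G2 z) = z" if "z \<in> U'" for z using hom that unfolding homeomorphism_def by blast
  have "0 \<in> V'" using V'(2) z by (simp add: zero_prod_def)
  then obtain r where r: "r > 0" "ball 0 r \<subseteq> V'" using V'(1) openE by blast
  define c where "c = r / 2"
  have c: "c > 0" using r by (simp add: c_def)
  have box: "(a, b) \<in> V'" if "\<bar>a\<bar> < c" "\<bar>b\<bar> < c" for a b
  proof -
    have "norm (a, b) < r" using norm_Pair_le[of a b] that by (simp add: c_def)
    then show ?thesis using r(2) by (auto simp: subset_iff)
  qed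
  \<comment> \<open>The factor \<open>c\<close> is half the radius of a ball in the image, so that the square of half-width \<open>c\<close> lies in it.\<close>
  define \<gamma>1 where "\<gamma>1 t = \<Psi> (0, c * t)" for t
  define \<gamma>2 where "\<gamma>2 t = \<Psi> (c * t, 0)" for t
  have ct: "\<bar>c * t\<bar> < c" if "t \<in> {-1<..<1}" for t
  proof -
    have "\<bar>t\<bar> < 1" using that by (auto simp: abs_less_iff)
    then show ?thesis using c by (simp add: abs_mult)
  qed
  define S where "S = {-c<..<c} \<times> {-c<..<c}"
  have oS: "open S" unfolding S_def by (intro open_Times open_greaterThanLessThan)
  have cF: "continuous_on U' (\<lambda>z. (G1 z, G2 z))" using hom by (simp add: homeomorphism_def)
  define U where "U = U' \<inter> (\<lambda>z. (G1 z, G2 z)) -` S"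
  have U: "open U" "U \<subseteq> U'" using continuous_open_preimage[OF cF U'(1) oS] by (auto simp: U_def)
  have U0: "0 \<in> U" using U'(3) z c by (simp add: U_def S_def)
  have sV: "smooth_on U' G1" "smooth_on U' G2" using smooth_on_subset V U'(2) by blast+
  have g1: "\<gamma>1 t \<in> U" "G1 (\<gamma>1 t) = 0" "G2 (\<gamma>1 t) = c * t" if t: "t \<in> {-1<..<1}" for t
    using PU[OF box[of 0 "c * t"]] FP[OF box[of 0 "c * t"]] ct[OF t] c by (auto simp: \<gamma>1_def U_def S_def abs_less_iff)
  have g2: "\<gamma>2 t \<in> U" "G1 (\<gamma>2 t) = c * t" "G2 (\<gamma>2 t) = 0" if t: "t \<in> {-1<..<1}" for t
    using PU[OF box[of "c * t" 0]] FP[OF box[of "c * t" 0]] ct[OF t] c by (auto simp: \<gamma>2_def U_def S_def abs_less_iff)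
  have b: "bounded_linear (\<lambda>t :: real. (0 :: real, c * t))" "bounded_linear (\<lambda>t :: real. (c * t, 0 :: real))"
    by (intro bounded_linear_Pair bounded_linear_zero bounded_linear_mult_right)+
  have i: "open {-1<..<1::real}" by simp
  have s1: "smooth_on {-1<..<1} \<gamma>1" unfolding \<gamma>1_def[abs_def]
    by (rule smooth_on_compose[OF i V'(1) _ smooth_on_linear[OF b(1)] sP]) (use box ct c in auto)
  have s2: "smooth_on {-1<..<1} \<gamma>2" unfolding \<gamma>2_def[abs_def]
    by (rule smooth_on_compose[OF i V'(1) _ smooth_on_linear[OF b(2)] sP]) (use box ct c in auto)
  have a1: "smooth_arc \<gamma>1"
    by (rule smooth_arc_of_coordinate[OF s1 U'(1) sV(2)]) (use g1 U(2) c in auto)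
  have a2: "smooth_arc \<gamma>2"
    by (rule smooth_arc_of_coordinate[OF s2 U'(1) sV(1)]) (use g2 U(2) c in auto)
  have 0: "\<gamma>1 0 = 0" "\<gamma>2 0 = 0" using PF[OF U'(3)] z by (simp_all add: \<gamma>1_def \<gamma>2_def)
  have tt: "x / c \<in> {-1<..<1}" if "\<bar>x\<bar> < c" for x using that c by (auto simp: field_simps abs_less_iff)
  have z1: "{z \<in> U. G1 z = 0} = \<gamma>1 ` {-1<..<1}"
  proof (intro equalityI subsetI)
    fix w assume "w \<in> {z \<in> U. G1 z = 0}"
    then have w: "w \<in> U'" "G1 w = 0" "\<bar>G2 w\<bar> < c" by (auto simp: U_def S_def)
    have "w = \<gamma>1 (G2 w / c)" using PF[OF w(1)] w(2) c by (simp add: \<gamma>1_def)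
    then show "w \<in> \<gamma>1 ` {-1<..<1}" using tt[OF w(3)] by (rule image_eqI)
  qed (use g1 in auto)
  have z2: "{z \<in> U. G2 z = 0} = \<gamma>2 ` {-1<..<1}"
  proof (intro equalityI subsetI)
    fix w assume "w \<in> {z \<in> U. G2 z = 0}"
    then have w: "w \<in> U'" "G2 w = 0" "\<bar>G1 w\<bar> < c" by (auto simp: U_def S_def)
    have "w = \<gamma>2 (G1 w / c)" using PF[OF w(1)] w(2) c by (simp add: \<gamma>2_def)
    then show "w \<in> \<gamma>2 ` {-1<..<1}" using tt[OF w(3)] by (rule image_eqI)
  qed (use g2 in auto)
  show ?thesis
    by (rule that[OF c U(1) U0 _ a1 a2 0 _ _ z1 z2]) (use g1 g2 U(2) U'(2) in auto)
qed

section \<open>Signs near the inflexion point\<close>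

text \<open>The pencil parameter \<open>\<lambda> = g''(k,e) / f''(k,e)\<close> tends to 0 at the inflexion point, so every derivative of \<open>g - \<lambda> f\<close> is close to the
corresponding derivative of \<open>g\<close>; the nondegeneracy conditions of the normal form persist near the inflexion point.\<close>

lemma branch_sign:
  fixes f g :: "real \<times> real \<Rightarrow> real"
  assumes W: "open W" "0 \<in> W" "smooth_on W f" "smooth_on W g"
    and ek: "(e \<longlongrightarrow> e0) (nhds 0)" "(k \<longlongrightarrow> k0) (nhds 0)"
    and f: "dd k0 (dd e0 f) 0 \<noteq> 0" and g: "dd k0 (dd e0 g) 0 = 0"
    and quartic: "dirs [e0, e0, e0, e0] g 0 \<noteq> 0"
    and cubic: "dirs [e0, e0, e0] g 0 \<noteq> 0 \<or> dirs [k0, e0, e0] g 0 \<noteq> 0"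
  shows "\<forall>\<^sub>F z in nhds 0. dd (e z) (dd (e z) f) z = 0 \<longrightarrow> dd (k z) (dd (k z) f) z = 0 \<longrightarrow>
    dd (e z) (dd (e z) g) z = 0 \<longrightarrow> dd (k z) (dd (k z) g) z \<noteq> 0 \<longrightarrow>
    ordinary_parabolic_point f g W z \<and>
    parabolic_sign f g W z = sgn (dd (k z) (dd (k z) g) z) * sgn (dirs [e0, e0, e0, e0] g 0)"
proof -
  let ?N = "nhds (0 :: real \<times> real)"
  have id: "((\<lambda>z. z) \<longlongrightarrow> 0) ?N" by (rule filterlim_ident)
  have lim: "((\<lambda>z. dirs (map (\<lambda>v. v z) vs) h z) \<longlongrightarrow> dirs ls h 0) ?N"
    if "smooth_on W h" "list_all2 (\<lambda>v l. (v \<longlongrightarrow> l) ?N) vs ls" for h :: "real \<times> real \<Rightarrow> real" and vs ls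
    using tendsto_dirs[OF W(1,2) id that] .
  define lam where "lam z = dd (k z) (dd (e z) g) z / dd (k z) (dd (e z) f) z" for z
  have lke: "((\<lambda>z. dd (k z) (dd (e z) h) z) \<longlongrightarrow> dd k0 (dd e0 h) 0) ?N" if "smooth_on W h" for h :: "real \<times> real \<Rightarrow> real"
    using lim[OF that, of "[k, e]" "[k0, e0]"] ek by simp
  have llam: "(lam \<longlongrightarrow> 0) ?N"
    using tendsto_divide[OF lke[OF W(4)] lke[OF W(3)] f] g unfolding lam_def[abs_def] by simp
  have lh: "((\<lambda>z. dirs (map (\<lambda>v. v z) vs) g z - lam z * dirs (map (\<lambda>v. v z) vs) f z) \<longlongrightarrow> dirs ls g 0) ?N"
    if "list_all2 (\<lambda>v l. (v \<longlongrightarrow> l) ?N) vs ls" for vs ls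
    using tendsto_diff[OF lim[OF W(4) that] tendsto_mult[OF llam lim[OF W(3) that]]] by simp
  define q where "q = dirs [e0, e0, e0, e0] g 0"
  have "\<forall>\<^sub>F z in ?N. z \<in> W" using W(1,2) by (rule eventually_nhds_in_open)
  moreover have "\<forall>\<^sub>F z in ?N. dd (k z) (dd (e z) f) z \<noteq> 0" by (rule tendsto_imp_eventually_ne[OF lke[OF W(3)] f])
  moreover have "\<forall>\<^sub>F z in ?N. \<bar>(dirs [e z, e z, e z, e z] g z - lam z * dirs [e z, e z, e z, e z] f z) - q\<bar> < \<bar>q\<bar>"
    using tendstoD[OF lh[of "[e, e, e, e]" "[e0, e0, e0, e0]"], of "\<bar>q\<bar>"] ek quartic by (simp add: q_def dist_real_def)
  moreover have "\<forall>\<^sub>F z in ?N. dirs [e z, e z, e z] g z - lam z * dirs [e z, e z, e z] f z \<noteq> 0 \<or>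
      dirs [k z, e z, e z] g z - lam z * dirs [k z, e z, e z] f z \<noteq> 0"
    using cubic
  proof
    assume "dirs [e0, e0, e0] g 0 \<noteq> 0"
    from tendsto_imp_eventually_ne[OF lh[of "[e, e, e]"] this] show ?thesis
      using ek by (auto elim: eventually_mono)
  next
    assume "dirs [k0, e0, e0] g 0 \<noteq> 0"
    from tendsto_imp_eventually_ne[OF lh[of "[k, e, e]"] this] show ?thesis
      using ek by (auto elim: eventually_mono)
  qed
  ultimately show ?thesis
  proof eventually_elim
    case (elim z)
    show ?case
    proof (intro impI)
      assume h: "dd (e z) (dd (e z) f) z = 0" "dd (k z) (dd (k z) f) z = 0"
        "dd (e z) (dd (e z) g) z = 0" "dd (k z) (dd (k z) g) z \<noteq> 0"
      have dh: "dirs vs (\<lambda>w. g w - lam z * f w) z = dirs vs g z - lam z * dirs vs f z" for vs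
        by (rule dirs_diff_cmult[OF W(1,3,4) elim(1)])
      have "dirs [e z, e z, e z, e z] (\<lambda>w. g w - lam z * f w) z \<noteq> 0"
        and s: "sgn (dirs [e z, e z, e z, e z] (\<lambda>w. g w - lam z * f w) z) = sgn q"
        using elim(3) unfolding dh by (auto simp: sgn_if)
      then interpret parabolic_frame f g W z "e z" "k z" "lam z" "\<lambda>w. g w - lam z * f w"
        using W elim(1,2) h by unfold_locales (simp_all add: lam_def)
      have "dirs [e z, e z, e z] (\<lambda>w. g w - lam z * f w) z \<noteq> 0 \<or> dirs [k z, e z, e z] (\<lambda>w. g w - lam z * f w) z \<noteq> 0"
        using elim(4) unfolding dh .
      from ordinary_parabolic_point_and_sign[OF this]
      show "ordinary_parabolic_point f g W z \<and>
        parabolic_sign f g W z = sgn (dd (k z) (dd (k z) g) z) * sgn (dirs [e0, e0, e0, e0] g 0)"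
        by (simp only: sgn_mult s q_def simp_thms)
    qed
  qed
qed

theorem proposition3p6:
  fixes f g :: "real \<times> real \<Rightarrow> real"
    and W :: "(real \<times> real) set"
    and f11 :: real
    and H :: "real \<times> real \<Rightarrow> real \<times> real \<times> real \<Rightarrow> real \<times> real"
  assumes "open W" and "0 \<in> W" and "smooth_on W f" and "smooth_on W g"
    and "two_jet_eq f 0 f11 0" and "f11 \<noteq> 0" and "two_jet_eq g 0 0 0"
    and "(taylor_coeff g 2 2)\<^sup>2 - 4 * taylor_coeff g 4 0 * taylor_coeff g 0 4 \<noteq> 0"
    and "9 * taylor_coeff g 3 0 * taylor_coeff g 0 3 - taylor_coeff g 1 2 * taylor_coeff g 2 1 \<noteq> 0"
    and "taylor_coeff g 4 0 \<noteq> 0" and "taylor_coeff g 0 4 \<noteq> 0"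
    and "represents_contact_maps f g H"
  shows "\<exists>\<gamma>1 \<gamma>2. smooth_arc \<gamma>1 \<and> smooth_arc \<gamma>2 \<and> \<gamma>1 0 = 0 \<and> \<gamma>2 0 = 0 \<and>
      \<gamma>1 ` {-1<..<1} \<inter> \<gamma>2 ` {-1<..<1} = {0} \<and>
      (\<exists>\<epsilon>0>0. \<forall>\<epsilon>. 0 < \<epsilon> \<and> \<epsilon> \<le> \<epsilon>0 \<longrightarrow>
         (\<exists>D. open D \<and> 0 \<in> D \<and>
            bifurcation_set H \<epsilon> \<inter> D = parabolic_set f g W \<inter> D \<and>
            parabolic_set f g W \<inter> D = (\<gamma>1 ` {-1<..<1} \<union> \<gamma>2 ` {-1<..<1}) \<inter> D)) \<and>
      (\<forall>\<gamma>\<in>{\<gamma>1, \<gamma>2}. \<exists>\<sigma>\<in>{-1, 1}.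
         (\<forall>t\<in>{-1<..<0}. ordinary_parabolic_point f g W (\<gamma> t) \<and> parabolic_sign f g W (\<gamma> t) = -\<sigma>) \<and>
         (\<forall>t\<in>{0<..<1}. ordinary_parabolic_point f g W (\<gamma> t) \<and> parabolic_sign f g W (\<gamma> t) = \<sigma>))"
proof -
  note W = assms(1-4)
  note jf = assms(5)[unfolded two_jet_eq_dirs] and jg = assms(7)[unfolded two_jet_eq_dirs]
  define a where "a = Dx (Dx f)"
  define b where "b = Dx (Dy f)"
  define c where "c = Dy (Dy f)"
  define a' where "a' = Dx (Dx g)"
  define b' where "b' = Dx (Dy g)"
  define c' where "c' = Dy (Dy g)"
  have sm: "smooth_on W a" "smooth_on W b" "smooth_on W c" "smooth_on W a'" "smooth_on W b'" "smooth_on W c'"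
    unfolding a_def b_def c_def a'_def b'_def c'_def by (intro smooth_on_dd W)+
  have at0: "a 0 = 0" "b 0 = f11" "c 0 = 0" "a' 0 = 0" "b' 0 = 0" "c' 0 = 0"
    using jf jg by (simp_all add: a_def b_def c_def a'_def b'_def c'_def)
  \<comment> \<open>The sign of \<open>R\<close> keeps \<open>s = b + R\<close> away from 0. The vectors \<open>(s, -a)\<close> and \<open>(-c, s)\<close> are then roots of the form \<open>a x\<^sup>2 + 2 b x y + c y\<^sup>2\<close>, close to the axes, and they depend smoothly on the point.\<close>
  define V0 where "V0 = {z \<in> W. b z * b z - a z * c z > 0 \<and> b z * f11 > 0}"
  define R where "R z = sgn f11 * sqrt (b z * b z - a z * c z)" for z
  define s where "s z = b z + R z" for z
  have V0: "open V0" "0 \<in> V0" "V0 \<subseteq> W"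
  proof -
    have "continuous_on W (\<lambda>z. (b z * b z - a z * c z, b z * f11))"
      by (intro continuous_intros smooth_on_continuous sm)
    moreover have "open ({0<..} \<times> {0<..} :: (real \<times> real) set)" by (intro open_Times) auto
    ultimately have "open (W \<inter> (\<lambda>z. (b z * b z - a z * c z, b z * f11)) -` ({0<..} \<times> {0<..}))"
      by (rule continuous_open_preimage[OF _ W(1)])
    also have "\<dots> = V0" by (auto simp: V0_def)
    finally show "open V0" .
    show "0 \<in> V0" using W(2) assms(6) not_real_square_gt_zero[of f11] by (simp add: V0_def at0 del: not_real_square_gt_zero)
    show "V0 \<subseteq> W" by (auto simp: V0_def)
  qed
  have sV: "smooth_on V0 a" "smooth_on V0 b" "smooth_on V0 c" "smooth_on V0 a'" "smooth_on V0 b'" "smooth_on V0 c'"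
    using sm smooth_on_subset[OF _ V0(3)] by blast+
  have sR: "smooth_on V0 R" unfolding R_def[abs_def]
    by (intro smooth_on_mult smooth_on_const smooth_on_sqrt smooth_on_diff sV V0(1)) (auto simp: V0_def)
  have ss: "smooth_on V0 s" unfolding s_def[abs_def] by (intro smooth_on_add sV sR V0(1))
  have R2: "R z * R z = b z * b z - a z * c z" if "z \<in> V0" for z
  proof -
    have "R z * R z = (sgn f11 * sgn f11) * (sqrt (b z * b z - a z * c z) * sqrt (b z * b z - a z * c z))"
      by (simp add: R_def mult_ac)
    also have "sgn f11 * sgn f11 = 1" using assms(6) by (simp add: sgn_if)
    also have "sqrt (b z * b z - a z * c z) * sqrt (b z * b z - a z * c z) = b z * b z - a z * c z"
      using that by (simp add: V0_def)
    finally show ?thesis by simp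
  qed
  have s_ne: "s z \<noteq> 0" if "z \<in> V0" for z
  proof -
    have "s z * f11 = b z * f11 + (sgn f11 * f11) * sqrt (b z * b z - a z * c z)"
      by (simp add: s_def R_def algebra_simps)
    moreover have "(sgn f11 * f11) * sqrt (b z * b z - a z * c z) \<ge> 0"
    proof -
      have "sgn f11 * f11 \<ge> 0" by (simp add: sgn_if)
      then show ?thesis using that by (simp add: V0_def)
    qed
    ultimately have "s z * f11 > 0" using that by (simp add: V0_def)
    then show ?thesis by auto
  qed
  have s0: "s 0 = 2 * f11"
    by (simp add: s_def R_def at0 sgn_if)
  define e1 where "e1 z = (s z, - a z)" for z
  define e2 where "e2 z = (- c z, s z)" for z
  define G1 where "G1 z = dd (e1 z) (dd (e1 z) g) z" for z
  define G2 where "G2 z = dd (e2 z) (dd (e2 z) g) z" for z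
  have roots: "dd (e1 z) (dd (e1 z) f) z = 0" "dd (e2 z) (dd (e2 z) f) z = 0" if z: "z \<in> V0" for z
  proof -
    have zW: "z \<in> W" using z V0(3) by blast
    have q: "s z * s z - 2 * b z * s z + a z * c z = 0" using R2[OF z] unfolding s_def by algebra
    show "dd (e1 z) (dd (e1 z) f) z = 0"
      unfolding e1_def hess_expand[OF W(1,3) zW, of "s z" "- a z" "s z" "- a z"] a_def[symmetric] b_def[symmetric] c_def[symmetric]
      using q by algebra
    show "dd (e2 z) (dd (e2 z) f) z = 0"
      unfolding e2_def hess_expand[OF W(1,3) zW, of "- c z" "s z" "- c z" "s z"] a_def[symmetric] b_def[symmetric] c_def[symmetric]
      using q by algebra
  qed
  have G1_eq: "G1 z = a' z * (s z * s z) + (b' z * (- 2 * (s z * a z)) + c' z * (a z * a z))"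
    and G2_eq: "G2 z = a' z * (c z * c z) + (b' z * (- 2 * (s z * c z)) + c' z * (s z * s z))" if z: "z \<in> V0" for z
  proof -
    have zW: "z \<in> W" using z V0(3) by blast
    show "G1 z = a' z * (s z * s z) + (b' z * (- 2 * (s z * a z)) + c' z * (a z * a z))"
      unfolding G1_def e1_def hess_expand[OF W(1,4) zW, of "s z" "- a z" "s z" "- a z"] a'_def[symmetric] b'_def[symmetric] c'_def[symmetric]
      by algebra
    show "G2 z = a' z * (c z * c z) + (b' z * (- 2 * (s z * c z)) + c' z * (s z * s z))"
      unfolding G2_def e2_def hess_expand[OF W(1,4) zW, of "- c z" "s z" "- c z" "s z"] a'_def[symmetric] b'_def[symmetric] c'_def[symmetric]
      by algebra
  qed
  \<comment> \<open>The resultant of two quadratic forms is, up to a factor, the product of the values of one at the roots of the other; here the factor is \<open>s\<^sup>2\<close>, and the identity holds modulo the equation \<open>s\<^sup>2 - 2 b s + a c = 0\<close>.\<close>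
  have para: "z \<in> parabolic_set f g W \<longleftrightarrow> G1 z = 0 \<or> G2 z = 0" if z: "z \<in> V0" for z
  proof -
    have zW: "z \<in> W" using z V0(3) by blast
    have q: "s z * s z - 2 * b z * s z + a z * c z = 0" using R2[OF z] unfolding s_def by algebra
    have "G1 z * G2 z = (s z)\<^sup>2 * ((a z * c' z - c z * a' z)\<^sup>2 - 4 * (b z * c' z - c z * b' z) * (a z * b' z - b z * a' z))"
      unfolding G1_eq[OF z] G2_eq[OF z] using q by algebra
    moreover have "z \<in> parabolic_set f g W \<longleftrightarrow>
      (a z * c' z - c z * a' z)\<^sup>2 - 4 * (b z * c' z - c z * b' z) * (a z * b' z - b z * a' z) = 0"
      using zW by (simp add: parabolic_set_def dx_eq_dd dy_eq_dd a_def b_def c_def a'_def b'_def c'_def)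
    ultimately show ?thesis using s_ne[OF z] by (metis mult_eq_0_iff power_not_zero)
  qed
  \<comment> \<open>All coefficients of \<open>g''\<close> vanish at the origin, so the product rule leaves one term in each of the following sums.\<close>
  have sG: "smooth_on V0 G1" "smooth_on V0 G2"
  proof -
    have "smooth_on V0 (\<lambda>z. a' z * (s z * s z) + (b' z * (- 2 * (s z * a z)) + c' z * (a z * a z)))"
      "smooth_on V0 (\<lambda>z. a' z * (c z * c z) + (b' z * (- 2 * (s z * c z)) + c' z * (s z * s z)))"
      by (intro smooth_on_add smooth_on_mult smooth_on_const sV ss V0(1))+
    note sm' = this
    show "smooth_on V0 G1" by (rule smooth_on_cong[OF V0(1) _ sm'(1)]) (rule G1_eq[symmetric])
    show "smooth_on V0 G2" by (rule smooth_on_cong[OF V0(1) _ sm'(2)]) (rule G2_eq[symmetric])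
  qed
  have dprod: "dd v (\<lambda>z. p1 z * q1 z + (p2 z * q2 z + p3 z * q3 z)) 0 = dd v p1 0 * q1 0 + (dd v p2 0 * q2 0 + dd v p3 0 * q3 0)"
    if "smooth_on V0 p1" "smooth_on V0 p2" "smooth_on V0 p3" "smooth_on V0 q1" "smooth_on V0 q2" "smooth_on V0 q3"
      "p1 0 = 0" "p2 0 = 0" "p3 0 = 0" for p1 p2 p3 q1 q2 q3 :: "real \<times> real \<Rightarrow> real" and v
  proof -
    have d: "p differentiable (at 0)" if "smooth_on V0 p" for p :: "real \<times> real \<Rightarrow> real"
      by (rule smooth_on_differentiable[OF that V0(2)])
    have m: "smooth_on V0 (\<lambda>z. p1 z * q1 z)" "smooth_on V0 (\<lambda>z. p2 z * q2 z)" "smooth_on V0 (\<lambda>z. p3 z * q3 z)"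
      by (intro smooth_on_mult V0(1) that)+
    have m2: "smooth_on V0 (\<lambda>z. p2 z * q2 z + p3 z * q3 z)" by (intro smooth_on_add V0(1) m)
    show ?thesis
      unfolding dd_add[OF d[OF m(1)] d[OF m2]] dd_add[OF d[OF m(2)] d[OF m(3)]]
        dd_mult[OF d[OF that(1)] d[OF that(4)]] dd_mult[OF d[OF that(2)] d[OF that(5)]] dd_mult[OF d[OF that(3)] d[OF that(6)]]
      using that(7-9) by simp
  qed
  have sq: "smooth_on V0 (\<lambda>z. s z * s z)" "smooth_on V0 (\<lambda>z. - 2 * (s z * a z))" "smooth_on V0 (\<lambda>z. a z * a z)"
     "smooth_on V0 (\<lambda>z. c z * c z)" "smooth_on V0 (\<lambda>z. - 2 * (s z * c z))"
    by (intro smooth_on_mult smooth_on_const sV ss V0(1))+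
  have dG1: "dd v G1 0 = 4 * f11\<^sup>2 * dd v a' 0" for v
  proof -
    have "dd v G1 0 = dd v (\<lambda>z. a' z * (s z * s z) + (b' z * (- 2 * (s z * a z)) + c' z * (a z * a z))) 0"
      by (rule dd_cong_open[OF V0(1,2) G1_eq])
    also have "\<dots> = dd v a' 0 * (s 0 * s 0) + (dd v b' 0 * (- 2 * (s 0 * a 0)) + dd v c' 0 * (a 0 * a 0))"
      by (rule dprod[OF sV(4,5,6) sq(1,2,3) at0(4,5,6)])
    finally show ?thesis unfolding at0 s0 by algebra
  qed
  have dG2: "dd v G2 0 = 4 * f11\<^sup>2 * dd v c' 0" for v
  proof -
    have "dd v G2 0 = dd v (\<lambda>z. a' z * (c z * c z) + (b' z * (- 2 * (s z * c z)) + c' z * (s z * s z))) 0"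
      by (rule dd_cong_open[OF V0(1,2) G2_eq])
    also have "\<dots> = dd v a' 0 * (c 0 * c 0) + (dd v b' 0 * (- 2 * (s 0 * c 0)) + dd v c' 0 * (s 0 * s 0))"
      by (rule dprod[OF sV(4,5,6) sq(4,5,1) at0(4,5,6)])
    finally show ?thesis unfolding at0 s0 by algebra
  qed
  have com: "dd u (dd v h) z = dd v (dd u h) z" if "smooth_on W h" "z \<in> W" for u v z and h :: "real \<times> real \<Rightarrow> real"
    by (rule dd_commute[OF W(1) that])
  have yxx: "Dy a' 0 = Dx (Dx (Dy g)) 0"
  proof -
    have "Dy a' 0 = Dx (Dy (Dx g)) 0"
      unfolding a'_def by (rule com[OF smooth_on_dd[OF W(1,4)] W(2)])
    also have "\<dots> = Dx (Dx (Dy g)) 0"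
      by (rule dd_cong_open[OF W(1,2)]) (rule com[OF W(4)])
    finally show ?thesis .
  qed
  have g30: "Dx a' 0 = 6 * taylor_coeff g 3 0" and g21: "Dy a' 0 = 2 * taylor_coeff g 2 1"
    and g12: "Dx c' 0 = 2 * taylor_coeff g 1 2" and g03: "Dy c' 0 = 6 * taylor_coeff g 0 3"
    unfolding yxx by (simp_all add: a'_def c'_def taylor_coeff_dirs numeral_eq_Suc)
  have det: "Dx G1 0 * Dy G2 0 - Dy G1 0 * Dx G2 0 \<noteq> 0"
  proof -
    have "Dx G1 0 * Dy G2 0 - Dy G1 0 * Dx G2 0 = 64 * (f11\<^sup>2)\<^sup>2 *
        (9 * taylor_coeff g 3 0 * taylor_coeff g 0 3 - taylor_coeff g 1 2 * taylor_coeff g 2 1)"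
      unfolding dG1 dG2 g30 g21 g12 g03 by algebra
    then show ?thesis using assms(6,9) by simp
  qed
  \<comment> \<open>The root directions tend to multiples of the coordinate directions, which turns derivatives along them into Taylor coefficients of \<open>g\<close>.\<close>
  have lim: "(h \<longlongrightarrow> h 0) (nhds 0)" if "smooth_on V0 h" for h :: "real \<times> real \<Rightarrow> real"
    using smooth_on_isCont[OF that V0(2)] by (simp add: isCont_def tendsto_nhds_iff)
  have le1: "(e1 \<longlongrightarrow> (2 * f11) *\<^sub>R (1, 0)) (nhds 0)"
    using tendsto_Pair[OF lim[OF ss] tendsto_minus[OF lim[OF sV(1)]]] by (simp add: e1_def[abs_def] s0 at0)
  have le2: "(e2 \<longlongrightarrow> (2 * f11) *\<^sub>R (0, 1)) (nhds 0)"
    using tendsto_Pair[OF tendsto_minus[OF lim[OF sV(3)]] lim[OF ss]] by (simp add: e2_def[abs_def] s0 at0)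
  let ?x = "(2 * f11) *\<^sub>R (1 :: real, 0 :: real)" and ?y = "(2 * f11) *\<^sub>R (0 :: real, 1 :: real)"
  have hf: "dd ?y (dd ?x f) 0 \<noteq> 0" "dd ?x (dd ?y f) 0 \<noteq> 0"
    using hess_expand[OF W(1,3,2), of 0 "2 * f11" "2 * f11" 0] hess_expand[OF W(1,3,2), of "2 * f11" 0 0 "2 * f11"]
      assms(6) jf by simp_all
  have hg: "dd ?y (dd ?x g) 0 = 0" "dd ?x (dd ?y g) 0 = 0"
    using hess_expand[OF W(1,4,2), of 0 "2 * f11" "2 * f11" 0] hess_expand[OF W(1,4,2), of "2 * f11" 0 0 "2 * f11"]
      jg by simp_all
  define q1 where "q1 = dirs [?x, ?x, ?x, ?x] g 0"
  define q2 where "q2 = dirs [?y, ?y, ?y, ?y] g 0"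
  have scale: "dirs [r *\<^sub>R v, r *\<^sub>R v, r *\<^sub>R v, r *\<^sub>R v] g 0 = r ^ 4 * dirs [v, v, v, v] g 0"
    "dirs [r *\<^sub>R v, r *\<^sub>R v, r *\<^sub>R v] g 0 = r ^ 3 * dirs [v, v, v] g 0" for r v
    using dirs_replicate_scale[OF W(1,4,2), of 4 r v] dirs_replicate_scale[OF W(1,4,2), of 3 r v]
    by (simp_all add: numeral_eq_Suc)
  have x4: "dirs [(1, 0), (1, 0), (1, 0), (1, 0)] g 0 \<noteq> 0" and y4: "dirs [(0, 1), (0, 1), (0, 1), (0, 1)] g 0 \<noteq> 0"
    using assms(10,11) by (simp_all add: taylor_coeff_dirs numeral_eq_Suc)
  have q: "q1 \<noteq> 0" "q2 \<noteq> 0" unfolding q1_def q2_def scale using x4 y4 assms(6) by simp_all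
  have cub1: "dirs [?x, ?x, ?x] g 0 \<noteq> 0 \<or> dirs [?y, ?x, ?x] g 0 \<noteq> 0"
  proof -
    have "dirs [?x, ?x, ?x] g 0 = (2 * f11) ^ 3 * (6 * taylor_coeff g 3 0)"
      unfolding scale using g30 by (simp add: a'_def)
    moreover have "dirs [?y, ?x, ?x] g 0 = (2 * f11) ^ 3 * (2 * taylor_coeff g 2 1)"
    proof -
      have eq: "dirs [?x, ?x] g w = (2 * f11) ^ 2 * a' w" if "w \<in> W" for w
        using dirs_replicate_scale[OF W(1,4) that, of 2 "2 * f11" "(1, 0)"] by (simp add: numeral_eq_Suc a'_def)
      have "dirs [?y, ?x, ?x] g 0 = dd ?y (dirs [?x, ?x] g) 0" by (simp only: dirs_simps)
      also have "\<dots> = dd ?y (\<lambda>w. (2 * f11) ^ 2 * a' w) 0"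
        by (rule dd_cong_open[OF W(1,2) eq])
      also have "\<dots> = (2 * f11) ^ 2 * (2 * f11 * Dy a' 0)"
        by (simp only: dd_cmult[OF smooth_on_differentiable[OF sm(4) W(2)]]
            dd_scale_dir[OF smooth_on_differentiable[OF sm(4) W(2)]] real_scaleR_def)
      finally show ?thesis unfolding g21 by algebra
    qed
    ultimately show ?thesis using assms(6,9) by auto
  qed
  have cub2: "dirs [?y, ?y, ?y] g 0 \<noteq> 0 \<or> dirs [?x, ?y, ?y] g 0 \<noteq> 0"
  proof -
    have "dirs [?y, ?y, ?y] g 0 = (2 * f11) ^ 3 * (6 * taylor_coeff g 0 3)"
      unfolding scale using g03 by (simp add: c'_def)
    moreover have "dirs [?x, ?y, ?y] g 0 = (2 * f11) ^ 3 * (2 * taylor_coeff g 1 2)"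
    proof -
      have eq: "dirs [?y, ?y] g w = (2 * f11) ^ 2 * c' w" if "w \<in> W" for w
        using dirs_replicate_scale[OF W(1,4) that, of 2 "2 * f11" "(0, 1)"] by (simp add: numeral_eq_Suc c'_def)
      have "dirs [?x, ?y, ?y] g 0 = dd ?x (dirs [?y, ?y] g) 0" by (simp only: dirs_simps)
      also have "\<dots> = dd ?x (\<lambda>w. (2 * f11) ^ 2 * c' w) 0"
        by (rule dd_cong_open[OF W(1,2) eq])
      also have "\<dots> = (2 * f11) ^ 2 * (2 * f11 * Dx c' 0)"
        by (simp only: dd_cmult[OF smooth_on_differentiable[OF sm(6) W(2)]]
            dd_scale_dir[OF smooth_on_differentiable[OF sm(6) W(2)]] real_scaleR_def)
      finally show ?thesis unfolding g12 by algebra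
    qed
    ultimately show ?thesis using assms(6,9) by auto
  qed
  have ev: "\<forall>\<^sub>F z in nhds 0. z \<in> V0" using V0(1,2) by (rule eventually_nhds_in_open)
  have ev1: "\<forall>\<^sub>F z in nhds 0. G1 z = 0 \<longrightarrow> G2 z \<noteq> 0 \<longrightarrow>
      ordinary_parabolic_point f g W z \<and> parabolic_sign f g W z = sgn (G2 z) * sgn q1"
    using branch_sign[OF W le1 le2 hf(1) hg(1) q(1)[unfolded q1_def] cub1] ev
    by eventually_elim (use roots in \<open>simp add: G1_def G2_def q1_def\<close>)
  have ev2: "\<forall>\<^sub>F z in nhds 0. G2 z = 0 \<longrightarrow> G1 z \<noteq> 0 \<longrightarrow>
      ordinary_parabolic_point f g W z \<and> parabolic_sign f g W z = sgn (G1 z) * sgn q2"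
    using branch_sign[OF W le2 le1 hf(2) hg(2) q(2)[unfolded q2_def] cub2] ev
    by eventually_elim (use roots in \<open>simp add: G1_def G2_def q2_def\<close>)
  from eventually_conj[OF ev eventually_conj[OF ev1 ev2]]
  obtain V where V: "open V" "0 \<in> V" and VP: "\<forall>z\<in>V. z \<in> V0 \<and>
      (G1 z = 0 \<longrightarrow> G2 z \<noteq> 0 \<longrightarrow> ordinary_parabolic_point f g W z \<and> parabolic_sign f g W z = sgn (G2 z) * sgn q1) \<and>
      (G2 z = 0 \<longrightarrow> G1 z \<noteq> 0 \<longrightarrow> ordinary_parabolic_point f g W z \<and> parabolic_sign f g W z = sgn (G1 z) * sgn q2)"
    unfolding eventually_nhds by (elim exE conjE)
  have VV0: "V \<subseteq> V0" using VP by blast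
  have G0: "G1 0 = 0" "G2 0 = 0" using G1_eq[OF V0(2)] G2_eq[OF V0(2)] by (simp_all add: at0)
  obtain \<gamma>1 \<gamma>2 k U where k: "k > 0" and U: "open U" "0 \<in> U" "U \<subseteq> V"
    and arcs: "smooth_arc \<gamma>1" "smooth_arc \<gamma>2" "\<gamma>1 0 = 0" "\<gamma>2 0 = 0"
    and on1: "\<forall>t\<in>{-1<..<1}. \<gamma>1 t \<in> U \<and> G1 (\<gamma>1 t) = 0 \<and> G2 (\<gamma>1 t) = k * t"
    and on2: "\<forall>t\<in>{-1<..<1}. \<gamma>2 t \<in> U \<and> G1 (\<gamma>2 t) = k * t \<and> G2 (\<gamma>2 t) = 0"
    and im: "{z \<in> U. G1 z = 0} = \<gamma>1 ` {-1<..<1}" "{z \<in> U. G2 z = 0} = \<gamma>2 ` {-1<..<1}"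
    by (rule node_branches[OF V smooth_on_subset[OF sG(1) VV0] smooth_on_subset[OF sG(2) VV0] G0 det])
  have cross: "\<gamma>1 ` {-1<..<1} \<inter> \<gamma>2 ` {-1<..<1} = {0}"
  proof (intro equalityI subsetI)
    fix w assume w: "w \<in> \<gamma>1 ` {-1<..<1} \<inter> \<gamma>2 ` {-1<..<1}"
    then obtain t where t: "t \<in> {-1<..<1}" "w = \<gamma>1 t" by blast
    have "G2 w = 0" using w im(2) by blast
    then have "k * t = 0" using on1 t by auto
    then have "t = 0" using k by simp
    then show "w \<in> {0}" using t arcs(3) by simp
  next
    fix w :: "real \<times> real" assume "w \<in> {0}"
    then have "w = 0" by simp
    have "(0::real) \<in> {-1<..<1}" by simp
    then have "\<gamma>1 0 \<in> \<gamma>1 ` {-1<..<1}" "\<gamma>2 0 \<in> \<gamma>2 ` {-1<..<1}" by (rule imageI)+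
    then show "w \<in> \<gamma>1 ` {-1<..<1} \<inter> \<gamma>2 ` {-1<..<1}" using arcs(3,4) \<open>w = 0\<close> by simp
  qed
  have fj: "Dx (Dx f) 0 = 0" "Dy (Dy f) 0 = 0" "Dx (Dy f) 0 \<noteq> 0"
    and gj: "Dx (Dy g) 0 = 0"
    using jf jg assms(6) by simp_all
  obtain \<epsilon>0 \<delta> where \<epsilon>0: "\<epsilon>0 > 0" and \<delta>: "\<delta> > 0" and bif: "\<forall>\<epsilon> z. 0 < \<epsilon> \<longrightarrow> \<epsilon> \<le> \<epsilon>0 \<longrightarrow> norm z < \<delta> \<longrightarrow>
    (z \<in> bifurcation_set H \<epsilon> \<longleftrightarrow> z \<in> parabolic_set f g W)"
    using bifurcation_set_eq_parabolic_set[OF W fj gj x4 y4 assms(12)] by (elim exE conjE)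
  have D: "\<exists>D. open D \<and> 0 \<in> D \<and> bifurcation_set H \<epsilon> \<inter> D = parabolic_set f g W \<inter> D \<and>
            parabolic_set f g W \<inter> D = (\<gamma>1 ` {-1<..<1} \<union> \<gamma>2 ` {-1<..<1}) \<inter> D" if \<epsilon>: "0 < \<epsilon> \<and> \<epsilon> \<le> \<epsilon>0" for \<epsilon>
  proof (intro exI[of _ "U \<inter> ball 0 \<delta>"] conjI)
    show "open (U \<inter> ball 0 \<delta>)" "0 \<in> U \<inter> ball 0 \<delta>" using U \<delta> by auto
    show "bifurcation_set H \<epsilon> \<inter> (U \<inter> ball 0 \<delta>) = parabolic_set f g W \<inter> (U \<inter> ball 0 \<delta>)"
      using bif \<epsilon> by auto
    have "z \<in> parabolic_set f g W \<longleftrightarrow> z \<in> \<gamma>1 ` {-1<..<1} \<union> \<gamma>2 ` {-1<..<1}" if "z \<in> U" for z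
    proof -
      have "z \<in> V0" using that U(3) VV0 by blast
      then show ?thesis using para[of z] that unfolding im[symmetric] by simp
    qed
    then show "parabolic_set f g W \<inter> (U \<inter> ball 0 \<delta>) = (\<gamma>1 ` {-1<..<1} \<union> \<gamma>2 ` {-1<..<1}) \<inter> (U \<inter> ball 0 \<delta>)"
      by blast
  qed
  have sign1: "ordinary_parabolic_point f g W (\<gamma>1 t) \<and> parabolic_sign f g W (\<gamma>1 t) = sgn t * sgn q1"
    if t: "t \<in> {-1<..<1}" "t \<noteq> 0" for t
  proof -
    have "\<gamma>1 t \<in> V" "G1 (\<gamma>1 t) = 0" "G2 (\<gamma>1 t) = k * t" using on1 t(1) U(3) by auto
    then show ?thesis using VP[rule_format, of "\<gamma>1 t"] k t(2) by (simp add: sgn_mult)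
  qed
  have sign2: "ordinary_parabolic_point f g W (\<gamma>2 t) \<and> parabolic_sign f g W (\<gamma>2 t) = sgn t * sgn q2"
    if t: "t \<in> {-1<..<1}" "t \<noteq> 0" for t
  proof -
    have "\<gamma>2 t \<in> V" "G2 (\<gamma>2 t) = 0" "G1 (\<gamma>2 t) = k * t" using on2 t(1) U(3) by auto
    then show ?thesis using VP[rule_format, of "\<gamma>2 t"] k t(2) by (simp add: sgn_mult)
  qed
  have signs: "\<exists>\<sigma>\<in>{-1, 1}.
         (\<forall>t\<in>{-1<..<0}. ordinary_parabolic_point f g W (\<gamma> t) \<and> parabolic_sign f g W (\<gamma> t) = -\<sigma>) \<and>
         (\<forall>t\<in>{0<..<1}. ordinary_parabolic_point f g W (\<gamma> t) \<and> parabolic_sign f g W (\<gamma> t) = \<sigma>)"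
    if "\<And>t. t \<in> {-1<..<1} \<Longrightarrow> t \<noteq> 0 \<Longrightarrow> ordinary_parabolic_point f g W (\<gamma> t) \<and> parabolic_sign f g W (\<gamma> t) = sgn t * sgn q"
      "q \<noteq> 0" for \<gamma> and q :: real
    by (rule bexI[of _ "sgn q"]) (use that in \<open>auto simp: sgn_if\<close>)
  have both: "\<forall>\<gamma>\<in>{\<gamma>1, \<gamma>2}. \<exists>\<sigma>\<in>{-1, 1}.
         (\<forall>t\<in>{-1<..<0}. ordinary_parabolic_point f g W (\<gamma> t) \<and> parabolic_sign f g W (\<gamma> t) = -\<sigma>) \<and>
         (\<forall>t\<in>{0<..<1}. ordinary_parabolic_point f g W (\<gamma> t) \<and> parabolic_sign f g W (\<gamma> t) = \<sigma>)"
    using signs[OF sign1 q(1)] signs[OF sign2 q(2)] by blast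
  show ?thesis
  proof (rule exI[of _ \<gamma>1], rule exI[of _ \<gamma>2], intro conjI)
    show "\<exists>\<epsilon>0>0. \<forall>\<epsilon>. 0 < \<epsilon> \<and> \<epsilon> \<le> \<epsilon>0 \<longrightarrow>
         (\<exists>D. open D \<and> 0 \<in> D \<and>
            bifurcation_set H \<epsilon> \<inter> D = parabolic_set f g W \<inter> D \<and>
            parabolic_set f g W \<inter> D = (\<gamma>1 ` {-1<..<1} \<union> \<gamma>2 ` {-1<..<1}) \<inter> D)"
      using \<epsilon>0 D by blast
  qed (fact arcs cross both)+
qed

end
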